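(* Let $f:M\to(N,g)$ be a pluri-harmonic map from a compact complex manifold $M$ to a Kähler or Riemannian manifold $(N,g)$ with non-positive Riemannian sectional curvature. If $M$ has a Hermitian metric with positive holomorphic sectional curvature, then $f$ is a constant map.
   Context: Manifolds are connected. A smooth map $f:M\to(N,g)$ from a complex manifold to a Riemannian manifold is pluri-harmonic if, in local holomorphic coordinates $z^\alpha$ on $M$ and local coordinates $x^i$ on $N$, $\frac{\partial^2f^i}{\partial z^\alpha\partial\bar z^\beta}+\Gamma^i_{jk}\frac{\partial f^j}{\partial\bar z^\beta}\frac{\partial f^k}{\partial z^\alpha}=0$ for all $i,\alpha,\beta$, with $\Gamma^i_{jk}$ the Christoffel symbols of the Levi-Civita connection. When $(N,g)$ is Kähler, with local holomorphic coordinates $w^i$, $f$ is pluri-harmonic if $\frac{\partial^2f^i}{\partial z^\alpha\partial\bar z^\beta}+\Gamma^i_{jk}\frac{\partial f^j}{\partial z^\alpha}\frac{\partial f^k}{\partial\bar z^\beta}=0$ for all $i,\alpha,\beta$, where $\Gamma^i_{jk}=g^{i\bar\ell}\frac{\partial g_{k\bar\ell}}{\partial w^j}$ are the Christoffel symbols of the Chern connection on $(T^{1,0}N,g)$. A Hermitian metric $h$ on $M$ has positive holomorphic sectional curvature if its Chern curvature $R_{\alpha\bar\beta\gamma\bar\delta}=-\frac{\partial^2h_{\gamma\bar\delta}}{\partial z^\alpha\partial\bar z^\beta}+h^{\mu\bar\nu}\frac{\partial h_{\gamma\bar\nu}}{\partial z^\alpha}\frac{\partial h_{\mu\bar\delta}}{\partial\bar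 z^\beta}$ satisfies $R_{\alpha\bar\beta\gamma\bar\delta}v^\alpha\bar v^\beta v^\gamma\bar v^\delta>0$ for every nonzero $v\in T^{1,0}M$. *)

theory Defs
  imports "HOL-Analysis.Analysis"
begin

section \<open>Smooth functions and partial derivatives\<close>

fun Ck_on :: "nat \<Rightarrow> 'v::real_normed_vector set \<Rightarrow> ('v \<Rightarrow> 'w::real_normed_vector) \<Rightarrow> bool" where
  "Ck_on 0 S f \<longleftrightarrow> continuous_on S f"
| "Ck_on (Suc k) S f \<longleftrightarrow>
     (\<forall>x\<in>S. f differentiable (at x)) \<and> (\<forall>v. Ck_on k S (\<lambda>x. frechet_derivative f (at x) v))"

text \<open>Used only for open sets in finite-dimensional spaces, where testing the derivatives
  along all fixed directions is the usual notion of smoothness.\<close>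

definition smooth_on :: "'v::real_normed_vector set \<Rightarrow> ('v \<Rightarrow> 'w::real_normed_vector) \<Rightarrow> bool" where
  "smooth_on S f \<longleftrightarrow> (\<forall>k. Ck_on k S f)"

definition holo_on :: "(complex^'m) set \<Rightarrow> (complex^'m \<Rightarrow> complex^'n) \<Rightarrow> bool" where
  "holo_on S f \<longleftrightarrow>
     (\<forall>z\<in>S. \<exists>L. (f has_derivative L) (at z) \<and> (\<forall>a v. L (a *s v) = a *s L v))"

definition pd :: "'k \<Rightarrow> (real^'k \<Rightarrow> real) \<Rightarrow> real^'k \<Rightarrow> real" where
  "pd j f x = frechet_derivative f (at x) (axis j 1)"

text \<open>The Wirtinger derivatives \<open>\<partial>/\<partial>z\<^sup>\<alpha>\<close> and \<open>\<partial>/\<partial>\<bar>z\<^sup>\<alpha>\<close> of a (real differentiable) complex-valued function: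
  \<open>axis \<alpha> 1\<close> and \<open>axis \<alpha> \<i>\<close> are the directions of \<open>Re z\<^sup>\<alpha>\<close> and \<open>Im z\<^sup>\<alpha>\<close>.\<close>

definition dz :: "'m \<Rightarrow> (complex^'m \<Rightarrow> complex) \<Rightarrow> complex^'m \<Rightarrow> complex" where
  "dz \<alpha> f z = (frechet_derivative f (at z) (axis \<alpha> 1)
               - \<i> * frechet_derivative f (at z) (axis \<alpha> \<i>)) / 2"

definition dzbar :: "'m \<Rightarrow> (complex^'m \<Rightarrow> complex) \<Rightarrow> complex^'m \<Rightarrow> complex" where
  "dzbar \<alpha> f z = (frechet_derivative f (at z) (axis \<alpha> 1)
                  + \<i> * frechet_derivative f (at z) (axis \<alpha> \<i>)) / 2"

section \<open>Smooth and complex manifolds\<close>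

text \<open>A chart is a pair of its domain and its coordinate map.  The coordinate map matters only
  on the domain.\<close>

type_synonym ('a, 'v) chart = "'a set \<times> ('a \<Rightarrow> 'v)"

definition chart_image :: "('a, 'v) chart \<Rightarrow> 'v set" where
  "chart_image c = snd c ` fst c"

definition chart_inv :: "('a, 'v) chart \<Rightarrow> 'v \<Rightarrow> 'a" where
  "chart_inv c = inv_into (fst c) (snd c)"

definition is_chart :: "'a topology \<Rightarrow> ('a, 'v::topological_space) chart \<Rightarrow> bool" where
  "is_chart X c \<longleftrightarrow> openin X (fst c) \<and> open (chart_image c) \<and>
     homeomorphic_map (subtopology X (fst c)) (top_of_set (chart_image c)) (snd c)"

definition overlap :: "('a, 'v) chart \<Rightarrow> ('a, 'v) chart \<Rightarrow> 'v set" where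
  "overlap c d = snd c ` (fst c \<inter> fst d)"

definition transition :: "('a, 'v) chart \<Rightarrow> ('a, 'v) chart \<Rightarrow> 'v \<Rightarrow> 'v" where
  "transition c d = snd d \<circ> chart_inv c"

definition connected_manifold :: "'a topology \<Rightarrow> ('a, 'v::topological_space) chart set \<Rightarrow> bool" where
  "connected_manifold X A \<longleftrightarrow>
     Hausdorff_space X \<and> second_countable X \<and> connected_space X \<and>
     (\<forall>c\<in>A. is_chart X c) \<and> topspace X = (\<Union>c\<in>A. fst c)"

definition smooth_manifold :: "'a topology \<Rightarrow> ('a, real^'n) chart set \<Rightarrow> bool" where
  "smooth_manifold X A \<longleftrightarrow> connected_manifold X A \<and>
     (\<forall>c\<in>A. \<forall>d\<in>A. smooth_on (overlap c d) (transition c d))"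

definition complex_manifold :: "'a topology \<Rightarrow> ('a, complex^'m) chart set \<Rightarrow> bool" where
  "complex_manifold X A \<longleftrightarrow> connected_manifold X A \<and>
     (\<forall>c\<in>A. \<forall>d\<in>A. holo_on (overlap c d) (transition c d))"

definition map_domain :: "('a, 'v) chart \<Rightarrow> ('b, 'w) chart \<Rightarrow> ('a \<Rightarrow> 'b) \<Rightarrow> 'v set" where
  "map_domain c d f = snd c ` (fst c \<inter> f -` fst d)"

definition local_rep :: "('a, 'v) chart \<Rightarrow> ('b, 'w) chart \<Rightarrow> ('a \<Rightarrow> 'b) \<Rightarrow> 'v \<Rightarrow> 'w" where
  "local_rep c d f = snd d \<circ> f \<circ> chart_inv c"

definition smooth_map ::
  "'a topology \<Rightarrow> ('a, 'v::real_normed_vector) chart set \<Rightarrow>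
   'b topology \<Rightarrow> ('b, 'w::real_normed_vector) chart set \<Rightarrow> ('a \<Rightarrow> 'b) \<Rightarrow> bool" where
  "smooth_map X A Y B f \<longleftrightarrow> continuous_map X Y f \<and>
     (\<forall>c\<in>A. \<forall>d\<in>B. smooth_on (map_domain c d f) (local_rep c d f))"

section \<open>Riemannian metrics\<close>

text \<open>A metric is given by its components in each chart: \<open>g c x $ i $ j = g\<^sub>i\<^sub>j\<close> at the point with
  coordinates \<open>x\<close> in the chart \<open>c\<close>.  The last clause is the transformation law of a tensor.\<close>

definition riemannian_metric ::
  "('a, real^'n) chart set \<Rightarrow> (('a, real^'n) chart \<Rightarrow> real^'n \<Rightarrow> real^'n^'n) \<Rightarrow> bool" where
  "riemannian_metric A g \<longleftrightarrow>
     (\<forall>c\<in>A. smooth_on (chart_image c) (g c) \<and>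
        (\<forall>x\<in>chart_image c. transpose (g c x) = g c x \<and> (\<forall>v. v \<noteq> 0 \<longrightarrow> v \<bullet> (g c x *v v) > 0))) \<and>
     (\<forall>c\<in>A. \<forall>d\<in>A. \<forall>x\<in>overlap c d. \<forall>v w.
        v \<bullet> (g c x *v w) =
        frechet_derivative (transition c d) (at x) v \<bullet>
          (g d (transition c d x) *v frechet_derivative (transition c d) (at x) w))"

text \<open>\<open>christoffel G i j k\<close> is \<open>\<Gamma>\<^sup>i\<^sub>j\<^sub>k\<close>.\<close>

definition christoffel :: "(real^'n \<Rightarrow> real^'n^'n) \<Rightarrow> 'n \<Rightarrow> 'n \<Rightarrow> 'n \<Rightarrow> real^'n \<Rightarrow> real" where
  "christoffel G i j k x =
     (\<Sum>l\<in>UNIV. matrix_inv (G x) $ i $ l *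
        (pd j (\<lambda>y. G y $ k $ l) x + pd k (\<lambda>y. G y $ j $ l) x - pd l (\<lambda>y. G y $ j $ k) x)) / 2"

text \<open>\<open>riemann_curv G l i j k\<close> is the \<open>l\<close>-th component of
  \<open>R(\<partial>\<^sub>i,\<partial>\<^sub>j)\<partial>\<^sub>k = \<nabla>\<^sub>i\<nabla>\<^sub>j\<partial>\<^sub>k - \<nabla>\<^sub>j\<nabla>\<^sub>i\<partial>\<^sub>k\<close>.\<close>

definition riemann_curv :: "(real^'n \<Rightarrow> real^'n^'n) \<Rightarrow> 'n \<Rightarrow> 'n \<Rightarrow> 'n \<Rightarrow> 'n \<Rightarrow> real^'n \<Rightarrow> real" where
  "riemann_curv G l i j k x =
     pd i (christoffel G l j k) x - pd j (christoffel G l i k) x +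
     (\<Sum>s\<in>UNIV. christoffel G l i s x * christoffel G s j k x
               - christoffel G l j s x * christoffel G s i k x)"

text \<open>\<open>K(X,Y) = \<langle>R(X,Y)Y, X\<rangle> / (|X|\<^sup>2 |Y|\<^sup>2 - \<langle>X,Y\<rangle>\<^sup>2)\<close>\<close>

definition sectional_curvature :: "(real^'n \<Rightarrow> real^'n^'n) \<Rightarrow> real^'n \<Rightarrow> real^'n \<Rightarrow> real^'n \<Rightarrow> real" where
  "sectional_curvature G x X Y =
     (\<Sum>m\<in>UNIV. \<Sum>l\<in>UNIV. \<Sum>i\<in>UNIV. \<Sum>j\<in>UNIV. \<Sum>k\<in>UNIV.
        G x $ l $ m * riemann_curv G l i j k x * X $ i * Y $ j * Y $ k * X $ m) /
     ((X \<bullet> (G x *v X)) * (Y \<bullet> (G x *v Y)) - (X \<bullet> (G x *v Y))\<^sup>2)"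

definition nonpos_sectional_curvature ::
  "('a, real^'n) chart set \<Rightarrow> (('a, real^'n) chart \<Rightarrow> real^'n \<Rightarrow> real^'n^'n) \<Rightarrow> bool" where
  "nonpos_sectional_curvature A g \<longleftrightarrow>
     (\<forall>c\<in>A. \<forall>x\<in>chart_image c. \<forall>X Y. X \<noteq> Y \<and> independent {X, Y} \<longrightarrow>
        sectional_curvature (g c) x X Y \<le> 0)"

section \<open>Hermitian and Kaehler metrics\<close>

text \<open>As above, \<open>h c z $ i $ j = h\<^sub>i\<^sub>\<bar>\<^sub>j\<close>.\<close>

definition herm_form :: "complex^'m^'m \<Rightarrow> complex^'m \<Rightarrow> complex^'m \<Rightarrow> complex" where
  "herm_form H v w = (\<Sum>i\<in>UNIV. \<Sum>j\<in>UNIV. H $ i $ j * v $ i * cnj (w $ j))"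

definition hermitian_metric ::
  "('a, complex^'m) chart set \<Rightarrow> (('a, complex^'m) chart \<Rightarrow> complex^'m \<Rightarrow> complex^'m^'m) \<Rightarrow> bool" where
  "hermitian_metric A h \<longleftrightarrow>
     (\<forall>c\<in>A. smooth_on (chart_image c) (h c) \<and>
        (\<forall>z\<in>chart_image c. (\<forall>i j. h c z $ j $ i = cnj (h c z $ i $ j)) \<and>
           (\<forall>v. v \<noteq> 0 \<longrightarrow> Re (herm_form (h c z) v v) > 0))) \<and>
     (\<forall>c\<in>A. \<forall>d\<in>A. \<forall>z\<in>overlap c d. \<forall>v w.
        herm_form (h c z) v w =
        herm_form (h d (transition c d z)) (frechet_derivative (transition c d) (at z) v)
          (frechet_derivative (transition c d) (at z) w))"

text \<open>In both definitions below \<open>h\<^sup>\<mu>\<^sup>\<bar>\<^sup>\<nu>\<close>, determined by \<open>\<Sum>\<^sub>\<nu> h\<^sup>\<mu>\<^sup>\<bar>\<^sup>\<nu> h\<^sub>\<lambda>\<^sub>\<bar>\<^sub>\<nu> = \<delta>\<^sup>\<mu>\<^sub>\<lambda>\<close>, is the entry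
  \<open>(\<nu>, \<mu>)\<close> of the inverse matrix.\<close>

definition chern_curv ::
  "(complex^'m \<Rightarrow> complex^'m^'m) \<Rightarrow> 'm \<Rightarrow> 'm \<Rightarrow> 'm \<Rightarrow> 'm \<Rightarrow> complex^'m \<Rightarrow> complex" where
  "chern_curv H \<alpha> \<beta> \<gamma> \<delta> z =
     - dz \<alpha> (dzbar \<beta> (\<lambda>y. H y $ \<gamma> $ \<delta>)) z +
     (\<Sum>\<mu>\<in>UNIV. \<Sum>\<nu>\<in>UNIV. matrix_inv (H z) $ \<nu> $ \<mu> *
        dz \<alpha> (\<lambda>y. H y $ \<gamma> $ \<nu>) z * dzbar \<beta> (\<lambda>y. H y $ \<mu> $ \<delta>) z)"

definition chern_christoffel ::
  "(complex^'n \<Rightarrow> complex^'n^'n) \<Rightarrow> 'n \<Rightarrow> 'n \<Rightarrow> 'n \<Rightarrow> complex^'n \<Rightarrow> complex" where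
  "chern_christoffel G i j k w =
     (\<Sum>l\<in>UNIV. matrix_inv (G w) $ l $ i * dz j (\<lambda>y. G y $ k $ l) w)"

text \<open>The sum below is automatically real.\<close>

definition positive_HSC ::
  "('a, complex^'m) chart set \<Rightarrow> (('a, complex^'m) chart \<Rightarrow> complex^'m \<Rightarrow> complex^'m^'m) \<Rightarrow> bool" where
  "positive_HSC A h \<longleftrightarrow>
     (\<forall>c\<in>A. \<forall>z\<in>chart_image c. \<forall>v. v \<noteq> 0 \<longrightarrow>
        Re (\<Sum>\<alpha>\<in>UNIV. \<Sum>\<beta>\<in>UNIV. \<Sum>\<gamma>\<in>UNIV. \<Sum>\<delta>\<in>UNIV.
              chern_curv (h c) \<alpha> \<beta> \<gamma> \<delta> z * v $ \<alpha> * cnj (v $ \<beta>) * v $ \<gamma> * cnj (v $ \<delta>)) > 0)"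

text \<open>The Riemannian metric underlying a Hermitian metric: a real tangent vector
  \<open>\<Sum>\<^sub>i X\<^sup>i \<partial>\<^sub>i + \<Sum>\<^sub>i cnj X\<^sup>i \<partial>\<^sub>\<bar>\<^sub>i\<close> is identified with \<open>X\<close>, and \<open>g\<^sub>i\<^sub>\<bar>\<^sub>j = g(\<partial>\<^sub>i, \<partial>\<^sub>\<bar>\<^sub>j)\<close> for the
  complex bilinear extension of \<open>g\<close>.\<close>

definition real_form :: "complex^'n^'n \<Rightarrow> complex^'n \<Rightarrow> complex^'n \<Rightarrow> real" where
  "real_form G X Y = 2 * Re (herm_form G X Y)"

text \<open>The form \<open>\<omega>(X,Y) = g(JX,Y)\<close>, in the coordinates of a chart, and its exterior derivative,
  evaluated on constant vector fields (whose brackets vanish).\<close>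

definition kaehler_form :: "complex^'n^'n \<Rightarrow> complex^'n \<Rightarrow> complex^'n \<Rightarrow> real" where
  "kaehler_form G X Y = real_form G (\<i> *s X) Y"

definition d_kaehler_form ::
  "(complex^'n \<Rightarrow> complex^'n^'n) \<Rightarrow> complex^'n \<Rightarrow> complex^'n \<Rightarrow> complex^'n \<Rightarrow> complex^'n \<Rightarrow> real" where
  "d_kaehler_form G w X Y Z =
     frechet_derivative (\<lambda>u. kaehler_form (G u) Y Z) (at w) X +
     frechet_derivative (\<lambda>u. kaehler_form (G u) Z X) (at w) Y +
     frechet_derivative (\<lambda>u. kaehler_form (G u) X Y) (at w) Z"

definition kaehler_metric ::
  "('a, complex^'n) chart set \<Rightarrow> (('a, complex^'n) chart \<Rightarrow> complex^'n \<Rightarrow> complex^'n^'n) \<Rightarrow> bool" where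
  "kaehler_metric A g \<longleftrightarrow> hermitian_metric A g \<and>
     (\<forall>c\<in>A. \<forall>w\<in>chart_image c. \<forall>X Y Z. d_kaehler_form (g c) w X Y Z = 0)"

text \<open>Real coordinates: \<open>Inl i\<close> and \<open>Inr i\<close> index the real and imaginary part of the \<open>i\<close>-th
  holomorphic coordinate.\<close>

definition realify :: "complex^'n \<Rightarrow> real^('n + 'n)" where
  "realify w = (\<chi> a. case a of Inl i \<Rightarrow> Re (w $ i) | Inr i \<Rightarrow> Im (w $ i))"

definition complexify :: "real^('n + 'n) \<Rightarrow> complex^'n" where
  "complexify x = (\<chi> i. Complex (x $ Inl i) (x $ Inr i))"

definition underlying_atlas :: "('a, complex^'n) chart set \<Rightarrow> ('a, real^('n + 'n)) chart set" where
  "underlying_atlas A = (\<lambda>c. (fst c, realify \<circ> snd c)) ` A"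

definition underlying_metric ::
  "(('a, complex^'n) chart \<Rightarrow> complex^'n \<Rightarrow> complex^'n^'n) \<Rightarrow>
   ('a, real^('n + 'n)) chart \<Rightarrow> real^('n + 'n) \<Rightarrow> real^('n + 'n)^('n + 'n)" where
  "underlying_metric g c x =
     (\<chi> a b. real_form (g (fst c, complexify \<circ> snd c) (complexify x))
              (complexify (axis a 1)) (complexify (axis b 1)))"

section \<open>Pluri-harmonic maps\<close>

definition pluriharmonic_riemannian ::
  "'a topology \<Rightarrow> ('a, complex^'m) chart set \<Rightarrow> 'b topology \<Rightarrow> ('b, real^'n) chart set \<Rightarrow>
   (('b, real^'n) chart \<Rightarrow> real^'n \<Rightarrow> real^'n^'n) \<Rightarrow> ('a \<Rightarrow> 'b) \<Rightarrow> bool" where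
  "pluriharmonic_riemannian M A N B g f \<longleftrightarrow> smooth_map M A N B f \<and>
     (\<forall>c\<in>A. \<forall>d\<in>B. \<forall>z\<in>map_domain c d f. \<forall>i \<alpha> \<beta>.
        let F = (\<lambda>i z. complex_of_real (local_rep c d f z $ i)) in
        dz \<alpha> (dzbar \<beta> (F i)) z +
        (\<Sum>j\<in>UNIV. \<Sum>k\<in>UNIV. complex_of_real (christoffel (g d) i j k (local_rep c d f z)) *
            dzbar \<beta> (F j) z * dz \<alpha> (F k) z) = 0)"

definition pluriharmonic_kaehler ::
  "'a topology \<Rightarrow> ('a, complex^'m) chart set \<Rightarrow> 'b topology \<Rightarrow> ('b, complex^'n) chart set \<Rightarrow>
   (('b, complex^'n) chart \<Rightarrow> complex^'n \<Rightarrow> complex^'n^'n) \<Rightarrow> ('a \<Rightarrow> 'b) \<Rightarrow> bool" where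
  "pluriharmonic_kaehler M A N B g f \<longleftrightarrow> smooth_map M A N B f \<and>
     (\<forall>c\<in>A. \<forall>d\<in>B. \<forall>z\<in>map_domain c d f. \<forall>i \<alpha> \<beta>.
        let F = (\<lambda>i z. local_rep c d f z $ i) in
        dz \<alpha> (dzbar \<beta> (F i)) z +
        (\<Sum>j\<in>UNIV. \<Sum>k\<in>UNIV. chern_christoffel (g d) i j k (local_rep c d f z) *
            dz \<alpha> (F j) z * dzbar \<beta> (F k) z) = 0)"

end

theory Submission
  imports Defs
begin

text \<open>
  Suppose that \<open>f\<close> is not constant.  For a point of \<open>M\<close> and a nonzero holomorphic tangent vector \<open>v\<close>
  there, consider the ratio of \<open>|\<partial>f(v)|\<^sup>2\<close>, measured with \<open>g\<close>, to \<open>h(v, v)\<close>.  It does not depend on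
  charts and is homogeneous of degree 0 in \<open>v\<close>, so by compactness of \<open>M\<close> and of the unit spheres it
  attains a maximum \<open>l\<close> at some \<open>(p, v)\<close> (\<open>ratio_attains_max\<close>).  If \<open>l \<le> 0\<close>, the differential of \<open>f\<close>
  vanishes and \<open>f\<close> is constant since \<open>M\<close> is connected (\<open>constant_if_energy_zero\<close>).

  If \<open>l > 0\<close>, restrict everything to a holomorphic disc \<open>\<gamma>(t) = p + t v + (t\<^sup>2/2) w\<close> in a chart and
  compare \<open>|\<partial>f(\<gamma>')|\<^sup>2\<close> with \<open>l h(\<gamma>', \<gamma>')\<close> as functions of the complex variable \<open>t\<close>.  Their difference
  is at most 0 and vanishes at \<open>t = 0\<close>, hence its Laplacian at 0 is at most 0.  On the other hand:

  \<^item> \<open>f \<circ> \<gamma>\<close> is a harmonic map from a flat plane domain, because pluri-harmonicity is inherited by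
    holomorphic discs.  The Bochner formula for the energy density of such a map consists of squares
    and of curvature terms \<open>- \<langle>R(X, Y) Y, X\<rangle>\<close>, so the density is subharmonic when the sectional curvature is
    non-positive (\<open>energy_subharmonic\<close>).

  \<^item> For a suitable \<open>w\<close>, the Laplacian of \<open>h(\<gamma>', \<gamma>')\<close> at 0 is \<open>- 4 R(v, \<bar>v, v, \<bar>v)\<close>, where \<open>R\<close> is the
    Chern curvature, and this is negative (\<open>disc_hermitian_norm_superharmonic\<close>).

  So the Laplacian of the difference at 0 is positive, which is a contradiction
  (\<open>no_positive_energy_maximum\<close>).

  The argument needs only a few properties of the target geometry, collected in the locale
  \<open>nonpos_connection\<close>: a metric together with a torsion-free connection that preserves it and whose
  curvature has the right sign.  For a Riemannian target this is the Levi-Civita connection in real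
  coordinates.  For a Kaehler target it is the Chern connection in holomorphic coordinates: the Kaehler
  condition makes it torsion-free, so that by uniqueness it is the Levi-Civita connection of the
  underlying real metric, whose sectional curvature is the one in the hypothesis.
\<close>

section \<open>Calculus of smooth functions\<close>

abbreviation \<D> :: "('v::real_normed_vector \<Rightarrow> 'w::real_normed_vector) \<Rightarrow> 'v \<Rightarrow> 'v \<Rightarrow> 'w" where
  "\<D> f x \<equiv> frechet_derivative f (at x)"

abbreviation laplacian :: "(complex \<Rightarrow> 'w::real_normed_vector) \<Rightarrow> complex \<Rightarrow> 'w" where
  "laplacian \<phi> t \<equiv> \<D> (\<lambda>t. \<D> \<phi> t 1) t 1 + \<D> (\<lambda>t. \<D> \<phi> t \<i>) t \<i>"

lemma has_derivative_fderiv: "f differentiable (at x) \<Longrightarrow> (f has_derivative \<D> f x) (at x)"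
  using frechet_derivative_works by blast

lemma fderivI: "(f has_derivative f') (at x) \<Longrightarrow> \<D> f x = f'"
  by (rule frechet_derivative_at[symmetric])

lemma has_derivative_cong_open:
  assumes "open S" "x \<in> S" "\<And>y. y \<in> S \<Longrightarrow> f y = g y"
  shows "(f has_derivative f') (at x) \<longleftrightarrow> (g has_derivative f') (at x)"
  using has_derivative_transform_within_open[of f f' x UNIV S g]
    has_derivative_transform_within_open[of g f' x UNIV S f] assms by metis

lemma fderiv_cong_open:
  assumes "open S" "x \<in> S" "\<And>y. y \<in> S \<Longrightarrow> f y = g y"
  shows "\<D> f x = \<D> g x"
  unfolding frechet_derivative_def using has_derivative_cong_open[OF assms] by simp

lemma differentiable_cong_open:
  assumes "open S" "x \<in> S" "\<And>y. y \<in> S \<Longrightarrow> f y = g y"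
  shows "f differentiable (at x) \<longleftrightarrow> g differentiable (at x)"
  unfolding differentiable_def using has_derivative_cong_open[OF assms] by simp

lemma fderiv_bounded_linear:
  assumes "bounded_linear L" "f differentiable (at x)"
  shows "(\<lambda>x. L (f x)) differentiable (at x)" "\<D> (\<lambda>x. L (f x)) x v = L (\<D> f x v)"
proof -
  have *: "((\<lambda>x. L (f x)) has_derivative (\<lambda>v. L (\<D> f x v))) (at x)"
    by (rule bounded_linear.has_derivative[OF assms(1) has_derivative_fderiv[OF assms(2)]])
  show "(\<lambda>x. L (f x)) differentiable (at x)" using * differentiable_def by blast
  show "\<D> (\<lambda>x. L (f x)) x v = L (\<D> f x v)" by (simp add: fderivI[OF *])
qed

lemma fderiv_compose_at:
  assumes "g differentiable (at x)" "f differentiable (at (g x))"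
  shows "\<D> (\<lambda>x. f (g x)) x v = \<D> f (g x) (\<D> g x v)"
  using frechet_derivative_compose[OF assms] by (simp add: o_def)

lemma Ck_on_cong:
  assumes "open S" "\<And>x. x \<in> S \<Longrightarrow> f x = g x"
  shows "Ck_on k S f \<longleftrightarrow> Ck_on k S g"
  using assms(2)
proof (induction k arbitrary: f g)
  case 0
  then show ?case by (auto cong: continuous_on_cong)
next
  case (Suc k)
  have "\<And>x. x \<in> S \<Longrightarrow> \<D> f x = \<D> g x"
    using fderiv_cong_open[OF assms(1)] Suc.prems by blast
  moreover have "\<And>x. x \<in> S \<Longrightarrow> f differentiable (at x) \<longleftrightarrow> g differentiable (at x)"
    using differentiable_cong_open[OF assms(1)] Suc.prems by blast
  ultimately show ?case using Suc.IH by (metis (no_types, lifting) Ck_on.simps(2))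
qed

lemma Ck_on_SucD: "Ck_on (Suc k) S f \<Longrightarrow> Ck_on k S f"
proof (induction k arbitrary: f)
  case 0
  then show ?case
    by (auto intro!: differentiable_imp_continuous_on differentiable_at_imp_differentiable_on)
qed auto

lemma Ck_on_subset: "Ck_on k T f \<Longrightarrow> S \<subseteq> T \<Longrightarrow> Ck_on k S f"
proof (induction k arbitrary: f)
  case 0
  then show ?case by (auto intro: continuous_on_subset)
next
  case (Suc k)
  then show ?case by auto
qed

lemma Ck_on_const: "Ck_on k S (\<lambda>x. c)"
  by (induction k arbitrary: c) auto

lemma Ck_on_add:
  assumes "open S"
  shows "Ck_on k S f \<Longrightarrow> Ck_on k S g \<Longrightarrow> Ck_on k S (\<lambda>x. f x + g x)"
proof (induction k arbitrary: f g)
  case 0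
  then show ?case by (auto intro: continuous_on_add)
next
  case (Suc k)
  have "Ck_on k S (\<lambda>x. \<D> (\<lambda>x. f x + g x) x v)" for v
  proof (subst Ck_on_cong[OF assms])
    show "Ck_on k S (\<lambda>x. \<D> f x v + \<D> g x v)" using Suc by auto
    show "\<D> (\<lambda>x. f x + g x) x v = \<D> f x v + \<D> g x v" if "x \<in> S" for x
      using that Suc.prems by (subst fderivI[OF has_derivative_add[OF has_derivative_fderiv has_derivative_fderiv]]) auto
  qed
  then show ?case using Suc.prems by auto
qed

lemma Ck_on_sum:
  assumes "open S" "\<And>i. i \<in> I \<Longrightarrow> Ck_on k S (f i)"
  shows "Ck_on k S (\<lambda>x. \<Sum>i\<in>I. f i x)"
  using assms(2)
  by (induction I rule: infinite_finite_induct) (auto intro: Ck_on_const Ck_on_add assms(1))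

lemma Ck_on_bounded_linear:
  assumes "open S" "bounded_linear L"
  shows "Ck_on k S f \<Longrightarrow> Ck_on k S (\<lambda>x. L (f x))"
proof (induction k arbitrary: f)
  case 0
  then show ?case using assms(2) by (auto intro: bounded_linear.continuous_on)
next
  case (Suc k)
  have "Ck_on k S (\<lambda>x. \<D> (\<lambda>x. L (f x)) x v)" for v
    using Suc by (subst Ck_on_cong[OF assms(1), where g = "\<lambda>x. L (\<D> f x v)"])
      (simp_all add: fderiv_bounded_linear(2)[OF assms(2)])
  then show ?case using Suc.prems fderiv_bounded_linear(1)[OF assms(2)] by auto
qed

lemma Ck_on_bilinear:
  assumes "open S" "bounded_bilinear B"
  shows "Ck_on k S f \<Longrightarrow> Ck_on k S g \<Longrightarrow> Ck_on k S (\<lambda>x. B (f x) (g x))"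
proof (induction k arbitrary: f g)
  case 0
  then show ?case using assms(2) by (auto intro: bounded_bilinear.continuous_on)
next
  case (Suc k)
  have *: "((\<lambda>x. B (f x) (g x)) has_derivative (\<lambda>v. B (f x) (\<D> g x v) + B (\<D> f x v) (g x))) (at x)"
    if "x \<in> S" for x
    using that Suc.prems
    by (intro bounded_bilinear.FDERIV[OF assms(2)] has_derivative_fderiv) auto
  have "Ck_on k S (\<lambda>x. \<D> (\<lambda>x. B (f x) (g x)) x v)" for v
  proof (subst Ck_on_cong[OF assms(1)])
    show "Ck_on k S (\<lambda>x. B (f x) (\<D> g x v) + B (\<D> f x v) (g x))"
      using Suc.prems Suc.prems[THEN Ck_on_SucD] by (intro Ck_on_add assms(1) Suc.IH) auto
  qed (simp add: fderivI[OF *])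
  then show ?case using * by (auto simp: differentiable_def)
qed

lemma fderiv_basis:
  fixes f :: "'v::euclidean_space \<Rightarrow> 'w::real_normed_vector"
  assumes "f differentiable (at x)"
  shows "\<D> f x v = (\<Sum>b\<in>Basis. (v \<bullet> b) *\<^sub>R \<D> f x b)"
proof -
  have l: "linear (\<D> f x)" by (rule linear_frechet_derivative[OF assms])
  have "\<D> f x v = \<D> f x (\<Sum>b\<in>Basis. (v \<bullet> b) *\<^sub>R b)" by (simp add: euclidean_representation)
  then show ?thesis by (simp add: linear_sum[OF l] linear_cmul[OF l])
qed

text \<open>Expanding the outer derivative in a basis turns the chain rule into a finite sum of products
  of an inner derivative and a composition one order lower, which is what makes the induction work.\<close>
lemma Ck_on_compose:
  fixes f :: "'v::euclidean_space \<Rightarrow> 'w::real_normed_vector"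
  assumes "open S" "g ` S \<subseteq> T"
  shows "Ck_on k T f \<Longrightarrow> Ck_on k S g \<Longrightarrow> Ck_on k S (\<lambda>x. f (g x))"
proof (induction k arbitrary: f)
  case 0
  then show ?case using assms by (auto intro: continuous_on_compose2)
next
  case (Suc k)
  have df: "g differentiable (at x)" "f differentiable (at (g x))" if "x \<in> S" for x
    using Suc.prems that assms(2) by auto
  have "Ck_on k S (\<lambda>x. \<D> (\<lambda>x. f (g x)) x v)" for v
  proof (subst Ck_on_cong[OF assms(1)])
    show "Ck_on k S (\<lambda>x. \<Sum>b\<in>Basis. (\<D> g x v \<bullet> b) *\<^sub>R \<D> f (g x) b)"
      using Suc.prems Suc.prems(2)[THEN Ck_on_SucD]
      by (intro Ck_on_sum Ck_on_bilinear[OF _ bounded_bilinear_scaleR] Suc.IH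
          Ck_on_bounded_linear[OF _ bounded_linear_inner_left] assms(1)) auto
    show "\<D> (\<lambda>x. f (g x)) x v = (\<Sum>b\<in>Basis. (\<D> g x v \<bullet> b) *\<^sub>R \<D> f (g x) b)" if "x \<in> S" for x
      using df[OF that] by (simp add: fderiv_compose_at fderiv_basis[symmetric])
  qed
  moreover have "(\<lambda>x. f (g x)) differentiable (at x)" if "x \<in> S" for x
    by (rule differentiable_compose[OF df(2)[OF that] df(1)[OF that]])
  ultimately show ?case by simp
qed

lemma Ck_on_linear:
  assumes L: "bounded_linear L"
  shows "Ck_on k S L"
proof -
  have "\<D> L x = L" for x using L by (intro fderivI bounded_linear_imp_has_derivative)
  then show ?thesis
    using L by (cases k) (simp_all add: linear_continuous_on Ck_on_const bounded_linear_imp_differentiable)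
qed

lemma smooth_onD:
  assumes "smooth_on S f" "x \<in> S"
  shows "f differentiable (at x)"
  using assms(1)[unfolded smooth_on_def, rule_format, of "Suc 0"] assms(2) by simp

lemma smooth_on_fderiv:
  assumes "smooth_on S f"
  shows "smooth_on S (\<lambda>x. \<D> f x v)"
proof -
  have "Ck_on (Suc k) S f" for k using assms unfolding smooth_on_def by blast
  then show ?thesis unfolding smooth_on_def by simp
qed

lemma smooth_on_continuous: "smooth_on S f \<Longrightarrow> continuous_on S f"
  unfolding smooth_on_def by (drule spec[of _ 0]) simp

lemma smooth_on_subset: "smooth_on T f \<Longrightarrow> S \<subseteq> T \<Longrightarrow> smooth_on S f"
  unfolding smooth_on_def using Ck_on_subset by blast

lemma smooth_on_compose:
  fixes f :: "'v::euclidean_space \<Rightarrow> 'w::real_normed_vector"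
  assumes "open S" "g ` S \<subseteq> T" "smooth_on T f" "smooth_on S g"
  shows "smooth_on S (\<lambda>x. f (g x))"
  using assms(3,4) by (simp add: smooth_on_def Ck_on_compose[OF assms(1,2)])

lemma smooth_on_bounded_linear:
  "open S \<Longrightarrow> bounded_linear L \<Longrightarrow> smooth_on S f \<Longrightarrow> smooth_on S (\<lambda>x. L (f x))"
  by (simp add: smooth_on_def Ck_on_bounded_linear)

lemma smooth_on_bilinear:
  "open S \<Longrightarrow> bounded_bilinear B \<Longrightarrow> smooth_on S f \<Longrightarrow> smooth_on S g \<Longrightarrow> smooth_on S (\<lambda>x. B (f x) (g x))"
  by (simp add: smooth_on_def Ck_on_bilinear)

lemma smooth_on_add:
  "open S \<Longrightarrow> smooth_on S f \<Longrightarrow> smooth_on S g \<Longrightarrow> smooth_on S (\<lambda>x. f x + g x)"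
  by (simp add: smooth_on_def Ck_on_add)

lemma smooth_on_sum:
  "open S \<Longrightarrow> (\<And>i. i \<in> I \<Longrightarrow> smooth_on S (f i)) \<Longrightarrow> smooth_on S (\<lambda>x. \<Sum>i\<in>I. f i x)"
  by (simp add: smooth_on_def Ck_on_sum)

lemma smooth_on_const: "smooth_on S (\<lambda>x. c)"
  by (simp add: smooth_on_def Ck_on_const)

lemma smooth_on_linear: "bounded_linear L \<Longrightarrow> smooth_on S L"
  by (simp add: smooth_on_def Ck_on_linear)

lemma has_real_derivative_along_line:
  fixes k :: "'v::real_normed_vector \<Rightarrow> real"
  assumes "k differentiable (at (p + s *\<^sub>R d))"
  shows "((\<lambda>s. k (p + s *\<^sub>R d)) has_real_derivative \<D> k (p + s *\<^sub>R d) d) (at s)"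
proof -
  have "((\<lambda>s. k (p + s *\<^sub>R d)) has_derivative (\<lambda>r. \<D> k (p + s *\<^sub>R d) (r *\<^sub>R d))) (at s)"
    by (rule has_derivative_compose[of "\<lambda>s. p + s *\<^sub>R d" _ _ _ k, OF _ has_derivative_fderiv[OF assms]])
      (auto intro!: derivative_eq_intros)
  moreover have "\<D> k (p + s *\<^sub>R d) (r *\<^sub>R d) = \<D> k (p + s *\<^sub>R d) d * r" for r
    using linear_cmul[OF linear_frechet_derivative[OF assms]] by simp
  moreover have "(*) (\<D> k (p + s *\<^sub>R d) d) = (\<lambda>r. \<D> k (p + s *\<^sub>R d) d * r)" by auto
  ultimately show ?thesis by (simp only: has_field_derivative_def)
qed

text \<open>Two applications of the mean value theorem.  The left-hand side is symmetric in \<open>a\<close> and \<open>b\<close>,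
  which is the reason why mixed derivatives commute.\<close>
lemma second_difference:
  fixes f :: "'v::real_normed_vector \<Rightarrow> real"
  assumes s: "0 < s"
    and S: "\<And>\<sigma> \<tau>. 0 \<le> \<sigma> \<Longrightarrow> \<sigma> \<le> s \<Longrightarrow> 0 \<le> \<tau> \<Longrightarrow> \<tau> \<le> s \<Longrightarrow> x + \<sigma> *\<^sub>R a + \<tau> *\<^sub>R b \<in> S"
    and d1: "\<And>y. y \<in> S \<Longrightarrow> f differentiable (at y)"
    and d2: "\<And>y. y \<in> S \<Longrightarrow> (\<lambda>y. \<D> f y a) differentiable (at y)"
  shows "\<exists>\<sigma> \<tau>. 0 \<le> \<sigma> \<and> \<sigma> \<le> s \<and> 0 \<le> \<tau> \<and> \<tau> \<le> s \<and>
    f (x + s *\<^sub>R a + s *\<^sub>R b) - f (x + s *\<^sub>R a) - f (x + s *\<^sub>R b) + f x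
      = s * s * \<D> (\<lambda>y. \<D> f y a) (x + \<sigma> *\<^sub>R a + \<tau> *\<^sub>R b) b"
proof -
  define \<phi> where "\<phi> \<sigma> = f ((x + s *\<^sub>R b) + \<sigma> *\<^sub>R a) - f (x + \<sigma> *\<^sub>R a)" for \<sigma>
  have mem: "(x + s *\<^sub>R b) + \<sigma> *\<^sub>R a \<in> S" "x + \<sigma> *\<^sub>R a \<in> S" if "0 \<le> \<sigma>" "\<sigma> \<le> s" for \<sigma>
    using S[OF that, of s] S[OF that, of 0] s by (auto simp: algebra_simps)
  have "\<exists>\<sigma>. 0 < \<sigma> \<and> \<sigma> < s \<and> \<phi> s - \<phi> 0 = (s - 0) *
      (\<D> f ((x + s *\<^sub>R b) + \<sigma> *\<^sub>R a) a - \<D> f (x + \<sigma> *\<^sub>R a) a)"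
    using s unfolding \<phi>_def by (intro MVT2 DERIV_diff has_real_derivative_along_line d1 mem) auto
  then obtain \<sigma> where \<sigma>: "0 < \<sigma>" "\<sigma> < s"
    and e1: "\<phi> s - \<phi> 0 = s * (\<D> f ((x + s *\<^sub>R b) + \<sigma> *\<^sub>R a) a - \<D> f (x + \<sigma> *\<^sub>R a) a)" by auto
  have "\<exists>\<tau>. 0 < \<tau> \<and> \<tau> < s \<and>
      \<D> f ((x + \<sigma> *\<^sub>R a) + s *\<^sub>R b) a - \<D> f ((x + \<sigma> *\<^sub>R a) + 0 *\<^sub>R b) a
      = (s - 0) * \<D> (\<lambda>y. \<D> f y a) ((x + \<sigma> *\<^sub>R a) + \<tau> *\<^sub>R b) b"
    using s \<sigma> by (intro MVT2 has_real_derivative_along_line[of "\<lambda>y. \<D> f y a"] d2 S) auto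
  then obtain \<tau> where \<tau>: "0 < \<tau>" "\<tau> < s"
    and e2: "\<D> f ((x + \<sigma> *\<^sub>R a) + s *\<^sub>R b) a - \<D> f (x + \<sigma> *\<^sub>R a) a
      = s * \<D> (\<lambda>y. \<D> f y a) (x + \<sigma> *\<^sub>R a + \<tau> *\<^sub>R b) b" by auto
  have "(x + s *\<^sub>R b) + \<sigma> *\<^sub>R a = (x + \<sigma> *\<^sub>R a) + s *\<^sub>R b" by (simp add: algebra_simps)
  with e1 e2 have "\<phi> s - \<phi> 0 = s * s * \<D> (\<lambda>y. \<D> f y a) (x + \<sigma> *\<^sub>R a + \<tau> *\<^sub>R b) b" by simp
  moreover have "\<phi> s - \<phi> 0 = f (x + s *\<^sub>R a + s *\<^sub>R b) - f (x + s *\<^sub>R a) - f (x + s *\<^sub>R b) + f x"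
    unfolding \<phi>_def by (simp add: algebra_simps)
  ultimately show ?thesis using \<sigma> \<tau> by (metis less_imp_le)
qed

lemma second_fderiv_commute_real:
  fixes f :: "'v::real_normed_vector \<Rightarrow> real"
  assumes S: "open S" "x \<in> S" and f: "Ck_on 2 S f"
  shows "\<D> (\<lambda>y. \<D> f y a) x b = \<D> (\<lambda>y. \<D> f y b) x a"
proof -
  have d1: "\<And>y. y \<in> S \<Longrightarrow> f differentiable (at y)"
    and d2: "\<And>y c. y \<in> S \<Longrightarrow> (\<lambda>y. \<D> f y c) differentiable (at y)"
    and c2: "\<And>c d. continuous_on S (\<lambda>x. \<D> (\<lambda>y. \<D> f y c) x d)"
    using f by (auto simp: numeral_2_eq_2)
  have "\<bar>\<D> (\<lambda>y. \<D> f y a) x b - \<D> (\<lambda>y. \<D> f y b) x a\<bar> < 2 * e" if e: "e > 0" for e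
  proof -
    have "\<exists>\<delta>>0. \<forall>y. dist y x < \<delta> \<longrightarrow> y \<in> S \<and> \<bar>\<D> (\<lambda>y. \<D> f y c) y d - \<D> (\<lambda>y. \<D> f y c) x d\<bar> < e"
      for c d
    proof -
      obtain r where r: "r > 0" "ball x r \<subseteq> S" using S open_contains_ball by blast
      have "isCont (\<lambda>x. \<D> (\<lambda>y. \<D> f y c) x d) x"
        using c2 S continuous_on_eq_continuous_at by blast
      then obtain \<delta> where \<delta>: "\<delta> > 0"
        "\<And>y. dist y x < \<delta> \<Longrightarrow> dist (\<D> (\<lambda>y. \<D> f y c) y d) (\<D> (\<lambda>y. \<D> f y c) x d) < e"
        using e unfolding continuous_at_eps_delta by blast
      show ?thesis using r \<delta> by (intro exI[of _ "min r \<delta>"]) (auto simp: dist_real_def dist_commute subset_iff)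
    qed
    then obtain \<delta>1 \<delta>2 where \<delta>: "\<delta>1 > 0" "\<delta>2 > 0"
      and m1: "\<And>y. dist y x < \<delta>1 \<Longrightarrow> y \<in> S \<and> \<bar>\<D> (\<lambda>y. \<D> f y a) y b - \<D> (\<lambda>y. \<D> f y a) x b\<bar> < e"
      and m2: "\<And>y. dist y x < \<delta>2 \<Longrightarrow> y \<in> S \<and> \<bar>\<D> (\<lambda>y. \<D> f y b) y a - \<D> (\<lambda>y. \<D> f y b) x a\<bar> < e"
      by meson
    \<comment> \<open>The denominator keeps the whole parallelogram with sides \<open>s a\<close> and \<open>s b\<close> close to \<open>x\<close>, also if \<open>a = b = 0\<close>.\<close>
    define s where "s = min \<delta>1 \<delta>2 / (norm a + norm b + 1)"
    have pos: "norm a + norm b + 1 > 0" by (simp add: add_nonneg_pos)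
    have s: "s > 0" using \<delta> pos by (simp add: s_def)
    have near: "dist (x + \<sigma> *\<^sub>R a + \<tau> *\<^sub>R b) x < min \<delta>1 \<delta>2"
      if "0 \<le> \<sigma>" "\<sigma> \<le> s" "0 \<le> \<tau>" "\<tau> \<le> s" for \<sigma> \<tau>
    proof -
      have "dist (x + \<sigma> *\<^sub>R a + \<tau> *\<^sub>R b) x \<le> norm (\<sigma> *\<^sub>R a) + norm (\<tau> *\<^sub>R b)"
        by (metis add.assoc add_diff_cancel_left' dist_norm norm_triangle_ineq)
      also have "\<dots> \<le> s * norm a + s * norm b" using that by (auto intro!: add_mono mult_right_mono)
      also have "\<dots> < s * (norm a + norm b + 1)" using s by (simp add: algebra_simps)
      also have "\<dots> = min \<delta>1 \<delta>2" using pos by (simp add: s_def)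
      finally show ?thesis .
    qed
    have inS: "x + \<sigma> *\<^sub>R a + \<tau> *\<^sub>R b \<in> S" if "0 \<le> \<sigma>" "\<sigma> \<le> s" "0 \<le> \<tau>" "\<tau> \<le> s" for \<sigma> \<tau>
      using near[OF that] m1 by auto
    have inS': "x + \<sigma> *\<^sub>R b + \<tau> *\<^sub>R a \<in> S" if "0 \<le> \<sigma>" "\<sigma> \<le> s" "0 \<le> \<tau>" "\<tau> \<le> s" for \<sigma> \<tau>
      using inS[OF that(3,4,1,2)] by (simp add: algebra_simps)
    obtain \<sigma> \<tau> where st: "0 \<le> \<sigma>" "\<sigma> \<le> s" "0 \<le> \<tau>" "\<tau> \<le> s"
      and e1: "f (x + s *\<^sub>R a + s *\<^sub>R b) - f (x + s *\<^sub>R a) - f (x + s *\<^sub>R b) + f x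
        = s * s * \<D> (\<lambda>y. \<D> f y a) (x + \<sigma> *\<^sub>R a + \<tau> *\<^sub>R b) b"
      using second_difference[where f = f and S = S, OF s inS d1 d2] by blast
    obtain \<sigma>' \<tau>' where st': "0 \<le> \<sigma>'" "\<sigma>' \<le> s" "0 \<le> \<tau>'" "\<tau>' \<le> s"
      and e2: "f (x + s *\<^sub>R b + s *\<^sub>R a) - f (x + s *\<^sub>R b) - f (x + s *\<^sub>R a) + f x
        = s * s * \<D> (\<lambda>y. \<D> f y b) (x + \<sigma>' *\<^sub>R b + \<tau>' *\<^sub>R a) a"
      using second_difference[where f = f and S = S, OF s inS' d1 d2] by blast
    have "x + s *\<^sub>R a + s *\<^sub>R b = x + s *\<^sub>R b + s *\<^sub>R a" by simp
    with e1 e2 have "s * s * \<D> (\<lambda>y. \<D> f y a) (x + \<sigma> *\<^sub>R a + \<tau> *\<^sub>R b) b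
        = s * s * \<D> (\<lambda>y. \<D> f y b) (x + \<sigma>' *\<^sub>R b + \<tau>' *\<^sub>R a) a"
      by (metis diff_diff_add add.commute)
    then have "\<D> (\<lambda>y. \<D> f y a) (x + \<sigma> *\<^sub>R a + \<tau> *\<^sub>R b) b
        = \<D> (\<lambda>y. \<D> f y b) (x + \<tau>' *\<^sub>R a + \<sigma>' *\<^sub>R b) a" using s by (simp add: algebra_simps)
    moreover have "\<bar>\<D> (\<lambda>y. \<D> f y a) (x + \<sigma> *\<^sub>R a + \<tau> *\<^sub>R b) b - \<D> (\<lambda>y. \<D> f y a) x b\<bar> < e"
      using m1 near[OF st] by auto
    moreover have "\<bar>\<D> (\<lambda>y. \<D> f y b) (x + \<tau>' *\<^sub>R a + \<sigma>' *\<^sub>R b) a - \<D> (\<lambda>y. \<D> f y b) x a\<bar> < e"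
      using m2 near[OF st'(3,4,1,2)] by auto
    ultimately show ?thesis by linarith
  qed
  from this[of "\<bar>\<D> (\<lambda>y. \<D> f y a) x b - \<D> (\<lambda>y. \<D> f y b) x a\<bar> / 2"] show ?thesis by force
qed

lemma second_fderiv_bounded_linear:
  assumes S: "open S" "t \<in> S" and L: "bounded_linear L" and F: "Ck_on 2 S F"
  shows "\<D> (\<lambda>t. \<D> (\<lambda>t. L (F t)) t c) t d = L (\<D> (\<lambda>t. \<D> F t c) t d)"
proof -
  have d1: "\<And>y. y \<in> S \<Longrightarrow> F differentiable (at y)"
    and d2: "\<And>y c. y \<in> S \<Longrightarrow> (\<lambda>y. \<D> F y c) differentiable (at y)"
    using F by (auto simp: numeral_2_eq_2)
  have "\<D> (\<lambda>t. \<D> (\<lambda>t. L (F t)) t c) t = \<D> (\<lambda>t. L (\<D> F t c)) t"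
    by (intro fderiv_cong_open[OF S] fderiv_bounded_linear(2)[OF L] d1)
  then show ?thesis by (simp add: fderiv_bounded_linear(2)[OF L] d2 S)
qed

lemma second_fderiv_commute:
  fixes f :: "'v::real_normed_vector \<Rightarrow> 'w::euclidean_space"
  assumes S: "open S" "x \<in> S" and f: "Ck_on 2 S f"
  shows "\<D> (\<lambda>y. \<D> f y a) x b = \<D> (\<lambda>y. \<D> f y b) x a"
proof (rule euclidean_eqI)
  fix i :: 'w
  note bl = bounded_linear_inner_left[of i]
  show "\<D> (\<lambda>y. \<D> f y a) x b \<bullet> i = \<D> (\<lambda>y. \<D> f y b) x a \<bullet> i"
    using second_fderiv_commute_real[OF S Ck_on_bounded_linear[OF S(1) bl f], of a b]
    by (simp add: second_fderiv_bounded_linear[OF S bl f])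
qed

lemma second_derivative_at_max:
  fixes e :: "'v::real_normed_vector \<Rightarrow> real"
  assumes S: "open S" "x \<in> S" and de: "\<And>t. t \<in> S \<Longrightarrow> e differentiable (at t)"
    and de2: "(\<lambda>t. \<D> e t d) differentiable (at x)"
    and max: "\<And>t. t \<in> S \<Longrightarrow> e t \<le> e x"
  shows "\<D> (\<lambda>t. \<D> e t d) x d \<le> 0"
proof (rule ccontr)
  assume "\<not> ?thesis"
  then have pos: "\<D> (\<lambda>t. \<D> e t d) x d > 0" by simp
  obtain r where r: "r > 0" "\<And>s. \<bar>s\<bar> < r \<Longrightarrow> x + s *\<^sub>R d \<in> S"
  proof -
    have "open ((\<lambda>s. x + s *\<^sub>R d) -` S)" by (intro open_vimage S continuous_intros)
    moreover have "0 \<in> (\<lambda>s. x + s *\<^sub>R d) -` S" using S by simp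
    ultimately obtain r where "r > 0" "ball 0 r \<subseteq> (\<lambda>s. x + s *\<^sub>R d) -` S"
      using open_contains_ball by blast
    then show ?thesis by (intro that[of r]) (auto simp: subset_iff)
  qed
  let ?k = "\<lambda>s. e (x + s *\<^sub>R d)" and ?k' = "\<lambda>s. \<D> e (x + s *\<^sub>R d) d"
  have k': "(?k has_real_derivative ?k' s) (at s)" if "\<bar>s\<bar> < r" for s
    by (rule has_real_derivative_along_line[OF de[OF r(2)[OF that]]])
  have "?k' 0 = 0"
    by (rule DERIV_local_max[OF k', of 0 r]) (use r max in auto)
  have "((\<lambda>s. \<D> e (x + s *\<^sub>R d) d) has_real_derivative \<D> (\<lambda>t. \<D> e t d) x d) (at 0)"
    using has_real_derivative_along_line[of "\<lambda>t. \<D> e t d" x 0 d] de2 by simp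
  from DERIV_pos_inc_right[OF this pos] obtain \<delta> where \<delta>: "\<delta> > 0"
    "\<And>h. 0 < h \<Longrightarrow> h < \<delta> \<Longrightarrow> ?k' 0 < ?k' h" by auto
  define h where "h = min \<delta> r / 2"
  have h: "0 < h" "h < \<delta>" "h < r" using \<delta>(1) r(1) by (auto simp: h_def)
  obtain z where z: "0 < z" "z < h" "?k h - ?k 0 = (h - 0) * ?k' z"
    using MVT2[of 0 h ?k ?k'] h k' by auto
  have "?k' z > 0" using \<delta>(2)[of z] z h \<open>?k' 0 = 0\<close> by simp
  then have "?k h > ?k 0" using z h by (simp add: algebra_simps)
  then show False using max[OF r(2), of h] h by simp
qed

section \<open>The Bochner formula for harmonic maps of plane domains\<close>

lemma bilinear_expand:
  fixes a :: "'a::euclidean_space" and b :: "'b::euclidean_space" and K :: "'a \<Rightarrow> 'b \<Rightarrow> 'c::real_normed_vector"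
  assumes "bilinear K"
  shows "K a b = (\<Sum>i\<in>Basis. \<Sum>j\<in>Basis. ((a \<bullet> i) * (b \<bullet> j)) *\<^sub>R K i j)"
proof -
  have "K a b = K (\<Sum>i\<in>Basis. (a \<bullet> i) *\<^sub>R i) (\<Sum>j\<in>Basis. (b \<bullet> j) *\<^sub>R j)"
    by (simp add: euclidean_representation)
  also have "\<dots> = (\<Sum>(i,j)\<in>Basis \<times> Basis. K ((a \<bullet> i) *\<^sub>R i) ((b \<bullet> j) *\<^sub>R j))"
    by (rule bilinear_sum[OF assms])
  also have "\<dots> = (\<Sum>i\<in>Basis. \<Sum>j\<in>Basis. K ((a \<bullet> i) *\<^sub>R i) ((b \<bullet> j) *\<^sub>R j))"
    by (simp add: sum.cartesian_product)
  finally show ?thesis by (simp add: bilinear_lmul[OF assms] bilinear_rmul[OF assms] mult.commute)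
qed

text \<open>The product rule for a bilinear form that depends on the base point.  Metrics and Christoffel
  symbols are differentiated along maps through this rule only, so that no indices are needed there.\<close>
lemma has_derivative_bilinear_field:
  fixes K :: "'v::euclidean_space \<Rightarrow> 'a::euclidean_space \<Rightarrow> 'b::euclidean_space \<Rightarrow> 'c::real_normed_vector"
    and F :: "'t::real_normed_vector \<Rightarrow> 'v"
  assumes U: "open U" "\<And>y. y \<in> U \<Longrightarrow> bilinear (K y)"
    and K: "\<And>a b. (\<lambda>y. K y a b) differentiable (at (F t))"
    and t: "F t \<in> U"
    and F: "(F has_derivative F') (at t)" and A: "(A has_derivative A') (at t)"
    and B: "(B has_derivative B') (at t)"
  shows "((\<lambda>s. K (F s) (A s) (B s)) has_derivative
    (\<lambda>v. \<D> (\<lambda>y. K y (A t) (B t)) (F t) (F' v) + K (F t) (A' v) (B t) + K (F t) (A t) (B' v))) (at t)"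
proof -
  have "isCont F t" using F has_derivative_continuous by blast
  then obtain N where N: "open N" "t \<in> N" "\<And>s. s \<in> N \<Longrightarrow> F s \<in> U"
    using U(1) t unfolding continuous_at_open by meson
  let ?k = "\<lambda>i j. \<D> (\<lambda>y. K y i j) (F t)"
  have dk: "((\<lambda>y. \<Sum>i\<in>Basis. \<Sum>j\<in>Basis. ((a \<bullet> i) * (b \<bullet> j)) *\<^sub>R K y i j) has_derivative
      (\<lambda>c. \<Sum>i\<in>Basis. \<Sum>j\<in>Basis. ((a \<bullet> i) * (b \<bullet> j)) *\<^sub>R ?k i j c)) (at (F t))" for a b
    by (intro has_derivative_sum has_derivative_scaleR_right has_derivative_fderiv K)
  have dK: "\<D> (\<lambda>y. K y a b) (F t) c = (\<Sum>i\<in>Basis. \<Sum>j\<in>Basis. ((a \<bullet> i) * (b \<bullet> j)) *\<^sub>R ?k i j c)" for a b c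
  proof -
    have "\<D> (\<lambda>y. K y a b) (F t) = \<D> (\<lambda>y. \<Sum>i\<in>Basis. \<Sum>j\<in>Basis. ((a \<bullet> i) * (b \<bullet> j)) *\<^sub>R K y i j) (F t)"
      by (rule fderiv_cong_open[OF U(1) t]) (rule bilinear_expand[OF U(2)])
    then show ?thesis by (simp add: fderivI[OF dk])
  qed
  have kF: "((\<lambda>s. K (F s) i j) has_derivative (\<lambda>v. ?k i j (F' v))) (at t)" for i j
    by (rule has_derivative_compose[OF F has_derivative_fderiv[OF K]])
  have "((\<lambda>s. \<Sum>i\<in>Basis. \<Sum>j\<in>Basis. ((A s \<bullet> i) * (B s \<bullet> j)) *\<^sub>R K (F s) i j) has_derivative
      (\<lambda>v. \<Sum>i\<in>Basis. \<Sum>j\<in>Basis. ((A t \<bullet> i) * (B t \<bullet> j)) *\<^sub>R ?k i j (F' v) +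
        ((A t \<bullet> i) * (B' v \<bullet> j) + (A' v \<bullet> i) * (B t \<bullet> j)) *\<^sub>R K (F t) i j)) (at t)"
    by (intro has_derivative_sum has_derivative_scaleR has_derivative_mult kF
        has_derivative_inner_left A B)
  moreover have "(\<lambda>v. \<Sum>i\<in>Basis. \<Sum>j\<in>Basis. ((A t \<bullet> i) * (B t \<bullet> j)) *\<^sub>R ?k i j (F' v) +
        ((A t \<bullet> i) * (B' v \<bullet> j) + (A' v \<bullet> i) * (B t \<bullet> j)) *\<^sub>R K (F t) i j)
      = (\<lambda>v. \<D> (\<lambda>y. K y (A t) (B t)) (F t) (F' v) + K (F t) (A' v) (B t) + K (F t) (A t) (B' v))"
  proof
    fix v
    have *: "K (F t) (A' v) (B t) = (\<Sum>i\<in>Basis. \<Sum>j\<in>Basis. ((A' v \<bullet> i) * (B t \<bullet> j)) *\<^sub>R K (F t) i j)"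
      "K (F t) (A t) (B' v) = (\<Sum>i\<in>Basis. \<Sum>j\<in>Basis. ((A t \<bullet> i) * (B' v \<bullet> j)) *\<^sub>R K (F t) i j)"
      by (rule bilinear_expand[OF U(2)[OF t]])+
    show "(\<Sum>i\<in>Basis. \<Sum>j\<in>Basis. ((A t \<bullet> i) * (B t \<bullet> j)) *\<^sub>R ?k i j (F' v) +
        ((A t \<bullet> i) * (B' v \<bullet> j) + (A' v \<bullet> i) * (B t \<bullet> j)) *\<^sub>R K (F t) i j)
      = \<D> (\<lambda>y. K y (A t) (B t)) (F t) (F' v) + K (F t) (A' v) (B t) + K (F t) (A t) (B' v)"
      unfolding dK[of "A t" "B t"] * by (simp add: sum.distrib scaleR_add_left add_ac)
  qed
  ultimately have "((\<lambda>s. \<Sum>i\<in>Basis. \<Sum>j\<in>Basis. ((A s \<bullet> i) * (B s \<bullet> j)) *\<^sub>R K (F s) i j) has_derivative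
     (\<lambda>v. \<D> (\<lambda>y. K y (A t) (B t)) (F t) (F' v) + K (F t) (A' v) (B t) + K (F t) (A t) (B' v))) (at t)"
    by (simp only:)
  then show ?thesis
  proof (rule has_derivative_transform_within_open[OF _ N(1,2)])
    fix s assume "s \<in> N"
    then show "(\<Sum>i\<in>Basis. \<Sum>j\<in>Basis. ((A s \<bullet> i) * (B s \<bullet> j)) *\<^sub>R K (F s) i j) = K (F s) (A s) (B s)"
      by (rule bilinear_expand[OF U(2)[OF N(3)], symmetric])
  qed
qed

text \<open>The curvature tensor \<open>R(a, b) c\<close> of the connection with Christoffel symbols \<open>\<Gamma>\<close>, for \<open>a\<close>, \<open>b\<close>, \<open>c\<close>
  extended as constant vector fields.\<close>
definition curvature ::
  "('v::real_normed_vector \<Rightarrow> 'v \<Rightarrow> 'v \<Rightarrow> 'v) \<Rightarrow> 'v \<Rightarrow> 'v \<Rightarrow> 'v \<Rightarrow> 'v \<Rightarrow> 'v" where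
  "curvature \<Gamma> y a b c = \<D> (\<lambda>y. \<Gamma> y b c) y a - \<D> (\<lambda>y. \<Gamma> y a c) y b
     + \<Gamma> y a (\<Gamma> y b c) - \<Gamma> y b (\<Gamma> y a c)"

lemma curvature_skew: "curvature \<Gamma> y a b c = - curvature \<Gamma> y b a c"
  by (simp add: curvature_def)

text \<open>The derivative in direction \<open>d\<close> of a vector field \<open>W\<close> along \<open>F\<close>, for the pulled back connection.\<close>
definition cov ::
  "('v \<Rightarrow> 'v \<Rightarrow> 'v \<Rightarrow> 'v::real_normed_vector) \<Rightarrow> ('t::real_normed_vector \<Rightarrow> 'v) \<Rightarrow> 't \<Rightarrow> ('t \<Rightarrow> 'v) \<Rightarrow> 't \<Rightarrow> 'v" where
  "cov \<Gamma> F d W t = \<D> W t d + \<Gamma> (F t) (\<D> F t d) (W t)"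

definition tension :: "('v \<Rightarrow> 'v \<Rightarrow> 'v \<Rightarrow> 'v::real_normed_vector) \<Rightarrow> (complex \<Rightarrow> 'v) \<Rightarrow> complex \<Rightarrow> 'v" where
  "tension \<Gamma> F t = cov \<Gamma> F 1 (\<lambda>t. \<D> F t 1) t + cov \<Gamma> F \<i> (\<lambda>t. \<D> F t \<i>) t"

definition energy :: "('v \<Rightarrow> 'v \<Rightarrow> 'v::real_normed_vector \<Rightarrow> real) \<Rightarrow> (complex \<Rightarrow> 'v) \<Rightarrow> complex \<Rightarrow> real" where
  "energy G F t = G (F t) (\<D> F t 1) (\<D> F t 1) + G (F t) (\<D> F t \<i>) (\<D> F t \<i>)"

text \<open>A metric \<open>G\<close> on a coordinate patch with its Levi-Civita connection and non-positive sectional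
  curvature, described by exactly the properties that enter the Bochner formula.  They hold both in real
  coordinates for the Christoffel symbols of a Riemannian metric and in holomorphic coordinates for those
  of a Kaehler metric.  The curvature condition is not divided by the area of the parallelogram spanned by
  \<open>a\<close> and \<open>b\<close>, so that it makes sense for dependent vectors as well.\<close>
locale nonpos_connection =
  fixes U :: "'v::euclidean_space set" and G :: "'v \<Rightarrow> 'v \<Rightarrow> 'v \<Rightarrow> real" and \<Gamma> :: "'v \<Rightarrow> 'v \<Rightarrow> 'v \<Rightarrow> 'v"
  assumes open_U: "open U"
    and bilinear_G: "y \<in> U \<Longrightarrow> bilinear (G y)"
    and G_sym: "y \<in> U \<Longrightarrow> G y a b = G y b a"
    and G_pos: "y \<in> U \<Longrightarrow> a \<noteq> 0 \<Longrightarrow> G y a a > 0"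
    and bilinear_\<Gamma>: "y \<in> U \<Longrightarrow> bilinear (\<Gamma> y)"
    and \<Gamma>_sym: "y \<in> U \<Longrightarrow> \<Gamma> y a b = \<Gamma> y b a"
    and G_parallel: "y \<in> U \<Longrightarrow>
      ((\<lambda>y. G y a b) has_derivative (\<lambda>c. G y (\<Gamma> y c a) b + G y a (\<Gamma> y c b))) (at y)"
    and \<Gamma>_differentiable: "y \<in> U \<Longrightarrow> (\<lambda>y. \<Gamma> y a b) differentiable (at y)"
    and curvature_nonpos: "y \<in> U \<Longrightarrow> G y (curvature \<Gamma> y a b b) a \<le> 0"
begin

lemma G_nonneg: "y \<in> U \<Longrightarrow> G y a a \<ge> 0"
  using G_pos[of y a] bilinear_lzero[OF bilinear_G, of y 0] by (cases "a = 0") auto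

lemma has_derivative_G:
  assumes "F t \<in> U" "F differentiable (at t)" "V differentiable (at t)" "W differentiable (at t)"
  shows "((\<lambda>t. G (F t) (V t) (W t)) has_derivative
    (\<lambda>d. G (F t) (cov \<Gamma> F d V t) (W t) + G (F t) (V t) (cov \<Gamma> F d W t))) (at t)"
proof -
  note bl = bilinear_ladd[OF bilinear_G[OF assms(1)]] bilinear_radd[OF bilinear_G[OF assms(1)]]
  have "((\<lambda>t. G (F t) (V t) (W t)) has_derivative
    (\<lambda>d. \<D> (\<lambda>y. G y (V t) (W t)) (F t) (\<D> F t d) + G (F t) (\<D> V t d) (W t) + G (F t) (V t) (\<D> W t d))) (at t)"
    by (rule has_derivative_bilinear_field[where K = G and F = F and t = t and A = V and B = W,
          OF open_U bilinear_G differentiableI[OF G_parallel[OF assms(1)]] assms(1)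
          assms(2)[THEN has_derivative_fderiv] assms(3)[THEN has_derivative_fderiv] assms(4)[THEN has_derivative_fderiv]])
  then show ?thesis
    by (simp add: fderivI[OF G_parallel[OF assms(1)]] cov_def bl algebra_simps)
qed

lemma has_derivative_\<Gamma>:
  assumes "F t \<in> U" "F differentiable (at t)" "V differentiable (at t)" "W differentiable (at t)"
  shows "((\<lambda>t. \<Gamma> (F t) (V t) (W t)) has_derivative
    (\<lambda>d. \<D> (\<lambda>y. \<Gamma> y (V t) (W t)) (F t) (\<D> F t d) + \<Gamma> (F t) (\<D> V t d) (W t) + \<Gamma> (F t) (V t) (\<D> W t d))) (at t)"
  by (rule has_derivative_bilinear_field[where K = \<Gamma> and F = F and t = t and A = V and B = W,
        OF open_U bilinear_\<Gamma> \<Gamma>_differentiable[OF assms(1)] assms(1)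
        assms(2)[THEN has_derivative_fderiv] assms(3)[THEN has_derivative_fderiv] assms(4)[THEN has_derivative_fderiv]])

lemma cov_differentiable:
  assumes "F t \<in> U" "F differentiable (at t)" "(\<lambda>t. \<D> F t d) differentiable (at t)"
    "W differentiable (at t)" "(\<lambda>t. \<D> W t d) differentiable (at t)"
  shows "cov \<Gamma> F d W differentiable (at t)"
proof -
  have "(\<lambda>t. \<Gamma> (F t) (\<D> F t d) (W t)) differentiable (at t)"
    using has_derivative_\<Gamma>[OF assms(1,2,3,4)] differentiable_def by blast
  then have "(\<lambda>t. \<D> W t d + \<Gamma> (F t) (\<D> F t d) (W t)) differentiable (at t)"
    using assms(5) by (rule differentiable_add[rotated])
  then show ?thesis by (simp add: cov_def[abs_def])
qed

text \<open>The second derivatives of \<open>F\<close> and of \<open>W\<close> are symmetric and cancel; what remains is the curvature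
  evaluated on the coordinate fields of \<open>F\<close>.\<close>
lemma cov_commute:
  fixes F :: "'t::euclidean_space \<Rightarrow> 'v"
  assumes S: "open S" "t \<in> S" and FU: "\<And>s. s \<in> S \<Longrightarrow> F s \<in> U"
    and F: "smooth_on S F" and W: "smooth_on S W"
  shows "cov \<Gamma> F c (cov \<Gamma> F d W) t - cov \<Gamma> F d (cov \<Gamma> F c W) t = curvature \<Gamma> (F t) (\<D> F t c) (\<D> F t d) (W t)"
proof -
  note tU = FU[OF S(2)]
  have dF: "F differentiable (at t)" and dW: "W differentiable (at t)"
    and dFd: "\<And>d. (\<lambda>t. \<D> F t d) differentiable (at t)"
    and dWd: "\<And>d. (\<lambda>t. \<D> W t d) differentiable (at t)"
    using F W S(2) by (auto intro: smooth_onD smooth_on_fderiv)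
  have e: "\<D> (cov \<Gamma> F d W) t c = \<D> (\<lambda>t. \<D> W t d) t c
      + (\<D> (\<lambda>y. \<Gamma> y (\<D> F t d) (W t)) (F t) (\<D> F t c) + \<Gamma> (F t) (\<D> (\<lambda>t. \<D> F t d) t c) (W t)
      + \<Gamma> (F t) (\<D> F t d) (\<D> W t c))" for c d
    unfolding cov_def[abs_def]
    by (subst fderivI[OF has_derivative_add[OF has_derivative_fderiv[OF dWd] has_derivative_\<Gamma>[OF tU dF dFd dW]]]) simp
  have s1: "\<D> (\<lambda>t. \<D> W t d) t c = \<D> (\<lambda>t. \<D> W t c) t d"
    and s2: "\<D> (\<lambda>t. \<D> F t d) t c = \<D> (\<lambda>t. \<D> F t c) t d"
    using F W by (auto intro!: second_fderiv_commute[OF S] simp: smooth_on_def)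
  show ?thesis
    unfolding curvature_def cov_def[of \<Gamma> F c "cov \<Gamma> F d W"] cov_def[of \<Gamma> F d "cov \<Gamma> F c W"] e s1 s2
    unfolding cov_def bilinear_radd[OF bilinear_\<Gamma>[OF tU]]
    by (simp add: algebra_simps)
qed

lemma cov_torsion_free:
  fixes F :: "'t::euclidean_space \<Rightarrow> 'v"
  assumes S: "open S" "t \<in> S" and FU: "F t \<in> U" and F: "smooth_on S F"
  shows "cov \<Gamma> F c (\<lambda>t. \<D> F t d) t = cov \<Gamma> F d (\<lambda>t. \<D> F t c) t"
proof -
  have "\<D> (\<lambda>t. \<D> F t d) t c = \<D> (\<lambda>t. \<D> F t c) t d"
    using F by (intro second_fderiv_commute[OF S]) (auto simp: smooth_on_def)
  then show ?thesis by (simp add: cov_def \<Gamma>_sym[OF FU])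
qed

lemma cov_cong:
  assumes "open S" "t \<in> S" "\<And>s. s \<in> S \<Longrightarrow> V s = W s"
  shows "cov \<Gamma> F d V t = cov \<Gamma> F d W t"
  using fderiv_cong_open[of S t V W, OF assms] assms(2,3) by (simp add: cov_def)

lemma cov_add:
  assumes "F t \<in> U" "V differentiable (at t)" "W differentiable (at t)"
  shows "cov \<Gamma> F d (\<lambda>t. V t + W t) t = cov \<Gamma> F d V t + cov \<Gamma> F d W t"
  using fderivI[OF has_derivative_add[OF assms(2,3)[THEN has_derivative_fderiv]]]
  by (simp add: cov_def bilinear_radd[OF bilinear_\<Gamma>[OF assms(1)]])

text \<open>The Bochner formula.  Write \<open>X\<close>, \<open>Y\<close> for the two partial derivatives of \<open>F\<close> and \<open>\<nabla>\<^sub>1\<close>, \<open>\<nabla>\<^sub>2\<close> for the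
  covariant derivatives.  The Laplacian of \<open>|X|\<^sup>2 + |Y|\<^sup>2\<close> is twice a sum of squares plus twice
  \<open>\<langle>\<Delta>X, X\<rangle> + \<langle>\<Delta>Y, Y\<rangle>\<close>, where \<open>\<Delta> = \<nabla>\<^sub>1\<nabla>\<^sub>1 + \<nabla>\<^sub>2\<nabla>\<^sub>2\<close>.  Since \<open>\<nabla>\<^sub>2X = \<nabla>\<^sub>1Y\<close> and \<open>\<nabla>\<^sub>1X + \<nabla>\<^sub>2Y = 0\<close>, commuting
  derivatives gives \<open>\<Delta>X = - R(X, Y) Y\<close>, and likewise \<open>\<Delta>Y = - R(Y, X) X\<close>; the flat domain contributes
  nothing.\<close>
lemma energy_subharmonic:
  assumes S: "open S" and FU: "\<And>s. s \<in> S \<Longrightarrow> F s \<in> U"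
    and F: "smooth_on S F" and harmonic: "\<And>s. s \<in> S \<Longrightarrow> tension \<Gamma> F s = 0"
  shows "\<And>t. t \<in> S \<Longrightarrow> energy G F differentiable (at t)"
    and "\<And>t d. t \<in> S \<Longrightarrow> (\<lambda>t. \<D> (energy G F) t d) differentiable (at t)"
    and "\<And>t. t \<in> S \<Longrightarrow> laplacian (energy G F) t \<ge> 0"
proof -
  let ?X = "\<lambda>d t. \<D> F t d"
  have sX: "smooth_on S (?X d)" for d using F by (rule smooth_on_fderiv)
  have dF: "F differentiable (at t)" if "t \<in> S" for t using F that by (rule smooth_onD)
  have dX: "?X d differentiable (at t)" if "t \<in> S" for t d using sX that by (rule smooth_onD)
  have dX2: "(\<lambda>t. \<D> (?X d) t c) differentiable (at t)" if "t \<in> S" for t c d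
    using smooth_on_fderiv[OF sX] that by (rule smooth_onD)
  have dc: "cov \<Gamma> F d (?X c) differentiable (at t)" if "t \<in> S" for t c d
    by (rule cov_differentiable[OF FU[OF that] dF[OF that] dX[OF that] dX[OF that] dX2[OF that]])
  have sym: "G (F t) a b = G (F t) b a" if "t \<in> S" for t a b using G_sym FU[OF that] by blast
  have de1: "((\<lambda>t. G (F t) (?X c t) (?X c t)) has_derivative (\<lambda>d. 2 * G (F t) (cov \<Gamma> F d (?X c) t) (?X c t))) (at t)"
    if "t \<in> S" for t c
    using has_derivative_G[OF FU[OF that] dF[OF that] dX[OF that] dX[OF that], of c c]
    by (simp add: sym[OF that, of "?X c t"])
  have de: "(energy G F has_derivative (\<lambda>d. 2 * G (F t) (cov \<Gamma> F d (?X 1) t) (?X 1 t)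
      + 2 * G (F t) (cov \<Gamma> F d (?X \<i>) t) (?X \<i> t))) (at t)" if "t \<in> S" for t
    unfolding energy_def[abs_def] by (intro has_derivative_add de1 that)
  show "energy G F differentiable (at t)" if "t \<in> S" for t
    using de[OF that] differentiable_def by blast
  define E where "E d t = 2 * G (F t) (cov \<Gamma> F d (?X 1) t) (?X 1 t) + 2 * G (F t) (cov \<Gamma> F d (?X \<i>) t) (?X \<i> t)" for d t
  have DE: "\<D> (energy G F) t d = E d t" if "t \<in> S" for t d
    unfolding fderivI[OF de[OF that]] E_def ..
  have dE: "(E d has_derivative (\<lambda>c.
      2 * (G (F t) (cov \<Gamma> F c (cov \<Gamma> F d (?X 1)) t) (?X 1 t) + G (F t) (cov \<Gamma> F d (?X 1) t) (cov \<Gamma> F c (?X 1) t)) +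
      2 * (G (F t) (cov \<Gamma> F c (cov \<Gamma> F d (?X \<i>)) t) (?X \<i> t) + G (F t) (cov \<Gamma> F d (?X \<i>) t) (cov \<Gamma> F c (?X \<i>) t)))) (at t)"
    if "t \<in> S" for t d
    unfolding E_def[abs_def]
    by (intro has_derivative_add has_derivative_mult_right has_derivative_G FU dF dc dX that)
  show "(\<lambda>t. \<D> (energy G F) t d) differentiable (at t)" if "t \<in> S" for t d
    using differentiable_cong_open[OF S that, of "\<lambda>t. \<D> (energy G F) t d" "E d"] DE
      differentiableI[OF dE[OF that, of d]] by blast
  show "laplacian (energy G F) t \<ge> 0" if t: "t \<in> S" for t
  proof -
    note tU = FU[OF t]
    note bl = bilinear_ladd[OF bilinear_G[OF tU]] bilinear_lneg[OF bilinear_G[OF tU]]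
    have lap: "\<D> (\<lambda>t. \<D> (energy G F) t d) t d
      = 2 * (G (F t) (cov \<Gamma> F d (cov \<Gamma> F d (?X 1)) t) (?X 1 t) + G (F t) (cov \<Gamma> F d (?X 1) t) (cov \<Gamma> F d (?X 1) t)) +
        2 * (G (F t) (cov \<Gamma> F d (cov \<Gamma> F d (?X \<i>)) t) (?X \<i> t) + G (F t) (cov \<Gamma> F d (?X \<i>) t) (cov \<Gamma> F d (?X \<i>) t))" for d
      using fderiv_cong_open[OF S t, of "\<lambda>t. \<D> (energy G F) t d" "E d"] DE
      by (simp add: fderivI[OF dE[OF t]])
    have tf: "cov \<Gamma> F c (?X d) s = cov \<Gamma> F d (?X c) s" if "s \<in> S" for c d s
      using cov_torsion_free[OF S that FU[OF that] F] .
    have ten: "cov \<Gamma> F d (cov \<Gamma> F 1 (?X 1)) t + cov \<Gamma> F d (cov \<Gamma> F \<i> (?X \<i>)) t = 0" for d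
    proof -
      have "cov \<Gamma> F d (cov \<Gamma> F 1 (?X 1)) t + cov \<Gamma> F d (cov \<Gamma> F \<i> (?X \<i>)) t
        = cov \<Gamma> F d (\<lambda>t. cov \<Gamma> F 1 (?X 1) t + cov \<Gamma> F \<i> (?X \<i>) t) t"
        by (rule cov_add[where F = F and t = t, symmetric, OF tU dc[OF t, of 1 1] dc[OF t, of \<i> \<i>]])
      also have "\<dots> = cov \<Gamma> F d (\<lambda>t. 0) t"
        using harmonic by (intro cov_cong[OF S t]) (simp add: tension_def)
      also have "\<dots> = 0" by (simp add: cov_def bilinear_rzero[OF bilinear_\<Gamma>[OF tU]])
      finally show ?thesis .
    qed
    have com: "cov \<Gamma> F c (cov \<Gamma> F d (?X e)) t = cov \<Gamma> F d (cov \<Gamma> F c (?X e)) t + curvature \<Gamma> (F t) (?X c t) (?X d t) (?X e t)"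
      for c d e
      using cov_commute[OF S t FU F sX[of e], of c d] by (simp add: algebra_simps)
    have sw: "cov \<Gamma> F c (cov \<Gamma> F d (?X e)) t = cov \<Gamma> F c (cov \<Gamma> F e (?X d)) t" for c d e
      by (intro cov_cong[OF S t] tf)
    have gr: "a + c = - k" if "a + b = 0" "c = d" "d = b + k'" "k' = - k" for a b c d k k' :: 'v
      using that by (simp add: add.assoc[symmetric])
    have gr': "c + a = - k" if "b + a = 0" "c = d" "d = b + k'" "k' = - k" for a b c d k k' :: 'v
      using gr[of a b c d k' k] that by (simp add: add.commute)
    have l1: "cov \<Gamma> F 1 (cov \<Gamma> F 1 (?X 1)) t + cov \<Gamma> F \<i> (cov \<Gamma> F \<i> (?X 1)) t
        = - curvature \<Gamma> (F t) (?X 1 t) (?X \<i> t) (?X \<i> t)"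
      by (rule gr[OF ten sw com curvature_skew])
    have l2: "cov \<Gamma> F 1 (cov \<Gamma> F 1 (?X \<i>)) t + cov \<Gamma> F \<i> (cov \<Gamma> F \<i> (?X \<i>)) t
        = - curvature \<Gamma> (F t) (?X \<i> t) (?X 1 t) (?X 1 t)"
      by (rule gr'[OF ten sw com curvature_skew])
    have g1: "G (F t) (cov \<Gamma> F 1 (cov \<Gamma> F 1 (?X 1)) t) (?X 1 t) + G (F t) (cov \<Gamma> F \<i> (cov \<Gamma> F \<i> (?X 1)) t) (?X 1 t) \<ge> 0"
      using curvature_nonpos[OF tU, of "?X 1 t" "?X \<i> t"] unfolding bl(1)[symmetric] l1 bl(2) by simp
    have g2: "G (F t) (cov \<Gamma> F 1 (cov \<Gamma> F 1 (?X \<i>)) t) (?X \<i> t) + G (F t) (cov \<Gamma> F \<i> (cov \<Gamma> F \<i> (?X \<i>)) t) (?X \<i> t) \<ge> 0"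
      using curvature_nonpos[OF tU, of "?X \<i> t" "?X 1 t"] unfolding bl(1)[symmetric] l2 bl(2) by simp
    have p: "G (F t) a a \<ge> 0" for a by (rule G_nonneg[OF tU])
    have arith: "0 \<le> 2 * (a1 + b1) + 2 * (a2 + b2) + (2 * (a3 + b3) + 2 * (a4 + b4))"
      if "0 \<le> a1 + a3" "0 \<le> a2 + a4" "0 \<le> b1" "0 \<le> b2" "0 \<le> b3" "0 \<le> b4" for a1 a2 a3 a4 b1 b2 b3 b4 :: real
      using that by simp
    show ?thesis unfolding lap by (rule arith[OF g1 g2 p p p p])
  qed
qed

end

section \<open>Holomorphic discs and the Chern curvature of the source\<close>

text \<open>The one-variable counterparts of \<open>dz\<close> and \<open>dzbar\<close>.\<close>
definition wirtinger :: "(complex \<Rightarrow> complex) \<Rightarrow> complex \<Rightarrow> complex" where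
  "wirtinger \<phi> t = (\<D> \<phi> t 1 - \<i> * \<D> \<phi> t \<i>) / 2"

definition wirtinger_bar :: "(complex \<Rightarrow> complex) \<Rightarrow> complex \<Rightarrow> complex" where
  "wirtinger_bar \<phi> t = (\<D> \<phi> t 1 + \<i> * \<D> \<phi> t \<i>) / 2"

lemma wirtinger_cong_open:
  assumes "open S" "t \<in> S" "\<And>s. s \<in> S \<Longrightarrow> \<phi> s = \<psi> s"
  shows "wirtinger \<phi> t = wirtinger \<psi> t"
  using fderiv_cong_open[of S t \<phi> \<psi>, OF assms] by (simp add: wirtinger_def)

lemma wirtinger_sum:
  assumes "\<And>i. i \<in> I \<Longrightarrow> \<phi> i differentiable (at t)"
  shows "wirtinger (\<lambda>t. \<Sum>i\<in>I. \<phi> i t) t = (\<Sum>i\<in>I. wirtinger (\<phi> i) t)"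
    "wirtinger_bar (\<lambda>t. \<Sum>i\<in>I. \<phi> i t) t = (\<Sum>i\<in>I. wirtinger_bar (\<phi> i) t)"
proof -
  have "((\<lambda>t. \<Sum>i\<in>I. \<phi> i t) has_derivative (\<lambda>v. \<Sum>i\<in>I. \<D> (\<phi> i) t v)) (at t)"
    using assms by (intro has_derivative_sum has_derivative_fderiv)
  from fderivI[OF this] show "wirtinger (\<lambda>t. \<Sum>i\<in>I. \<phi> i t) t = (\<Sum>i\<in>I. wirtinger (\<phi> i) t)"
    "wirtinger_bar (\<lambda>t. \<Sum>i\<in>I. \<phi> i t) t = (\<Sum>i\<in>I. wirtinger_bar (\<phi> i) t)"
    by (simp_all add: wirtinger_def wirtinger_bar_def sum_subtractf sum.distrib sum_distrib_left sum_divide_distrib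
        diff_divide_distrib add_divide_distrib)
qed

lemma wirtinger_double_sum:
  fixes \<phi> :: "'i::finite \<Rightarrow> 'j::finite \<Rightarrow> complex \<Rightarrow> complex"
  assumes "\<And>i j. \<phi> i j differentiable (at t)"
  shows "wirtinger (\<lambda>t. \<Sum>i\<in>UNIV. \<Sum>j\<in>UNIV. \<phi> i j t) t = (\<Sum>i\<in>UNIV. \<Sum>j\<in>UNIV. wirtinger (\<phi> i j) t)"
    "wirtinger_bar (\<lambda>t. \<Sum>i\<in>UNIV. \<Sum>j\<in>UNIV. \<phi> i j t) t = (\<Sum>i\<in>UNIV. \<Sum>j\<in>UNIV. wirtinger_bar (\<phi> i j) t)"
proof -
  have d: "(\<lambda>t. \<Sum>j\<in>UNIV. \<phi> i j t) differentiable (at t)" for i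
    by (rule differentiable_sum) (auto intro: assms)
  have "wirtinger (\<lambda>t. \<Sum>j\<in>UNIV. \<phi> i j t) t = (\<Sum>j\<in>UNIV. wirtinger (\<phi> i j) t)"
    "wirtinger_bar (\<lambda>t. \<Sum>j\<in>UNIV. \<phi> i j t) t = (\<Sum>j\<in>UNIV. wirtinger_bar (\<phi> i j) t)" for i
    by (rule wirtinger_sum, rule assms)+
  then show "wirtinger (\<lambda>t. \<Sum>i\<in>UNIV. \<Sum>j\<in>UNIV. \<phi> i j t) t = (\<Sum>i\<in>UNIV. \<Sum>j\<in>UNIV. wirtinger (\<phi> i j) t)"
    "wirtinger_bar (\<lambda>t. \<Sum>i\<in>UNIV. \<Sum>j\<in>UNIV. \<phi> i j t) t = (\<Sum>i\<in>UNIV. \<Sum>j\<in>UNIV. wirtinger_bar (\<phi> i j) t)"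
    using wirtinger_sum[of UNIV "\<lambda>i t. \<Sum>j\<in>UNIV. \<phi> i j t", OF d] by simp_all
qed

lemma wirtinger_mult:
  assumes "\<phi> differentiable (at t)" "\<psi> differentiable (at t)"
  shows "wirtinger (\<lambda>t. \<phi> t * \<psi> t) t = wirtinger \<phi> t * \<psi> t + \<phi> t * wirtinger \<psi> t"
    "wirtinger_bar (\<lambda>t. \<phi> t * \<psi> t) t = wirtinger_bar \<phi> t * \<psi> t + \<phi> t * wirtinger_bar \<psi> t"
  using fderivI[OF has_derivative_mult[OF assms[THEN has_derivative_fderiv]]]
  by (simp_all add: wirtinger_def wirtinger_bar_def field_simps)

lemma wirtinger_wirtinger_bar:
  assumes S: "open S" "t \<in> S" and \<phi>: "Ck_on 2 S \<phi>"
  shows "wirtinger (wirtinger_bar \<phi>) t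
    = laplacian \<phi> t / 4"
proof -
  have d: "(\<lambda>t. \<D> \<phi> t v) differentiable (at t)" for v
    using \<phi> S by (auto simp: numeral_2_eq_2)
  have "((\<lambda>t. (\<D> \<phi> t 1 + \<i> * \<D> \<phi> t \<i>) / 2) has_derivative
      (\<lambda>v. (\<D> (\<lambda>t. \<D> \<phi> t 1) t v + \<i> * \<D> (\<lambda>t. \<D> \<phi> t \<i>) t v) / 2)) (at t)"
    by (intro bounded_linear.has_derivative[OF bounded_linear_divide] has_derivative_add has_derivative_mult_right has_derivative_fderiv d)
  then show ?thesis
    using second_fderiv_commute[OF S \<phi>, of 1 \<i>]
    by (simp add: wirtinger_def wirtinger_bar_def[abs_def] fderivI field_simps)
qed

text \<open>The Wirtinger derivatives are the complex linear and antilinear parts of the differential.\<close>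
lemma dz_expand:
  fixes \<phi> :: "complex^'m \<Rightarrow> complex"
  assumes "\<phi> differentiable (at z)"
  shows "(\<D> \<phi> z v - \<i> * \<D> \<phi> z (\<i> *s v)) / 2 = (\<Sum>\<alpha>\<in>UNIV. v $ \<alpha> * dz \<alpha> \<phi> z)"
    and "(\<D> \<phi> z v + \<i> * \<D> \<phi> z (\<i> *s v)) / 2 = (\<Sum>\<alpha>\<in>UNIV. cnj (v $ \<alpha>) * dzbar \<alpha> \<phi> z)"
proof -
  let ?L = "\<D> \<phi> z"
  have lin: "linear ?L" by (rule linear_frechet_derivative[OF assms])
  have e: "?L w = (\<Sum>\<alpha>\<in>UNIV. Re (w $ \<alpha>) *\<^sub>R ?L (axis \<alpha> 1) + Im (w $ \<alpha>) *\<^sub>R ?L (axis \<alpha> \<i>))" for w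
  proof -
    have "w = (\<Sum>\<alpha>\<in>UNIV. Re (w $ \<alpha>) *\<^sub>R axis \<alpha> 1 + Im (w $ \<alpha>) *\<^sub>R axis \<alpha> \<i>)"
      by (simp add: vec_eq_iff axis_def if_distrib[of "\<lambda>x. _ *\<^sub>R x"] sum.distrib cong: if_cong)
        (simp add: complex_eq_iff)
    then have "?L w = ?L (\<Sum>\<alpha>\<in>UNIV. Re (w $ \<alpha>) *\<^sub>R axis \<alpha> 1 + Im (w $ \<alpha>) *\<^sub>R axis \<alpha> \<i>)" by simp
    then show ?thesis by (simp add: linear_sum[OF lin] linear_add[OF lin] linear_cmul[OF lin])
  qed
  have v: "v $ \<alpha> = complex_of_real (Re (v $ \<alpha>)) + \<i> * complex_of_real (Im (v $ \<alpha>))"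
    "cnj (v $ \<alpha>) = complex_of_real (Re (v $ \<alpha>)) - \<i> * complex_of_real (Im (v $ \<alpha>))" for \<alpha>
    by (simp_all add: complex_eq_iff)
  show "(\<D> \<phi> z v - \<i> * \<D> \<phi> z (\<i> *s v)) / 2 = (\<Sum>\<alpha>\<in>UNIV. v $ \<alpha> * dz \<alpha> \<phi> z)"
    unfolding e[of v] e[of "\<i> *s v"] sum_distrib_left sum_subtractf[symmetric] sum_divide_distrib dz_def
    by (intro sum.cong refl, subst v(1)) (simp add: scaleR_conv_of_real field_simps)
  show "(\<D> \<phi> z v + \<i> * \<D> \<phi> z (\<i> *s v)) / 2 = (\<Sum>\<alpha>\<in>UNIV. cnj (v $ \<alpha>) * dzbar \<alpha> \<phi> z)"
    unfolding e[of v] e[of "\<i> *s v"] sum_distrib_left sum.distrib[symmetric] sum_divide_distrib dzbar_def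
    by (intro sum.cong refl, subst v(2)) (simp add: scaleR_conv_of_real field_simps)
qed

text \<open>A quadratic disc has prescribed velocity \<open>v\<close> and acceleration \<open>w\<close> at 0.  The acceleration will be
  used to absorb the first derivatives of a Hermitian metric, in the way that normal coordinates would.\<close>
definition disc :: "complex^'m \<Rightarrow> complex^'m \<Rightarrow> complex^'m \<Rightarrow> complex \<Rightarrow> complex^'m" where
  "disc p v w t = p + t *s v + (t * t / 2) *s w"

lemma bounded_bilinear_vector_smult: "bounded_bilinear (\<lambda>t (v::complex^'m). t *s v)"
  unfolding bilinear_conv_bounded_bilinear[symmetric] bilinear_def
  by (auto intro!: linearI simp: vec_eq_iff complex_eq_iff algebra_simps)

lemma disc_has_derivative: "(disc p v w has_derivative (\<lambda>s. s *s (v + t *s w))) (at t)"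
proof -
  have "((\<lambda>t. p + t *s v + (t * t / 2) *s w) has_derivative (\<lambda>s. 0 + s *s v + ((t * s + s * t) / 2) *s w)) (at t)"
    by (intro has_derivative_add has_derivative_const bounded_linear.has_derivative[OF bounded_linear_divide]
        has_derivative_mult has_derivative_ident
        bounded_linear.has_derivative[OF bounded_bilinear.bounded_linear_left[OF bounded_bilinear_vector_smult]])
  moreover have "0 + s *s v + ((t * s + s * t) / 2) *s w = s *s (v + t *s w)" for s
    by (simp add: vec_eq_iff algebra_simps)
  ultimately show ?thesis by (simp add: disc_def[abs_def])
qed

lemma smooth_on_disc:
  assumes "open S"
  shows "smooth_on S (disc p v w)"
proof -
  have id: "smooth_on S (\<lambda>t::complex. t)"
    using smooth_on_linear[OF bounded_linear_ident] .
  note sm = bounded_bilinear.bounded_linear_left[OF bounded_bilinear_vector_smult]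
  have "smooth_on S (\<lambda>t::complex. t * t)"
    by (rule smooth_on_bilinear[OF assms bounded_bilinear_mult id id])
  then have "smooth_on S (\<lambda>t. t * t / 2)"
    by (rule smooth_on_bounded_linear[OF assms bounded_linear_divide])
  then show ?thesis unfolding disc_def[abs_def]
    by (rule smooth_on_add[OF assms smooth_on_add[OF assms smooth_on_const smooth_on_linear[OF sm]]
          smooth_on_bounded_linear[OF assms sm]])
qed

lemma open_disc_vimage: "open U \<Longrightarrow> open (disc p v w -` U)"
  using smooth_on_continuous[OF smooth_on_disc[OF open_UNIV]] by (auto intro: open_vimage)

lemma fderiv_disc:
  assumes "\<phi> differentiable (at (disc p v w t))"
  shows "(\<lambda>t. \<phi> (disc p v w t)) differentiable (at t)"
    and "\<D> (\<lambda>t. \<phi> (disc p v w t)) t s = \<D> \<phi> (disc p v w t) (s *s (v + t *s w))"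
proof -
  note * = has_derivative_compose[OF disc_has_derivative has_derivative_fderiv[OF assms]]
  show "(\<lambda>t. \<phi> (disc p v w t)) differentiable (at t)" using * differentiableI by blast
  show "\<D> (\<lambda>t. \<phi> (disc p v w t)) t s = \<D> \<phi> (disc p v w t) (s *s (v + t *s w))"
    by (simp add: fderivI[OF *])
qed

lemma wirtinger_disc:
  assumes "\<phi> differentiable (at (disc p v w t))"
  shows "wirtinger (\<lambda>t. \<phi> (disc p v w t)) t
      = (\<Sum>\<alpha>\<in>UNIV. (v + t *s w) $ \<alpha> * dz \<alpha> \<phi> (disc p v w t))"
    and "wirtinger_bar (\<lambda>t. \<phi> (disc p v w t)) t
      = (\<Sum>\<alpha>\<in>UNIV. cnj ((v + t *s w) $ \<alpha>) * dzbar \<alpha> \<phi> (disc p v w t))"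
  unfolding wirtinger_def wirtinger_bar_def fderiv_disc(2)[OF assms]
  using dz_expand[OF assms, of "v + t *s w"] by simp_all

lemma wirtinger_affine:
  "wirtinger (\<lambda>t. (v + t *s w) $ i) t = w $ i" "wirtinger_bar (\<lambda>t. (v + t *s w) $ i) t = 0"
  "wirtinger (\<lambda>t. cnj ((v + t *s w) $ i)) t = 0" "wirtinger_bar (\<lambda>t. cnj ((v + t *s w) $ i)) t = cnj (w $ i)"
  "(\<lambda>t. (v + t *s w) $ i) differentiable (at t)" "(\<lambda>t. cnj ((v + t *s w) $ i)) differentiable (at t)"
proof -
  have d: "((\<lambda>t. v $ i + t * w $ i) has_derivative (\<lambda>s. s * w $ i)) (at t)"
    by (auto intro!: derivative_eq_intros)
  note d' = has_derivative_cnj[OF d]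
  show "wirtinger (\<lambda>t. (v + t *s w) $ i) t = w $ i" "wirtinger_bar (\<lambda>t. (v + t *s w) $ i) t = 0"
    using fderivI[OF d] by (simp_all add: wirtinger_def wirtinger_bar_def)
  show "wirtinger (\<lambda>t. cnj ((v + t *s w) $ i)) t = 0" "wirtinger_bar (\<lambda>t. cnj ((v + t *s w) $ i)) t = cnj (w $ i)"
    using fderivI[OF d'] by (simp_all add: wirtinger_def wirtinger_bar_def)
  show "(\<lambda>t. (v + t *s w) $ i) differentiable (at t)" "(\<lambda>t. cnj ((v + t *s w) $ i)) differentiable (at t)"
    using d d' differentiableI by (simp_all, blast+)
qed

lemma differentiable_dzbar:
  assumes "Ck_on 2 U \<phi>" "z \<in> U"
  shows "dzbar \<beta> \<phi> differentiable (at z)"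
proof -
  have d: "(\<lambda>t. \<D> \<phi> t v) differentiable (at z)" for v
    using assms by (auto simp: numeral_2_eq_2)
  show ?thesis unfolding dzbar_def[abs_def]
    using bounded_linear.has_derivative[OF bounded_linear_divide, OF has_derivative_add[OF
      has_derivative_fderiv[OF d] has_derivative_mult_right[OF has_derivative_fderiv[OF d]]]]
      differentiableI by blast
qed

text \<open>The disc is holomorphic, so its acceleration does not contribute, and the mixed derivative of
  \<open>\<phi>\<close> along the disc is the Levi form of \<open>\<phi>\<close> in the direction of the velocity.\<close>
lemma levi_form_disc:
  assumes U: "open U" and \<phi>: "Ck_on 2 U \<phi>" and t: "disc p v w t \<in> U"
  shows "wirtinger (wirtinger_bar (\<lambda>t. \<phi> (disc p v w t))) t
      = (\<Sum>\<alpha>\<in>UNIV. \<Sum>\<beta>\<in>UNIV. dz \<alpha> (dzbar \<beta> \<phi>) (disc p v w t)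
          * (v + t *s w) $ \<alpha> * cnj ((v + t *s w) $ \<beta>))" (is "?lhs = ?rhs")
    and "wirtinger_bar (\<lambda>t. \<phi> (disc p v w t)) differentiable (at t)"
proof -
  have d: "\<phi> differentiable (at z)" if "z \<in> U" for z using \<phi> that by (auto simp: numeral_2_eq_2)
  note S = open_disc_vimage[OF U, of p v w]
  let ?E = "\<lambda>t. \<Sum>\<beta>\<in>UNIV. cnj ((v + t *s w) $ \<beta>) * dzbar \<beta> \<phi> (disc p v w t)"
  have eq: "\<And>s. s \<in> disc p v w -` U \<Longrightarrow> wirtinger_bar (\<lambda>t. \<phi> (disc p v w t)) s = ?E s"
    by (rule wirtinger_disc(2)) (auto intro: d)
  note dd = differentiable_dzbar[OF \<phi> t]
  have di: "(\<lambda>t. cnj ((v + t *s w) $ \<beta>) * dzbar \<beta> \<phi> (disc p v w t)) differentiable (at t)" for \<beta>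
    by (rule differentiable_mult[OF wirtinger_affine(6) fderiv_disc(1)[OF dd]])
  have "wirtinger (wirtinger_bar (\<lambda>t. \<phi> (disc p v w t))) t = wirtinger ?E t"
    by (rule wirtinger_cong_open[OF S _ eq]) (use t in auto)
  also have "\<dots> = (\<Sum>\<beta>\<in>UNIV. cnj ((v + t *s w) $ \<beta>) *
      (\<Sum>\<alpha>\<in>UNIV. (v + t *s w) $ \<alpha> * dz \<alpha> (dzbar \<beta> \<phi>) (disc p v w t)))"
    by (simp only: wirtinger_sum(1)[OF di] wirtinger_mult(1)[OF wirtinger_affine(6) fderiv_disc(1)[OF dd]]
        wirtinger_affine(3) wirtinger_disc(1)[OF dd] mult_zero_left add_0)
  also have "\<dots> = (\<Sum>\<beta>\<in>UNIV. \<Sum>\<alpha>\<in>UNIV. dz \<alpha> (dzbar \<beta> \<phi>) (disc p v w t)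
          * (v + t *s w) $ \<alpha> * cnj ((v + t *s w) $ \<beta>))"
    by (simp only: sum_distrib_left mult_ac)
  also have "\<dots> = ?rhs" by (rule sum.swap)
  finally show "?lhs = ?rhs" .
  have "?E differentiable (at t)" by (rule differentiable_sum) (use di in auto)
  then show "wirtinger_bar (\<lambda>t. \<phi> (disc p v w t)) differentiable (at t)"
    using differentiable_cong_open[OF S _ eq] t by simp
qed


lemma matrix_inv_works:
  fixes A :: "'a::field^'n^'n"
  assumes "invertible A"
  shows "A ** matrix_inv A = mat 1" "matrix_inv A ** A = mat 1"
  using someI_ex[OF assms[unfolded invertible_def]] unfolding matrix_inv_def by auto

lemma matrix_inv_sum:
  fixes A :: "'a::field^'n^'n"
  assumes "invertible A"
  shows "(\<Sum>l\<in>UNIV. matrix_inv A $ i $ l * A $ l $ j) = (if i = j then 1 else 0)"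
    "(\<Sum>l\<in>UNIV. A $ i $ l * matrix_inv A $ l $ j) = (if i = j then 1 else 0)"
  using matrix_inv_works[OF assms] by (simp_all add: vec_eq_iff matrix_matrix_mult_def mat_def)

lemma sum4_swap:
  "(\<Sum>i\<in>A. \<Sum>j\<in>B. \<Sum>\<alpha>\<in>C. \<Sum>\<beta>\<in>D. f i j \<alpha> \<beta>) = (\<Sum>\<alpha>\<in>C. \<Sum>\<beta>\<in>D. \<Sum>i\<in>A. \<Sum>j\<in>B. f i j \<alpha> \<beta>)"
proof -
  have "(\<Sum>i\<in>A. \<Sum>j\<in>B. \<Sum>\<alpha>\<in>C. \<Sum>\<beta>\<in>D. f i j \<alpha> \<beta>) = (\<Sum>i\<in>A. \<Sum>\<alpha>\<in>C. \<Sum>j\<in>B. \<Sum>\<beta>\<in>D. f i j \<alpha> \<beta>)"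
    by (intro sum.cong refl sum.swap)
  also have "\<dots> = (\<Sum>\<alpha>\<in>C. \<Sum>i\<in>A. \<Sum>j\<in>B. \<Sum>\<beta>\<in>D. f i j \<alpha> \<beta>)" by (rule sum.swap)
  also have "\<dots> = (\<Sum>\<alpha>\<in>C. \<Sum>i\<in>A. \<Sum>\<beta>\<in>D. \<Sum>j\<in>B. f i j \<alpha> \<beta>)"
    by (intro sum.cong refl sum.swap)
  also have "\<dots> = (\<Sum>\<alpha>\<in>C. \<Sum>\<beta>\<in>D. \<Sum>i\<in>A. \<Sum>j\<in>B. f i j \<alpha> \<beta>)"
    by (intro sum.cong refl sum.swap)
  finally show ?thesis .
qed

text \<open>The product rule for \<open>H(\<gamma>)(\<gamma>', \<gamma>')\<close> along a disc \<open>\<gamma>\<close> with acceleration \<open>w\<close>: as \<open>\<gamma>'\<close> is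
  holomorphic, \<open>wirtinger_bar\<close> acts only on \<open>H(\<gamma>)\<close> and on the second argument, and \<open>wirtinger\<close> only on
  \<open>H(\<gamma>)\<close> and on the first.\<close>
lemma hermitian_disc_levi:
  fixes H :: "complex^'m \<Rightarrow> complex^'m^'m" and p v w :: "complex^'m"
  defines "q \<equiv> \<lambda>t. herm_form (H (disc p v w t)) (v + t *s w) (v + t *s w)"
  assumes U: "open U" "p \<in> U" and H: "smooth_on U H"
  shows "smooth_on (disc p v w -` U) q"
    and "wirtinger (wirtinger_bar q) 0 =
      (\<Sum>i\<in>UNIV. \<Sum>j\<in>UNIV.
        (\<Sum>\<alpha>\<in>UNIV. \<Sum>\<beta>\<in>UNIV. dz \<alpha> (dzbar \<beta> (\<lambda>y. H y $ i $ j)) p * v $ \<alpha> * cnj (v $ \<beta>)) * v $ i * cnj (v $ j)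
        + (\<Sum>\<beta>\<in>UNIV. dzbar \<beta> (\<lambda>y. H y $ i $ j) p * cnj (v $ \<beta>)) * w $ i * cnj (v $ j)
        + (\<Sum>\<alpha>\<in>UNIV. dz \<alpha> (\<lambda>y. H y $ i $ j) p * v $ \<alpha>) * v $ i * cnj (w $ j)
        + H p $ i $ j * w $ i * cnj (w $ j))" (is "_ = ?rhs")
proof -
  let ?S = "disc p v w -` U"
  have S: "open ?S" "0 \<in> ?S" using open_disc_vimage U by (auto simp: disc_def)
  have Hij: "smooth_on U (\<lambda>y. H y $ i $ j)" for i j
    by (intro smooth_on_bounded_linear[OF U(1) bounded_linear_vec_nth] H)
  have h: "smooth_on ?S (\<lambda>t. H (disc p v w t) $ i $ j)" for i j
    by (rule smooth_on_compose[OF S(1) _ Hij smooth_on_disc[OF S(1)]]) auto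
  have V: "smooth_on ?S (\<lambda>t. (v + t *s w) $ i)" "smooth_on ?S (\<lambda>t. cnj ((v + t *s w) $ i))" for i
  proof -
    have "smooth_on ?S (\<lambda>t. v + t *s w)"
      by (rule smooth_on_add[OF S(1) smooth_on_const
            smooth_on_linear[OF bounded_bilinear.bounded_linear_left[OF bounded_bilinear_vector_smult]]])
    then show "smooth_on ?S (\<lambda>t. (v + t *s w) $ i)"
      by (rule smooth_on_bounded_linear[OF S(1) bounded_linear_vec_nth])
    then show "smooth_on ?S (\<lambda>t. cnj ((v + t *s w) $ i))"
      by (rule smooth_on_bounded_linear[OF S(1) bounded_linear_cnj])
  qed
  have q: "q = (\<lambda>t. \<Sum>i\<in>UNIV. \<Sum>j\<in>UNIV. H (disc p v w t) $ i $ j * (v + t *s w) $ i * cnj ((v + t *s w) $ j))"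
    by (simp add: q_def herm_form_def)
  show smooth: "smooth_on ?S q"
    unfolding q by (intro smooth_on_sum S(1) smooth_on_bilinear[OF S(1) bounded_bilinear_mult] h V)
  let ?h = "\<lambda>i j t. H (disc p v w t) $ i $ j"
  have C2: "Ck_on 2 U (\<lambda>y. H y $ i $ j)" for i j using Hij by (simp add: smooth_on_def)
  have dh: "?h i j differentiable (at t)" if "t \<in> ?S" for i j t
    using h that by (rule smooth_onD)
  note wa = wirtinger_affine
  have dhV: "(\<lambda>t. ?h i j t * (v + t *s w) $ i) differentiable (at t)" if "t \<in> ?S" for i j t
    by (rule differentiable_mult[OF dh[OF that] wa(5)])
  have dq: "(\<lambda>t. ?h i j t * (v + t *s w) $ i * cnj ((v + t *s w) $ j)) differentiable (at t)" if "t \<in> ?S" for i j t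
    by (rule differentiable_mult[OF dhV[OF that] wa(6)])
  let ?g = "\<lambda>i j t. wirtinger_bar (?h i j) t * (v + t *s w) $ i * cnj ((v + t *s w) $ j)
      + ?h i j t * (v + t *s w) $ i * cnj (w $ j)"
  have wb: "wirtinger_bar q t = (\<Sum>i\<in>UNIV. \<Sum>j\<in>UNIV. ?g i j t)" if "t \<in> ?S" for t
  proof -
    have "wirtinger_bar q t = (\<Sum>i\<in>UNIV. \<Sum>j\<in>UNIV.
      wirtinger_bar (\<lambda>t. ?h i j t * (v + t *s w) $ i * cnj ((v + t *s w) $ j)) t)"
      unfolding q by (rule wirtinger_double_sum(2)) (rule dq[OF that])
    then show ?thesis
      by (simp only: wirtinger_mult(2)[OF dhV[OF that] wa(6)] wirtinger_mult(2)[OF dh[OF that] wa(5)] wa(2,4)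
          mult_zero_right add_0_right)
  qed
  have dwb: "wirtinger_bar (?h i j) differentiable (at 0)"
    and ww: "wirtinger (wirtinger_bar (?h i j)) 0
      = (\<Sum>\<alpha>\<in>UNIV. \<Sum>\<beta>\<in>UNIV. dz \<alpha> (dzbar \<beta> (\<lambda>y. H y $ i $ j)) p * v $ \<alpha> * cnj (v $ \<beta>))" for i j
    using levi_form_disc[OF U(1) C2[of i j], of p v w 0] U(2) by (simp_all add: disc_def)
  have w1: "wirtinger (?h i j) 0 = (\<Sum>\<alpha>\<in>UNIV. v $ \<alpha> * dz \<alpha> (\<lambda>y. H y $ i $ j) p)"
    "wirtinger_bar (?h i j) 0 = (\<Sum>\<alpha>\<in>UNIV. cnj (v $ \<alpha>) * dzbar \<alpha> (\<lambda>y. H y $ i $ j) p)" for i j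
    using wirtinger_disc[of "\<lambda>y. H y $ i $ j" p v w 0] smooth_onD[OF Hij U(2), of i j] by (simp_all add: disc_def)
  have d1: "(\<lambda>t. wirtinger_bar (?h i j) t * (v + t *s w) $ i) differentiable (at 0)" for i j
    by (rule differentiable_mult[OF dwb wa(5)])
  have d2: "(\<lambda>t. wirtinger_bar (?h i j) t * (v + t *s w) $ i * cnj ((v + t *s w) $ j)) differentiable (at 0)" for i j
    by (rule differentiable_mult[OF d1 wa(6)])
  have d3: "(\<lambda>t. ?h i j t * (v + t *s w) $ i * cnj (w $ j)) differentiable (at 0)" for i j
    by (rule differentiable_mult[OF dhV[OF S(2)] differentiable_const])
  have d4: "?g i j differentiable (at 0)" for i j by (rule differentiable_add[OF d2 d3])
  have c: "wirtinger (\<lambda>t. cnj (w $ j)) 0 = 0" for j by (simp add: wirtinger_def)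
  have wadd: "wirtinger (\<lambda>t. a t + b t) 0 = wirtinger a 0 + wirtinger b 0"
    if "a differentiable (at 0)" "b differentiable (at 0)" for a b
    using fderivI[OF has_derivative_add[OF that[THEN has_derivative_fderiv]]]
    by (simp add: wirtinger_def field_simps)
  have "wirtinger (wirtinger_bar q) 0 = wirtinger (\<lambda>t. \<Sum>i\<in>UNIV. \<Sum>j\<in>UNIV. ?g i j t) 0"
    by (rule wirtinger_cong_open[OF S wb])
  also have "\<dots> = (\<Sum>i\<in>UNIV. \<Sum>j\<in>UNIV. wirtinger (?g i j) 0)"
    by (rule wirtinger_double_sum(1)) (rule d4)
  also have "\<dots> = (\<Sum>i\<in>UNIV. \<Sum>j\<in>UNIV.
        wirtinger (wirtinger_bar (?h i j)) 0 * v $ i * cnj (v $ j)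
        + wirtinger_bar (?h i j) 0 * w $ i * cnj (v $ j)
        + wirtinger (?h i j) 0 * v $ i * cnj (w $ j)
        + H p $ i $ j * w $ i * cnj (w $ j))"
  proof (intro sum.cong refl)
    fix i j
    show "wirtinger (?g i j) 0 = wirtinger (wirtinger_bar (?h i j)) 0 * v $ i * cnj (v $ j)
        + wirtinger_bar (?h i j) 0 * w $ i * cnj (v $ j)
        + wirtinger (?h i j) 0 * v $ i * cnj (w $ j)
        + H p $ i $ j * w $ i * cnj (w $ j)"
      unfolding wadd[OF d2 d3] wirtinger_mult(1)[OF d1 wa(6)] wirtinger_mult(1)[OF dwb wa(5)]
        wirtinger_mult(1)[OF dhV[OF S(2)] differentiable_const] wirtinger_mult(1)[OF dh[OF S(2)] wa(5)] wa c
      by (simp add: disc_def algebra_simps)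
  qed
  finally show "wirtinger (wirtinger_bar q) 0 = ?rhs"
    by (simp add: ww w1 mult.commute)
qed


lemma invertible_posdef_hermitian:
  assumes "\<And>v. v \<noteq> 0 \<Longrightarrow> Re (herm_form H v v) > 0"
  shows "invertible H"
proof -
  have "v = 0" if "transpose H *v v = 0" for v
  proof (rule ccontr)
    assume "v \<noteq> 0"
    then have "Re (herm_form H v v) > 0" by (rule assms)
    moreover have "herm_form H v v = (\<Sum>j\<in>UNIV. (transpose H *v v) $ j * cnj (v $ j))"
      unfolding herm_form_def
      by (subst sum.swap) (simp add: matrix_vector_mult_def transpose_def sum_distrib_right)
    ultimately show False using that by simp
  qed
  then have "invertible (transpose H)"
    by (simp add: invertible_left_inverse matrix_left_invertible_ker)
  then obtain K where "transpose H ** K = mat 1" unfolding invertible_def by blast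
  then have "transpose K ** H = mat 1"
    by (metis matrix_transpose_mul transpose_mat transpose_transpose)
  then show ?thesis using invertible_left_inverse by blast
qed

abbreviation chern_quartic :: "(complex^'m \<Rightarrow> complex^'m^'m) \<Rightarrow> complex^'m \<Rightarrow> complex^'m \<Rightarrow> complex" where
  "chern_quartic H p v \<equiv> \<Sum>\<alpha>\<in>UNIV. \<Sum>\<beta>\<in>UNIV. \<Sum>\<gamma>\<in>UNIV. \<Sum>\<delta>\<in>UNIV.
    chern_curv H \<alpha> \<beta> \<gamma> \<delta> p * v $ \<alpha> * cnj (v $ \<beta>) * v $ \<gamma> * cnj (v $ \<delta>)"

text \<open>Completing the square.  By \<open>hermitian_disc_levi\<close> the Laplacian is a quadratic polynomial in \<open>w\<close> with
  leading part \<open>4 H(w, w)\<close>.  At its critical point the terms with \<open>w\<close> become the second summand of the Chern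
  curvature, and the whole is \<open>- 4 R(v, \<bar>v, v, \<bar>v)\<close>.\<close>
lemma disc_hermitian_norm_superharmonic:
  fixes H :: "complex^'m \<Rightarrow> complex^'m^'m" and p v :: "complex^'m"
  assumes U: "open U" "p \<in> U" and H: "smooth_on U H" and inv: "invertible (H p)"
    and pos: "Re (chern_quartic H p v) > 0"
  obtains w where
    "smooth_on (disc p v w -` U) (\<lambda>t. Re (herm_form (H (disc p v w t)) (v + t *s w) (v + t *s w)))"
    "laplacian (\<lambda>t. Re (herm_form (H (disc p v w t)) (v + t *s w) (v + t *s w))) 0 < 0"
proof -
  define A where "A i j = (\<Sum>\<alpha>\<in>UNIV. \<Sum>\<beta>\<in>UNIV. dz \<alpha> (dzbar \<beta> (\<lambda>y. H y $ i $ j)) p * v $ \<alpha> * cnj (v $ \<beta>))" for i j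
  define B where "B i j = (\<Sum>\<beta>\<in>UNIV. dzbar \<beta> (\<lambda>y. H y $ i $ j) p * cnj (v $ \<beta>))" for i j
  define C where "C i j = (\<Sum>\<alpha>\<in>UNIV. dz \<alpha> (\<lambda>y. H y $ i $ j) p * v $ \<alpha>)" for i j
  define a where "a j = (\<Sum>i\<in>UNIV. C i j * v $ i)" for j
  define N where "N = matrix_inv (H p)"
  \<comment> \<open>The critical point of the quadratic polynomial: it makes the terms in the conjugate of \<open>w\<close> cancel.\<close>
  define w where "w = (\<chi> i. - (\<Sum>\<nu>\<in>UNIV. N $ \<nu> $ i * a \<nu>))"
  define q where "q t = herm_form (H (disc p v w t)) (v + t *s w) (v + t *s w)" for t
  let ?S = "disc p v w -` U"
  have S: "open ?S" "0 \<in> ?S" using open_disc_vimage U by (auto simp: disc_def)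
  note lv = hermitian_disc_levi[OF U H, of v w, folded q_def]
  have q: "smooth_on ?S q" using lv(1) by (simp add: q_def[abs_def])
  have "wirtinger (wirtinger_bar q) 0 =
      (\<Sum>i\<in>UNIV. \<Sum>j\<in>UNIV. A i j * v $ i * cnj (v $ j) + B i j * w $ i * cnj (v $ j)
        + C i j * v $ i * cnj (w $ j) + H p $ i $ j * w $ i * cnj (w $ j))"
    using lv(2) by (simp add: q_def[abs_def] A_def B_def C_def)
  also have "\<dots> = (\<Sum>i\<in>UNIV. \<Sum>j\<in>UNIV. A i j * v $ i * cnj (v $ j)) + (\<Sum>i\<in>UNIV. \<Sum>j\<in>UNIV. B i j * w $ i * cnj (v $ j))
        + ((\<Sum>i\<in>UNIV. \<Sum>j\<in>UNIV. C i j * v $ i * cnj (w $ j)) + (\<Sum>i\<in>UNIV. \<Sum>j\<in>UNIV. H p $ i $ j * w $ i * cnj (w $ j)))"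
    by (simp add: sum.distrib)
  also have "(\<Sum>i\<in>UNIV. \<Sum>j\<in>UNIV. C i j * v $ i * cnj (w $ j)) + (\<Sum>i\<in>UNIV. \<Sum>j\<in>UNIV. H p $ i $ j * w $ i * cnj (w $ j)) = 0"
  proof -
    have Hw: "(\<Sum>i\<in>UNIV. H p $ i $ j * w $ i) = - a j" for j
    proof -
      have "(\<Sum>i\<in>UNIV. H p $ i $ j * w $ i) = - (\<Sum>i\<in>UNIV. \<Sum>\<nu>\<in>UNIV. (N $ \<nu> $ i * H p $ i $ j) * a \<nu>)"
        by (simp add: w_def sum_distrib_left sum_negf mult_ac)
      also have "\<dots> = - (\<Sum>\<nu>\<in>UNIV. (\<Sum>i\<in>UNIV. N $ \<nu> $ i * H p $ i $ j) * a \<nu>)"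
        by (subst sum.swap) (simp add: sum_distrib_right)
      also have "\<dots> = - a j"
        by (simp add: N_def matrix_inv_sum[OF inv] if_distrib[of "\<lambda>x. x * _"] cong: if_cong)
      finally show ?thesis .
    qed
    have "(\<Sum>i\<in>UNIV. \<Sum>j\<in>UNIV. C i j * v $ i * cnj (w $ j)) = (\<Sum>j\<in>UNIV. a j * cnj (w $ j))"
      by (subst sum.swap) (simp add: a_def sum_distrib_right)
    moreover have "(\<Sum>i\<in>UNIV. \<Sum>j\<in>UNIV. H p $ i $ j * w $ i * cnj (w $ j)) = (\<Sum>j\<in>UNIV. - a j * cnj (w $ j))"
      by (subst sum.swap) (simp add: Hw[symmetric] sum_distrib_right)
    ultimately show ?thesis by (simp add: sum_negf)
  qed
  also have "(\<Sum>i\<in>UNIV. \<Sum>j\<in>UNIV. B i j * w $ i * cnj (v $ j))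
    = - (\<Sum>\<mu>\<in>UNIV. \<Sum>\<nu>\<in>UNIV. N $ \<nu> $ \<mu> * (a \<nu> * (\<Sum>j\<in>UNIV. B \<mu> j * cnj (v $ j))))"
    by (simp add: w_def sum_distrib_left sum_distrib_right sum_negf mult_ac)
      (intro sum.cong refl sum.swap)
  also have "(\<Sum>\<mu>\<in>UNIV. \<Sum>\<nu>\<in>UNIV. N $ \<nu> $ \<mu> * (a \<nu> * (\<Sum>j\<in>UNIV. B \<mu> j * cnj (v $ j))))
    = (\<Sum>\<alpha>\<in>UNIV. \<Sum>\<beta>\<in>UNIV. \<Sum>\<gamma>\<in>UNIV. \<Sum>\<delta>\<in>UNIV. \<Sum>\<mu>\<in>UNIV. \<Sum>\<nu>\<in>UNIV.
        N $ \<nu> $ \<mu> * dz \<alpha> (\<lambda>y. H y $ \<gamma> $ \<nu>) p * dzbar \<beta> (\<lambda>y. H y $ \<mu> $ \<delta>) p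
          * (v $ \<alpha> * cnj (v $ \<beta>) * v $ \<gamma> * cnj (v $ \<delta>)))" (is "_ = (\<Sum>\<alpha>\<in>UNIV. \<Sum>\<beta>\<in>UNIV. \<Sum>\<gamma>\<in>UNIV. \<Sum>\<delta>\<in>UNIV. \<Sum>\<mu>\<in>UNIV. \<Sum>\<nu>\<in>UNIV. ?X \<alpha> \<beta> \<gamma> \<delta> \<mu> \<nu>)")
  proof -
    have "(\<Sum>\<alpha>\<in>UNIV. \<Sum>\<beta>\<in>UNIV. \<Sum>\<gamma>\<in>UNIV. \<Sum>\<delta>\<in>UNIV. \<Sum>\<mu>\<in>UNIV. \<Sum>\<nu>\<in>UNIV. ?X \<alpha> \<beta> \<gamma> \<delta> \<mu> \<nu>)
      = (\<Sum>\<gamma>\<in>UNIV. \<Sum>\<delta>\<in>UNIV. \<Sum>\<alpha>\<in>UNIV. \<Sum>\<beta>\<in>UNIV. \<Sum>\<mu>\<in>UNIV. \<Sum>\<nu>\<in>UNIV. ?X \<alpha> \<beta> \<gamma> \<delta> \<mu> \<nu>)"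
      by (rule sum4_swap)
    also have "\<dots> = (\<Sum>\<gamma>\<in>UNIV. \<Sum>\<delta>\<in>UNIV. \<Sum>\<mu>\<in>UNIV. \<Sum>\<nu>\<in>UNIV. \<Sum>\<alpha>\<in>UNIV. \<Sum>\<beta>\<in>UNIV. ?X \<alpha> \<beta> \<gamma> \<delta> \<mu> \<nu>)"
      by (intro sum.cong refl sum4_swap)
    also have "\<dots> = (\<Sum>\<mu>\<in>UNIV. \<Sum>\<nu>\<in>UNIV. \<Sum>\<gamma>\<in>UNIV. \<Sum>\<delta>\<in>UNIV. \<Sum>\<alpha>\<in>UNIV. \<Sum>\<beta>\<in>UNIV. ?X \<alpha> \<beta> \<gamma> \<delta> \<mu> \<nu>)"
      by (rule sum4_swap)
    also have "\<dots> = (\<Sum>\<mu>\<in>UNIV. \<Sum>\<nu>\<in>UNIV. N $ \<nu> $ \<mu> * (a \<nu> * (\<Sum>j\<in>UNIV. B \<mu> j * cnj (v $ j))))"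
    proof (intro sum.cong refl)
      fix \<mu> \<nu>
      have "N $ \<nu> $ \<mu> * (a \<nu> * (\<Sum>j\<in>UNIV. B \<mu> j * cnj (v $ j)))
        = (\<Sum>\<gamma>\<in>UNIV. \<Sum>\<delta>\<in>UNIV. N $ \<nu> $ \<mu> * (v $ \<gamma> * cnj (v $ \<delta>)) * (C \<gamma> \<nu> * B \<mu> \<delta>))"
        unfolding a_def sum_product by (simp add: sum_distrib_left mult_ac)
      also have "\<dots> = (\<Sum>\<gamma>\<in>UNIV. \<Sum>\<delta>\<in>UNIV. \<Sum>\<alpha>\<in>UNIV. \<Sum>\<beta>\<in>UNIV. ?X \<alpha> \<beta> \<gamma> \<delta> \<mu> \<nu>)"
        unfolding C_def B_def sum_product by (simp add: sum_distrib_left mult_ac)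
      finally show "(\<Sum>\<gamma>\<in>UNIV. \<Sum>\<delta>\<in>UNIV. \<Sum>\<alpha>\<in>UNIV. \<Sum>\<beta>\<in>UNIV. ?X \<alpha> \<beta> \<gamma> \<delta> \<mu> \<nu>)
        = N $ \<nu> $ \<mu> * (a \<nu> * (\<Sum>j\<in>UNIV. B \<mu> j * cnj (v $ j)))" ..
    qed
    finally show ?thesis ..
  qed
  also have "(\<Sum>i\<in>UNIV. \<Sum>j\<in>UNIV. A i j * v $ i * cnj (v $ j))
    = (\<Sum>\<alpha>\<in>UNIV. \<Sum>\<beta>\<in>UNIV. \<Sum>\<gamma>\<in>UNIV. \<Sum>\<delta>\<in>UNIV.
        dz \<alpha> (dzbar \<beta> (\<lambda>y. H y $ \<gamma> $ \<delta>)) p * (v $ \<alpha> * cnj (v $ \<beta>) * v $ \<gamma> * cnj (v $ \<delta>)))"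
    unfolding A_def sum_distrib_right by (subst sum4_swap) (simp only: mult_ac)
  finally have W: "wirtinger (wirtinger_bar q) 0 = - chern_quartic H p v"
    unfolding chern_curv_def N_def
    by (simp add: sum.distrib sum_negf sum_distrib_right left_diff_distrib sum_subtractf mult.assoc)
  let ?Q = "\<lambda>t. Re (q t)"
  note bl = bounded_linear_Re
  have C2: "Ck_on 2 ?S q" using q by (simp add: smooth_on_def)
  note eq = second_fderiv_bounded_linear[OF S bl C2]
  have "wirtinger (wirtinger_bar q) 0 = laplacian q 0 / 4"
    by (rule wirtinger_wirtinger_bar[OF S C2])
  then have "laplacian q 0 = of_real 4 * wirtinger (wirtinger_bar q) 0"
    by (simp add: mult.commute)
  then have "Re (laplacian q 0) = Re (of_real 4 * wirtinger (wirtinger_bar q) 0)"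
    by (rule arg_cong)
  then have "laplacian ?Q 0 = 4 * Re (wirtinger (wirtinger_bar q) 0)"
    unfolding eq by (simp del: of_real_numeral)
  also have "\<dots> < 0" using pos unfolding W by simp
  finally have "laplacian ?Q 0 < 0" .
  moreover have "smooth_on ?S ?Q" by (rule smooth_on_bounded_linear[OF S(1) bl q])
  ultimately show thesis by (intro that[of w]) (simp_all add: q_def)
qed

section \<open>Comparison of the energy and the Hermitian metric at a maximum\<close>

text \<open>Four times the squared norm of \<open>\<partial>u(v)\<close>, expressed by the real differential of \<open>u\<close>.\<close>
definition pointwise_energy ::
  "('v \<Rightarrow> 'v \<Rightarrow> 'v \<Rightarrow> real) \<Rightarrow> (complex^'m \<Rightarrow> 'v::real_normed_vector) \<Rightarrow> complex^'m \<Rightarrow> complex^'m \<Rightarrow> real" where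
  "pointwise_energy G u x v
    = G (u x) (\<D> u x v) (\<D> u x v) + G (u x) (\<D> u x (\<i> *s v)) (\<D> u x (\<i> *s v))"

lemma energy_disc:
  assumes "u differentiable (at (disc p v w t))"
  shows "energy G (\<lambda>t. u (disc p v w t)) t = pointwise_energy G u (disc p v w t) (v + t *s w)"
  by (simp add: energy_def pointwise_energy_def fderiv_disc(2)[OF assms])

text \<open>At a maximum of the ratio of the energy to \<open>H\<close>, both quantities are compared along the disc that is
  tangent to the maximizing vector \<open>v\<close> and has the acceleration found above.\<close>
lemma (in nonpos_connection) no_positive_energy_maximum:
  fixes u :: "complex^'m \<Rightarrow> 'v" and H :: "complex^'m \<Rightarrow> complex^'m^'m"
  assumes V: "open V" "p \<in> V" and u: "smooth_on V u" "u ` V \<subseteq> U" and H: "smooth_on V H"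
    and inv: "invertible (H p)"
    and pos: "Re (chern_quartic H p v) > 0"
    and harmonic: "\<And>w t. disc p v w t \<in> V \<Longrightarrow> tension \<Gamma> (\<lambda>t. u (disc p v w t)) t = 0"
    and le: "\<And>x y. x \<in> V \<Longrightarrow> pointwise_energy G u x y \<le> c * Re (herm_form (H x) y y)"
    and eq: "pointwise_energy G u p v = c * Re (herm_form (H p) v v)"
    and c: "c > 0"
  shows False
proof -
  obtain w where Q: "smooth_on (disc p v w -` V) (\<lambda>t. Re (herm_form (H (disc p v w t)) (v + t *s w) (v + t *s w)))"
    and Q_neg: "laplacian (\<lambda>t. Re (herm_form (H (disc p v w t)) (v + t *s w) (v + t *s w))) 0 < 0"
    by (rule disc_hermitian_norm_superharmonic[OF V H inv pos])
  let ?S = "disc p v w -` V"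
  let ?Q = "\<lambda>t. Re (herm_form (H (disc p v w t)) (v + t *s w) (v + t *s w))"
  let ?F = "\<lambda>t. u (disc p v w t)"
  let ?e = "energy G ?F"
  have S: "open ?S" "0 \<in> ?S" using open_disc_vimage V by (auto simp: disc_def)
  have F: "smooth_on ?S ?F" by (rule smooth_on_compose[OF S(1) _ u(1) smooth_on_disc[OF S(1)]]) auto
  have FU: "\<And>s. s \<in> ?S \<Longrightarrow> ?F s \<in> U" using u(2) by auto
  have harm: "\<And>s. s \<in> ?S \<Longrightarrow> tension \<Gamma> ?F s = 0" using harmonic by simp
  have sub: "\<And>t. t \<in> ?S \<Longrightarrow> ?e differentiable (at t)"
    "\<And>t d. t \<in> ?S \<Longrightarrow> (\<lambda>t. \<D> ?e t d) differentiable (at t)"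
    "\<And>t. t \<in> ?S \<Longrightarrow> laplacian ?e t \<ge> 0"
    by (rule energy_subharmonic[OF S(1) _ F]; use FU harm in auto)+
  have en: "?e t = pointwise_energy G u (disc p v w t) (v + t *s w)" if "t \<in> ?S" for t
    using that by (intro energy_disc smooth_onD[OF u(1)]) simp
  define \<phi> where "\<phi> t = ?e t - c * ?Q t" for t
  have \<phi>: "(\<phi> has_derivative (\<lambda>d. \<D> ?e t d - c * \<D> ?Q t d)) (at t)" if "t \<in> ?S" for t
    unfolding \<phi>_def[abs_def]
    by (intro has_derivative_diff has_derivative_mult_right has_derivative_fderiv sub(1) smooth_onD[OF Q] that)
  have \<phi>1: "\<D> \<phi> t d = \<D> ?e t d - c * \<D> ?Q t d" if "t \<in> ?S" for t d
    using fderivI[OF \<phi>[OF that]] by simp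
  have \<phi>2: "((\<lambda>t. \<D> \<phi> t d) has_derivative
      (\<lambda>d'. \<D> (\<lambda>t. \<D> ?e t d) 0 d' - c * \<D> (\<lambda>t. \<D> ?Q t d) 0 d')) (at 0)" for d
  proof -
    have "((\<lambda>t. \<D> ?e t d - c * \<D> ?Q t d) has_derivative
      (\<lambda>d'. \<D> (\<lambda>t. \<D> ?e t d) 0 d' - c * \<D> (\<lambda>t. \<D> ?Q t d) 0 d')) (at 0)"
      by (intro has_derivative_diff has_derivative_mult_right has_derivative_fderiv sub(2)[OF S(2)]
          smooth_onD[OF smooth_on_fderiv[OF Q] S(2)])
    then show ?thesis
      by (rule has_derivative_transform_within_open[OF _ S]) (simp add: \<phi>1)
  qed
  have \<phi>0: "\<phi> 0 = 0" using eq en[OF S(2)] by (simp add: \<phi>_def disc_def)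
  have max: "\<phi> t \<le> \<phi> 0" if "t \<in> ?S" for t
    unfolding \<phi>0 using le[of "disc p v w t" "v + t *s w"] en[OF that] that by (simp add: \<phi>_def)
  have "\<D> (\<lambda>t. \<D> \<phi> t d) 0 d \<le> 0" for d
    by (rule second_derivative_at_max[OF S differentiableI[OF \<phi>] differentiableI[OF \<phi>2] max])
  then have "\<D> (\<lambda>t. \<D> ?e t d) 0 d \<le> c * \<D> (\<lambda>t. \<D> ?Q t d) 0 d" for d
    by (simp add: fderivI[OF \<phi>2])
  from add_mono[OF this[of 1] this[of \<i>]]
  have "0 \<le> c * (laplacian ?Q 0)"
    using sub(3)[OF S(2)] by (simp add: distrib_left)
  with c Q_neg show False by (simp add: zero_le_mult_iff)
qed

section \<open>Charts\<close>

text \<open>The consequences of the definition of a chart in terms of open sets of the whole space, instead of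
  subspace topologies.\<close>
lemma chart_facts:
  assumes "is_chart X c"
  shows "fst c \<subseteq> topspace X" "openin X (fst c)" "inj_on (snd c) (fst c)" "open (chart_image c)"
    and "\<And>p. p \<in> fst c \<Longrightarrow> chart_inv c (snd c p) = p"
    and "\<And>W. openin X W \<Longrightarrow> W \<subseteq> fst c \<Longrightarrow> open (snd c ` W)"
    and "\<And>O'. open O' \<Longrightarrow> openin X {p \<in> fst c. snd c p \<in> O'}"
proof -
  show o: "openin X (fst c)" "open (chart_image c)" using assms by (auto simp: is_chart_def)
  show sub: "fst c \<subseteq> topspace X" using o(1) openin_subset by blast
  have hm: "homeomorphic_map (subtopology X (fst c)) (top_of_set (chart_image c)) (snd c)"
    using assms by (simp add: is_chart_def)
  have ts: "topspace (subtopology X (fst c)) = fst c" using sub by (simp add: inf.absorb2)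
  show inj: "inj_on (snd c) (fst c)" using hm ts homeomorphic_imp_injective_map by metis
  show "\<And>p. p \<in> fst c \<Longrightarrow> chart_inv c (snd c p) = p"
    using inj by (simp add: chart_inv_def)
  show "open (snd c ` W)" if "openin X W" "W \<subseteq> fst c" for W
  proof -
    have "openin (subtopology X (fst c)) W" using that o(1) by (simp add: openin_open_subtopology)
    then have "openin (top_of_set (chart_image c)) (snd c ` W)"
      using homeomorphic_imp_open_map[OF hm] by (simp add: open_map_def)
    then show ?thesis using o(2) by (simp add: openin_open_eq)
  qed
  show "openin X {p \<in> fst c. snd c p \<in> O'}" if "open O'" for O'
  proof -
    have "continuous_map (subtopology X (fst c)) (top_of_set (chart_image c)) (snd c)"
      using hm homeomorphic_imp_continuous_map by blast
    then have "openin (subtopology X (fst c)) {p \<in> topspace (subtopology X (fst c)). snd c p \<in> O' \<inter> chart_image c}"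
      using that by (intro openin_continuous_map_preimage) (auto simp: openin_open)
    moreover have "{p \<in> topspace (subtopology X (fst c)). snd c p \<in> O' \<inter> chart_image c} = {p \<in> fst c. snd c p \<in> O'}"
      unfolding ts by (auto simp: chart_image_def)
    ultimately show ?thesis using o(1) by (simp add: openin_open_subtopology)
  qed
qed

lemma map_domainE:
  assumes "is_chart X c" "x \<in> map_domain c d f"
  obtains p where "p \<in> fst c" "f p \<in> fst d" "x = snd c p" "local_rep c d f x = snd d (f p)"
proof -
  obtain p where "p \<in> fst c" "f p \<in> fst d" "x = snd c p" using assms(2) by (auto simp: map_domain_def)
  then show thesis using chart_facts(5)[OF assms(1)] by (intro that[of p]) (auto simp: local_rep_def)
qed

lemma map_domain_iff:
  assumes "is_chart X c" "p \<in> fst c"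
  shows "snd c p \<in> map_domain c d f \<longleftrightarrow> f p \<in> fst d"
  using assms(2) chart_facts(3)[OF assms(1)] by (auto simp: map_domain_def inj_on_def)

lemma local_rep_chart:
  assumes "is_chart X c" "p \<in> fst c"
  shows "local_rep c d f (snd c p) = snd d (f p)"
  using chart_facts(5)[OF assms] by (simp add: local_rep_def)

lemma transition_chart:
  assumes "is_chart X c" "p \<in> fst c"
  shows "transition c d (snd c p) = snd d p"
  using chart_facts(5)[OF assms] by (simp add: transition_def)

lemma openin_chart_preimage:
  assumes "continuous_map X Y f" "is_chart X c" "openin Y W"
  shows "openin X (fst c \<inter> f -` W)"
proof -
  have "openin X (fst c \<inter> {p \<in> topspace X. f p \<in> W})"
    by (intro openin_Int openin_continuous_map_preimage[OF assms(1,3)] chart_facts(2)[OF assms(2)])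
  moreover have "fst c \<inter> {p \<in> topspace X. f p \<in> W} = fst c \<inter> f -` W"
    using chart_facts(1)[OF assms(2)] by auto
  ultimately show ?thesis by simp
qed

lemma open_map_domain:
  assumes "continuous_map X Y f" "is_chart X c" "is_chart Y d"
  shows "open (map_domain c d f)"
  unfolding map_domain_def
  by (rule chart_facts(6)[OF assms(2) openin_chart_preimage[OF assms(1,2) chart_facts(2)[OF assms(3)]] Int_lower1])

section \<open>The maximum of the energy on a compact source\<close>

lemma (in nonpos_connection) continuous_on_G:
  fixes Y :: "'t::topological_space \<Rightarrow> 'v"
  assumes "continuous_on K Y" "Y ` K \<subseteq> U" "continuous_on K A" "continuous_on K B"
  shows "continuous_on K (\<lambda>k. G (Y k) (A k) (B k))"
proof -
  have "continuous_on U (\<lambda>y. G y i j)" for i j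
    by (rule has_derivative_continuous_on[OF has_derivative_at_withinI[OF G_parallel]])
  then have "continuous_on K (\<lambda>k. G (Y k) i j)" for i j
    by (rule continuous_on_compose2[OF _ assms(1,2)])
  then have "continuous_on K (\<lambda>k. \<Sum>i\<in>Basis. \<Sum>j\<in>Basis. ((A k \<bullet> i) * (B k \<bullet> j)) *\<^sub>R G (Y k) i j)"
    using assms(3,4) by (intro continuous_intros)
  moreover have "(\<Sum>i\<in>Basis. \<Sum>j\<in>Basis. ((A k \<bullet> i) * (B k \<bullet> j)) *\<^sub>R G (Y k) i j) = G (Y k) (A k) (B k)" if "k \<in> K" for k
    using that assms(2) by (intro bilinear_expand[symmetric] bilinear_G) auto
  ultimately show ?thesis by (simp cong: continuous_on_cong)
qed

text \<open>The common setting of the Riemannian and the Kaehler case.  The metric and the connection of the target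
  enter through the bilinear forms \<open>G d\<close> and \<open>\<Gamma> d\<close> in each chart \<open>d\<close>, and pluri-harmonicity through
  its consequence that \<open>f\<close> is harmonic along all quadratic discs.\<close>
locale pluriharmonic_map =
  fixes M :: "'a topology" and A :: "('a, complex^'m) chart set"
    and h :: "('a, complex^'m) chart \<Rightarrow> complex^'m \<Rightarrow> complex^'m^'m"
    and N :: "'b topology" and B :: "('b, 'v::euclidean_space) chart set"
    and G :: "('b, 'v) chart \<Rightarrow> 'v \<Rightarrow> 'v \<Rightarrow> 'v \<Rightarrow> real"
    and \<Gamma> :: "('b, 'v) chart \<Rightarrow> 'v \<Rightarrow> 'v \<Rightarrow> 'v \<Rightarrow> 'v"
    and f :: "'a \<Rightarrow> 'b"
  assumes source: "complex_manifold M A" and hermitian: "hermitian_metric A h"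
    and target_chart: "d \<in> B \<Longrightarrow> is_chart N d" and target_cover: "topspace N = (\<Union>d\<in>B. fst d)"
    and transition_differentiable: "d \<in> B \<Longrightarrow> d' \<in> B \<Longrightarrow> y \<in> overlap d d' \<Longrightarrow>
      transition d d' differentiable (at y)"
    and G_tensor: "d \<in> B \<Longrightarrow> d' \<in> B \<Longrightarrow> y \<in> overlap d d' \<Longrightarrow>
      G d y a b = G d' (transition d d' y) (\<D> (transition d d') y a) (\<D> (transition d d') y b)"
    and connection: "d \<in> B \<Longrightarrow> nonpos_connection (chart_image d) (G d) (\<Gamma> d)"
    and smooth_f: "smooth_map M A N B f"
    and harmonic: "c \<in> A \<Longrightarrow> d \<in> B \<Longrightarrow> disc p v w t \<in> map_domain c d f \<Longrightarrow>
      tension (\<Gamma> d) (\<lambda>t. local_rep c d f (disc p v w t)) t = 0"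
begin

abbreviation En where "En c d \<equiv> pointwise_energy (G d) (local_rep c d f)"

abbreviation Hn where "Hn c x v \<equiv> Re (herm_form (h c x) v v)"

lemma source_chart: "c \<in> A \<Longrightarrow> is_chart M c"
  using source by (simp add: complex_manifold_def connected_manifold_def)

lemma continuous_f: "continuous_map M N f"
  using smooth_f by (simp add: smooth_map_def)

lemma local_rep_smooth: "c \<in> A \<Longrightarrow> d \<in> B \<Longrightarrow> smooth_on (map_domain c d f) (local_rep c d f)"
  using smooth_f by (simp add: smooth_map_def)

lemma open_dom: "c \<in> A \<Longrightarrow> d \<in> B \<Longrightarrow> open (map_domain c d f)"
  by (rule open_map_domain[OF continuous_f source_chart target_chart])

lemma local_rep_image:
  assumes "c \<in> A"
  shows "local_rep c d f ` map_domain c d f \<subseteq> chart_image d"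
proof
  fix y assume "y \<in> local_rep c d f ` map_domain c d f"
  then obtain x where x: "x \<in> map_domain c d f" "y = local_rep c d f x" by auto
  from map_domainE[OF source_chart[OF assms] x(1)] obtain p where "f p \<in> fst d" "local_rep c d f x = snd d (f p)"
    by metis
  with x(2) show "y \<in> chart_image d" by (simp add: chart_image_def)
qed

lemma dom_sub: "map_domain c d f \<subseteq> chart_image c"
  by (auto simp: map_domain_def chart_image_def)

lemma Hn_pos: "c \<in> A \<Longrightarrow> x \<in> chart_image c \<Longrightarrow> v \<noteq> 0 \<Longrightarrow> Hn c x v > 0"
  using hermitian by (simp add: hermitian_metric_def)

lemma En_nonneg:
  assumes "c \<in> A" "d \<in> B" "x \<in> map_domain c d f"
  shows "En c d x v \<ge> 0"
  using nonpos_connection.G_nonneg[OF connection[OF assms(2)]] local_rep_image[OF assms(1), of d] assms(3)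
  by (auto simp: pointwise_energy_def intro!: add_nonneg_nonneg)

lemma charts_exist:
  assumes "p \<in> topspace M"
  obtains c d where "c \<in> A" "d \<in> B" "p \<in> fst c" "f p \<in> fst d"
proof -
  obtain c where "c \<in> A" "p \<in> fst c"
    using assms source by (auto simp: complex_manifold_def connected_manifold_def)
  moreover have "f p \<in> topspace N" using continuous_f assms by (auto simp: continuous_map_def)
  then obtain d where "d \<in> B" "f p \<in> fst d" using target_cover by auto
  ultimately show thesis using that by blast
qed

text \<open>The differential \<open>L\<close> of the change of charts in the source commutes with multiplication by \<open>\<i>\<close>; this is
  why the energy, in which \<open>v\<close> and \<open>\<i> v\<close> both occur, is a function of the tangent vector alone.\<close>
lemma change_of_charts:
  assumes c: "c \<in> A" "c' \<in> A" and d: "d \<in> B" "d' \<in> B"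
    and p: "p \<in> fst c" "p \<in> fst c'" "f p \<in> fst d" "f p \<in> fst d'"
  shows "\<exists>L. \<forall>v. En c' d' (snd c' p) (L v) = En c d (snd c p) v \<and> Hn c' (snd c' p) (L v) = Hn c (snd c p) v"
proof -
  note cc = source_chart[OF c(1)] and cc' = source_chart[OF c(2)]
    and dd = target_chart[OF d(1)] and dd' = target_chart[OF d(2)]
  let ?x = "snd c p" and ?x' = "snd c' p"
  let ?T = "transition c c'" and ?S = "transition d d'"
  let ?u = "local_rep c d f" and ?u' = "local_rep c' d' f"
  have ov: "?x \<in> overlap c c'" using p by (auto simp: overlap_def)
  have ux: "?u ?x = snd d (f p)" by (rule local_rep_chart[OF cc p(1)])
  have ov': "?u ?x \<in> overlap d d'" unfolding ux using p by (auto simp: overlap_def)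
  have Tx: "?T ?x = ?x'" by (rule transition_chart[OF cc p(1)])
  have "holo_on (overlap c c') ?T" using source c by (simp add: complex_manifold_def)
  then obtain L where L: "(?T has_derivative L) (at ?x)" "\<And>a v. L (a *s v) = a *s L v"
    using ov unfolding holo_on_def by blast
  have DT: "\<D> ?T ?x = L" by (rule fderivI[OF L(1)])
  have u: "?u differentiable (at ?x)"
    by (rule smooth_onD[OF local_rep_smooth[OF c(1) d(1)]]) (simp add: map_domain_iff[OF cc p(1)] p)
  have u': "?u' differentiable (at ?x')"
    by (rule smooth_onD[OF local_rep_smooth[OF c(2) d(2)]]) (simp add: map_domain_iff[OF cc' p(2)] p)
  have S: "?S differentiable (at (?u ?x))" by (rule transition_differentiable[OF d ov'])
  define W where "W = snd c ` (fst c \<inter> (fst c' \<inter> f -` (fst d \<inter> fst d')))"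
  have "open W"
  proof -
    have "openin M (fst c \<inter> (fst c' \<inter> f -` (fst d \<inter> fst d')))"
      by (intro openin_Int openin_chart_preimage[OF continuous_f cc'] chart_facts(2)[OF cc]
          chart_facts(2)[OF dd] chart_facts(2)[OF dd'])
    then show ?thesis unfolding W_def by (intro chart_facts(6)[OF cc]) auto
  qed
  moreover have "?x \<in> W" using p by (auto simp: W_def)
  moreover have "?u' (?T y) = ?S (?u y)" if y: "y \<in> W" for y
  proof -
    obtain q where q: "q \<in> fst c" "q \<in> fst c'" "f q \<in> fst d" "f q \<in> fst d'" "y = snd c q"
      using y by (auto simp: W_def)
    show ?thesis
      by (simp add: q(5) transition_chart[OF cc q(1)] local_rep_chart[OF cc q(1)]
          local_rep_chart[OF cc' q(2)] transition_chart[OF dd q(3)])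
  qed
  ultimately have "\<D> (\<lambda>y. ?u' (?T y)) ?x = \<D> (\<lambda>y. ?S (?u y)) ?x"
    by (intro fderiv_cong_open)
  then have chain: "\<D> ?u' ?x' (L v) = \<D> ?S (?u ?x) (\<D> ?u ?x v)" for v
    using fderiv_compose_at[of ?T ?x ?u' v] fderiv_compose_at[of ?u ?x ?S v] u S u' differentiableI[OF L(1)]
    by (simp add: Tx DT)
  have eu: "?u' ?x' = ?S (?u ?x)"
    by (simp add: local_rep_chart[OF cc' p(2)] ux transition_chart[OF dd p(3)])
  have "En c' d' ?x' (L v) = En c d ?x v" for v
    by (simp add: pointwise_energy_def L(2)[symmetric] chain eu G_tensor[OF d ov', symmetric])
  moreover have "Hn c' ?x' (L v) = Hn c ?x v" for v
  proof -
    have "herm_form (h c ?x) v v = herm_form (h c' (?T ?x)) (\<D> ?T ?x v) (\<D> ?T ?x v)"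
      using hermitian c ov unfolding hermitian_metric_def by blast
    then show ?thesis by (simp add: DT Tx)
  qed
  ultimately show ?thesis by blast
qed

text \<open>\<open>v\<close> represents a nonzero tangent vector at the point with coordinates \<open>x\<close>, and \<open>f\<close> maps that point into
  the domain of \<open>d\<close>.\<close>
definition tangent where
  "tangent c d x v \<longleftrightarrow> c \<in> A \<and> d \<in> B \<and> x \<in> map_domain c d f \<and> v \<noteq> 0"

definition ratio where
  "ratio c d x v = En c d x v / Hn c x v"

lemma En_scaleR:
  assumes "c \<in> A" "d \<in> B" "x \<in> map_domain c d f"
  shows "En c d x (r *\<^sub>R v) = r\<^sup>2 * En c d x v"
proof -
  have "local_rep c d f differentiable (at x)" by (rule smooth_onD[OF local_rep_smooth[OF assms(1,2)] assms(3)])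
  then have l: "linear (\<D> (local_rep c d f) x)" by (rule linear_frechet_derivative)
  have "\<i> *s (r *\<^sub>R v) = r *\<^sub>R (\<i> *s v)" by (simp add: vec_eq_iff)
  moreover have bl: "bilinear (G d (local_rep c d f x))"
    using nonpos_connection.bilinear_G[OF connection[OF assms(2)]] local_rep_image[OF assms(1), of d] assms(3) by blast
  ultimately show ?thesis
    by (simp add: pointwise_energy_def linear_cmul[OF l] bilinear_lmul[OF bl] bilinear_rmul[OF bl]
        power2_eq_square algebra_simps)
qed

lemma Hn_scaleR: "Hn c x (r *\<^sub>R v) = r\<^sup>2 * Hn c x v"
proof -
  have "(r *\<^sub>R v) $ i = complex_of_real r * v $ i" for i by (simp add: complex_eq_iff)
  then have "herm_form (h c x) (r *\<^sub>R v) (r *\<^sub>R v) = complex_of_real (r\<^sup>2) * herm_form (h c x) v v"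
    by (simp add: herm_form_def power2_eq_square sum_distrib_left mult_ac)
  then show ?thesis by simp
qed

lemma continuous_ratio:
  assumes cd: "c \<in> A" "d \<in> B"
  shows "continuous_on (map_domain c d f \<times> - {0}) (\<lambda>(x, v). ratio c d x v)"
proof -
  let ?W = "map_domain c d f" and ?u = "local_rep c d f"
  let ?K = "?W \<times> - {0::complex^'m}"
  have u: "smooth_on ?W ?u" by (rule local_rep_smooth[OF cd])
  have fst: "continuous_on ?K (\<lambda>k. F (fst k))" if "continuous_on ?W F" for F :: "_ \<Rightarrow> 'z::topological_space"
    by (rule continuous_on_compose2[OF that continuous_on_fst[OF continuous_on_id]]) auto
  have Y: "continuous_on ?K (\<lambda>k. ?u (fst k))" by (rule fst[OF smooth_on_continuous[OF u]])
  have Du: "continuous_on ?K (\<lambda>k. \<D> ?u (fst k) (g (snd k)))" if "continuous_on UNIV g" for g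
  proof -
    have g: "continuous_on ?K (\<lambda>k. g (snd k))"
      by (rule continuous_on_compose2[OF that continuous_on_snd[OF continuous_on_id]]) auto
    have b: "continuous_on ?K (\<lambda>k. \<D> ?u (fst k) b)" for b
      by (rule fst[OF smooth_on_continuous[OF smooth_on_fderiv[OF u]]])
    have "continuous_on ?K (\<lambda>k. \<Sum>b\<in>Basis. (g (snd k) \<bullet> b) *\<^sub>R \<D> ?u (fst k) b)"
      by (intro continuous_intros g b)
    moreover have "\<D> ?u (fst k) (g (snd k)) = (\<Sum>b\<in>Basis. (g (snd k) \<bullet> b) *\<^sub>R \<D> ?u (fst k) b)" if "k \<in> ?K" for k
      using that by (intro fderiv_basis smooth_onD[OF u]) auto
    ultimately show ?thesis by (simp cong: continuous_on_cong)
  qed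
  have im: "(\<lambda>k. ?u (fst k)) ` ?K \<subseteq> chart_image d" using local_rep_image[OF cd(1), of d] by auto
  have "continuous_on UNIV (\<lambda>v::complex^'m. v)" "continuous_on UNIV (\<lambda>v::complex^'m. \<i> *s v)"
    by (simp_all add: linear_continuous_on bounded_bilinear.bounded_linear_right[OF bounded_bilinear_vector_smult])
  note cG = this[THEN Du]
  have En: "continuous_on ?K (\<lambda>k. En c d (fst k) (snd k))"
    unfolding pointwise_energy_def
    by (intro continuous_on_add nonpos_connection.continuous_on_G[OF connection[OF cd(2)] Y im] cG)
  have "smooth_on (chart_image c) (h c)" using hermitian cd by (simp add: hermitian_metric_def)
  then have "continuous_on ?W (h c)" by (rule continuous_on_subset[OF smooth_on_continuous dom_sub])
  then have h: "continuous_on ?K (\<lambda>k. h c (fst k))" by (rule fst)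
  have Hn: "continuous_on ?K (\<lambda>k. Hn c (fst k) (snd k))"
    unfolding herm_form_def by (intro continuous_intros h)
  have "Hn c (fst k) (snd k) \<noteq> 0" if "k \<in> ?K" for k
    using Hn_pos[OF cd(1) subsetD[OF dom_sub], of "fst k" d "snd k"] that by auto
  then have "continuous_on ?K (\<lambda>k. En c d (fst k) (snd k) / Hn c (fst k) (snd k))"
    by (intro continuous_on_divide En Hn) auto
  then show ?thesis by (simp add: ratio_def case_prod_unfold)
qed

text \<open>The ratio attains a maximum over a compact ball times the unit sphere.  Invariance under changes of
  charts and scaling carries the bound over to all charts and all tangent vectors near \<open>p\<close>.\<close>
lemma ratio_bounded_near:
  assumes p: "p \<in> topspace M"
  shows "\<exists>W c0 d0 x0 v0. openin M W \<and> p \<in> W \<and> tangent c0 d0 x0 v0 \<and>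
    (\<forall>q\<in>W. \<forall>c d v. q \<in> fst c \<longrightarrow> tangent c d (snd c q) v \<longrightarrow> ratio c d (snd c q) v \<le> ratio c0 d0 x0 v0)"
proof -
  obtain c0 d0 where cd: "c0 \<in> A" "d0 \<in> B" and pc: "p \<in> fst c0" "f p \<in> fst d0"
    using charts_exist[OF p] .
  note cc = source_chart[OF cd(1)]
  let ?W = "map_domain c0 d0 f"
  have "snd c0 p \<in> ?W" using map_domain_iff[OF cc pc(1)] pc(2) by blast
  then obtain r where r: "r > 0" "cball (snd c0 p) r \<subseteq> ?W"
    using open_dom[OF cd] open_contains_cball by blast
  let ?K = "cball (snd c0 p) r \<times> sphere (0::complex^'m) 1"
  obtain e :: "complex^'m" where "norm e = 1" using vector_choose_size[of 1] by auto
  then have "e \<in> sphere 0 1" by simp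
  then have ne: "?K \<noteq> {}" using r by auto
  have "continuous_on ?K (\<lambda>(x, v). ratio c0 d0 x v)"
    by (rule continuous_on_subset[OF continuous_ratio[OF cd]]) (use r in auto)
  moreover have "compact ?K" by (intro compact_Times compact_cball compact_sphere)
  ultimately obtain k where k: "k \<in> ?K"
    and k_max: "\<And>k'. k' \<in> ?K \<Longrightarrow> (case k' of (x, v) \<Rightarrow> ratio c0 d0 x v) \<le> (case k of (x, v) \<Rightarrow> ratio c0 d0 x v)"
    using continuous_attains_sup[OF _ ne] by metis
  obtain x0 v0 where k_eq: "k = (x0, v0)" by fastforce
  have valid: "tangent c0 d0 x0 v0" using k k_eq r cd by (auto simp: tangent_def)
  have max: "ratio c0 d0 x v \<le> ratio c0 d0 x0 v0" if "x \<in> cball (snd c0 p) r" "norm v = 1" for x v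
    using k_max[of "(x, v)"] that k_eq by simp
  define W where "W = {q \<in> fst c0. snd c0 q \<in> ball (snd c0 p) r}"
  have "ratio c d (snd c q) v \<le> ratio c0 d0 x0 v0"
    if q: "q \<in> W" "q \<in> fst c" and v: "tangent c d (snd c q) v" for q c d v
  proof -
    have cd': "c \<in> A" "d \<in> B" "v \<noteq> 0" "snd c q \<in> map_domain c d f" using v by (auto simp: tangent_def)
    have q0: "q \<in> fst c0" "snd c0 q \<in> ball (snd c0 p) r" using q by (auto simp: W_def)
    have fq: "f q \<in> fst d" using map_domain_iff[OF source_chart[OF cd'(1)] q(2)] cd' by blast
    have y: "snd c0 q \<in> cball (snd c0 p) r" using q0(2) by auto
    then have dom: "snd c0 q \<in> ?W" using r by blast
    then have fq0: "f q \<in> fst d0" using map_domain_iff[OF cc q0(1)] by blast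
    obtain L where L: "\<And>v. En c0 d0 (snd c0 q) (L v) = En c d (snd c q) v"
      "\<And>v. Hn c0 (snd c0 q) (L v) = Hn c (snd c q) v"
      using change_of_charts[OF cd'(1) cd(1) cd'(2) cd(2) q(2) q0(1) fq fq0] by auto
    have "Hn c (snd c q) v > 0" by (rule Hn_pos[OF cd'(1) subsetD[OF dom_sub cd'(4)] cd'(3)])
    then have "L v \<noteq> 0" using L(2)[of v] by (auto simp: herm_form_def)
    define w where "w = inverse (norm (L v)) *\<^sub>R L v"
    have "ratio c d (snd c q) v = ratio c0 d0 (snd c0 q) (L v)" by (simp add: ratio_def L)
    also have "\<dots> = ratio c0 d0 (snd c0 q) w"
      using \<open>L v \<noteq> 0\<close> unfolding ratio_def w_def En_scaleR[OF cd dom] Hn_scaleR by simp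
    also have "\<dots> \<le> ratio c0 d0 x0 v0" by (rule max[OF y]) (use \<open>L v \<noteq> 0\<close> in \<open>simp add: w_def\<close>)
    finally show ?thesis .
  qed
  moreover have "openin M W" unfolding W_def by (rule chart_facts(7)[OF cc open_ball])
  moreover have "p \<in> W" using pc r by (simp add: W_def)
  ultimately show ?thesis using valid by blast
qed

lemma ratio_attains_max:
  assumes compact: "compact_space M" and ne: "topspace M \<noteq> {}"
  shows "\<exists>c0 d0 x0 v0. tangent c0 d0 x0 v0 \<and>
    (\<forall>c d x v. tangent c d x v \<longrightarrow> ratio c d x v \<le> ratio c0 d0 x0 v0)"
proof -
  define good where "good p k \<longleftrightarrow> (case k of (W, c0, d0, x0, v0) \<Rightarrow> openin M W \<and> p \<in> W \<and> tangent c0 d0 x0 v0 \<and>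
    (\<forall>q\<in>W. \<forall>c d v. q \<in> fst c \<longrightarrow> tangent c d (snd c q) v \<longrightarrow> ratio c d (snd c q) v \<le> ratio c0 d0 x0 v0))" for p k
  have "\<forall>p\<in>topspace M. \<exists>k. good p k"
    using ratio_bounded_near by (simp add: split_paired_Ex good_def)
  from bchoice[OF this] obtain k where k: "\<And>p. p \<in> topspace M \<Longrightarrow> good p (k p)" by blast
  define W where "W p = fst (k p)" for p
  define \<tau> where "\<tau> p = snd (k p)" for p
  have W: "openin M (W p)" "p \<in> W p" and \<tau>: "case \<tau> p of (c0, d0, x0, v0) \<Rightarrow> tangent c0 d0 x0 v0 \<and>
      (\<forall>q\<in>W p. \<forall>c d v. q \<in> fst c \<longrightarrow> tangent c d (snd c q) v \<longrightarrow> ratio c d (snd c q) v \<le> ratio c0 d0 x0 v0)"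
    if "p \<in> topspace M" for p
    using k[OF that] by (auto simp: good_def W_def \<tau>_def split: prod.splits)
  have "\<forall>V\<in>W ` topspace M. openin M V" "topspace M \<subseteq> \<Union>(W ` topspace M)" using W by auto
  then obtain F where F: "finite F" "F \<subseteq> W ` topspace M" "topspace M \<subseteq> \<Union>F"
    using compact unfolding compact_space_alt by meson
  obtain P where P: "P \<subseteq> topspace M" "finite P" "F = W ` P" using finite_subset_image[OF F(1,2)] by blast
  have cover: "topspace M \<subseteq> (\<Union>p\<in>P. W p)" using F(3) P(3) by simp
  have Pne: "P \<noteq> {}" using cover ne by auto
  let ?\<rho> = "\<lambda>p. case \<tau> p of (c, d, x, v) \<Rightarrow> ratio c d x v"
  have "Max (?\<rho> ` P) \<in> ?\<rho> ` P" using P(2) Pne by (intro Max_in) auto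
  then obtain p0 where p0: "p0 \<in> P" "?\<rho> p0 = Max (?\<rho> ` P)" by force
  have p0_max: "?\<rho> p \<le> ?\<rho> p0" if "p \<in> P" for p unfolding p0(2) using P(2) that by auto
  obtain c0 d0 x0 v0 where t0: "\<tau> p0 = (c0, d0, x0, v0)" by (metis surj_pair)
  show ?thesis
  proof (intro exI conjI allI impI)
    show "tangent c0 d0 x0 v0" using \<tau>[of p0] t0 p0 P by auto
    show "ratio c d x v \<le> ratio c0 d0 x0 v0" if v: "tangent c d x v" for c d x v
    proof -
      have c: "c \<in> A" "x \<in> map_domain c d f" using v by (auto simp: tangent_def)
      obtain q where q: "q \<in> fst c" "x = snd c q"
        by (rule map_domainE[OF source_chart[OF c(1)] c(2)])
      have "q \<in> topspace M" using chart_facts(1)[OF source_chart[OF c(1)]] q by blast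
      then obtain p where p: "p \<in> P" "q \<in> W p" using cover by blast
      obtain c1 d1 x1 v1 where t1: "\<tau> p = (c1, d1, x1, v1)" by (metis surj_pair)
      have "\<forall>q\<in>W p. \<forall>c d v. q \<in> fst c \<longrightarrow> tangent c d (snd c q) v \<longrightarrow> ratio c d (snd c q) v \<le> ratio c1 d1 x1 v1"
        using \<tau>[of p] p P unfolding t1 prod.case by blast
      then have "ratio c d x v \<le> ratio c1 d1 x1 v1" using p q v by blast
      also have "\<dots> \<le> ratio c0 d0 x0 v0" using p0_max[OF p(1)] t0 t1 by simp
      finally show ?thesis .
    qed
  qed
qed

text \<open>In charts the differential of \<open>f\<close> vanishes, so \<open>f\<close> is locally constant.\<close>
lemma constant_if_energy_zero:
  assumes zero: "\<And>c d x v. c \<in> A \<Longrightarrow> d \<in> B \<Longrightarrow> x \<in> map_domain c d f \<Longrightarrow> En c d x v = 0"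
  shows "f constant_on topspace M"
proof -
  have loc: "\<exists>W. openin M W \<and> p \<in> W \<and> (\<forall>q\<in>W. f q = f p)" if p: "p \<in> topspace M" for p
  proof -
    obtain c d where cd: "c \<in> A" "d \<in> B" and pc: "p \<in> fst c" "f p \<in> fst d"
      using charts_exist[OF p] .
    note cc = source_chart[OF cd(1)] and conn = connection[OF cd(2)]
    let ?u = "local_rep c d f"
    have dom: "snd c p \<in> map_domain c d f" using map_domain_iff[OF cc pc(1)] pc(2) by blast
    then obtain r where r: "r > 0" "ball (snd c p) r \<subseteq> map_domain c d f"
      using open_dom[OF cd] open_contains_ball by blast
    have z: "(?u has_derivative (\<lambda>v. 0)) (at x within ball (snd c p) r)" if "x \<in> ball (snd c p) r" for x
    proof -
      have x: "x \<in> map_domain c d f" using that r by blast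
      have ux: "?u x \<in> chart_image d" by (rule subsetD[OF local_rep_image[OF cd(1)] imageI[OF x]])
      have "\<D> ?u x v = 0" for v
      proof (rule ccontr)
        assume "\<D> ?u x v \<noteq> 0"
        then have "G d (?u x) (\<D> ?u x v) (\<D> ?u x v) > 0"
          by (rule nonpos_connection.G_pos[OF conn ux])
        moreover have "G d (?u x) (\<D> ?u x (\<i> *s v)) (\<D> ?u x (\<i> *s v)) \<ge> 0"
          by (rule nonpos_connection.G_nonneg[OF conn ux])
        ultimately show False using zero[OF cd x, of v] by (simp add: pointwise_energy_def)
      qed
      then have "\<D> ?u x = (\<lambda>v. 0)" by auto
      then show ?thesis
        using has_derivative_at_withinI[OF has_derivative_fderiv[OF smooth_onD[OF local_rep_smooth[OF cd] x]]] by simp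
    qed
    from has_derivative_zero_constant[OF convex_ball z]
    obtain k where k: "\<And>x. x \<in> ball (snd c p) r \<Longrightarrow> ?u x = k" by auto
    let ?W = "{q \<in> fst c. snd c q \<in> ball (snd c p) r}"
    have "f q = f p" if q: "q \<in> ?W" for q
    proof -
      have "snd c q \<in> map_domain c d f" using q r by auto
      then have "f q \<in> fst d" using map_domain_iff[OF cc, of q d f] q by blast
      moreover have "snd d (f q) = snd d (f p)"
        using k[of "snd c q"] k[of "snd c p"] q r(1) local_rep_chart[OF cc, of q d f] local_rep_chart[OF cc pc(1), of d f]
        by auto
      ultimately show ?thesis using chart_facts(3)[OF target_chart[OF cd(2)]] pc(2) by (auto dest: inj_onD)
    qed
    moreover have "openin M ?W" by (rule chart_facts(7)[OF cc open_ball])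
    moreover have "p \<in> ?W" using pc r by simp
    ultimately show ?thesis by blast
  qed
  show ?thesis
  proof (cases "topspace M = {}")
    case True
    then show ?thesis by (simp add: constant_on_def)
  next
    case False
    then obtain p0 where p0: "p0 \<in> topspace M" by blast
    let ?E = "{q \<in> topspace M. f q = f p0}"
    have "openin M ?E"
    proof (rule openin_subopen[THEN iffD2], intro ballI)
      fix p assume p: "p \<in> ?E"
      then obtain W where W: "openin M W" "p \<in> W" "\<forall>q\<in>W. f q = f p" using loc[of p] by auto
      have "q \<in> ?E" if q: "q \<in> W" for q
      proof -
        have "f q = f p" using W(3) q by blast
        moreover have "f p = f p0" using p by blast
        moreover have "q \<in> topspace M" using openin_subset[OF W(1)] q by blast
        ultimately show ?thesis by simp
      qed
      with W(1,2) show "\<exists>T. openin M T \<and> p \<in> T \<and> T \<subseteq> ?E" by blast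
    qed
    moreover have "openin M (topspace M - ?E)"
    proof (rule openin_subopen[THEN iffD2], intro ballI)
      fix p assume p: "p \<in> topspace M - ?E"
      then obtain W where W: "openin M W" "p \<in> W" "\<forall>q\<in>W. f q = f p" using loc[of p] by auto
      have "q \<in> topspace M - ?E" if q: "q \<in> W" for q
      proof -
        have "f q = f p" using W(3) q by blast
        moreover have "f p \<noteq> f p0" using p by blast
        moreover have "q \<in> topspace M" using openin_subset[OF W(1)] q by blast
        ultimately show ?thesis by simp
      qed
      with W(1,2) show "\<exists>T. openin M T \<and> p \<in> T \<and> T \<subseteq> topspace M - ?E" by blast
    qed
    then have "closedin M ?E" by (auto simp: closedin_def)
    moreover have "connected_space M" using source by (simp add: complex_manifold_def connected_manifold_def)
    ultimately have "?E = {} \<or> ?E = topspace M" unfolding connected_space_clopen_in by blast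
    then have "?E = topspace M" using p0 by blast
    then show ?thesis unfolding constant_on_def by blast
  qed
qed

theorem constant_if_positive_HSC:
  assumes compact: "compact_space M" and pos: "positive_HSC A h"
  shows "f constant_on topspace M"
proof (cases "topspace M = {}")
  case True
  then show ?thesis by (simp add: constant_on_def)
next
  case False
  then obtain c0 d0 x0 v0 where valid: "tangent c0 d0 x0 v0"
    and max: "\<And>c d x v. tangent c d x v \<Longrightarrow> ratio c d x v \<le> ratio c0 d0 x0 v0"
    using ratio_attains_max[OF compact] by blast
  define l where "l = ratio c0 d0 x0 v0"
  have le: "En c d x v \<le> l * Hn c x v" if "c \<in> A" "d \<in> B" "x \<in> map_domain c d f" for c d x v
  proof (cases "v = 0")
    case True
    then show ?thesis using En_scaleR[OF that, of 0 0] Hn_scaleR[of c x 0 0] by simp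
  next
    case False
    then have "Hn c x v > 0" by (rule Hn_pos[OF that(1) subsetD[OF dom_sub that(3)]])
    moreover have "ratio c d x v \<le> l" unfolding l_def using max that False by (simp add: tangent_def)
    ultimately show ?thesis by (simp add: ratio_def pos_divide_le_eq)
  qed
  have cd: "c0 \<in> A" "d0 \<in> B" "x0 \<in> map_domain c0 d0 f" "v0 \<noteq> 0" using valid by (auto simp: tangent_def)
  have x0: "x0 \<in> chart_image c0" by (rule subsetD[OF dom_sub cd(3)])
  have H0: "Hn c0 x0 v0 > 0" by (rule Hn_pos[OF cd(1) x0 cd(4)])
  have "\<not> l > 0"
  proof
    assume l: "l > 0"
    have "smooth_on (chart_image c0) (h c0)" using hermitian cd by (simp add: hermitian_metric_def)
    then have H: "smooth_on (map_domain c0 d0 f) (h c0)" using dom_sub by (rule smooth_on_subset)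
    have curv: "Re (chern_quartic (h c0) x0 v0) > 0"
      using pos cd(1) x0 cd(4) unfolding positive_HSC_def by blast
    have inv: "invertible (h c0 x0)" by (rule invertible_posdef_hermitian[OF Hn_pos[OF cd(1) x0]])
    show False
    proof (rule nonpos_connection.no_positive_energy_maximum[OF connection[OF cd(2)] open_dom[OF cd(1,2)] cd(3)
          local_rep_smooth[OF cd(1,2)] local_rep_image[OF cd(1)] H inv curv _ _ _ l])
      show "tension (\<Gamma> d0) (\<lambda>t. local_rep c0 d0 f (disc x0 v0 w t)) t = 0"
        if "disc x0 v0 w t \<in> map_domain c0 d0 f" for w t
        by (rule harmonic[OF cd(1,2) that])
      show "En c0 d0 x y \<le> l * Hn c0 x y" if "x \<in> map_domain c0 d0 f" for x y
        by (rule le[OF cd(1,2) that])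
      show "En c0 d0 x0 v0 = l * Hn c0 x0 v0" using H0 by (simp add: l_def ratio_def)
    qed
  qed
  show ?thesis
  proof (rule constant_if_energy_zero)
    fix c d x v assume *: "c \<in> A" "d \<in> B" "x \<in> map_domain c d f"
    have "Hn c x v \<ge> 0"
      using Hn_pos[OF *(1) subsetD[OF dom_sub *(3)], of v] Hn_scaleR[of c x 0 0] by (cases "v = 0") auto
    then have "l * Hn c x v \<le> 0" using \<open>\<not> l > 0\<close> by (simp add: mult_nonpos_nonneg)
    then show "En c d x v = 0" using le[OF *, of v] En_nonneg[OF *, of v] by simp
  qed
qed

end

section \<open>The Levi-Civita connection in coordinates\<close>

lemma differentiable_prod:
  fixes f :: "'i \<Rightarrow> 'a::real_normed_vector \<Rightarrow> 'b::real_normed_field"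
  assumes "\<And>i. i \<in> I \<Longrightarrow> f i differentiable (at x)"
  shows "(\<lambda>y. \<Prod>i\<in>I. f i y) differentiable (at x)"
  by (rule differentiableI[OF has_derivative_prod[OF has_derivative_fderiv[OF assms]]])

lemma differentiable_det:
  fixes Q :: "'v::real_normed_vector \<Rightarrow> 'a::real_normed_field^'n^'n"
  assumes "\<And>i j. (\<lambda>y. Q y $ i $ j) differentiable (at x)"
  shows "(\<lambda>y. det (Q y)) differentiable (at x)"
  unfolding det_def
  by (intro differentiable_sum ballI differentiable_mult differentiable_const differentiable_prod assms
      finite_permutations finite)

text \<open>Cramer's rule shows that the inverse matrix depends differentiably on the matrix, hence that Christoffel
  symbols are differentiable.\<close>
lemma matrix_inv_cramer:
  fixes Q :: "'a::field^'n^'n"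
  assumes "invertible Q"
  shows "matrix_inv Q $ i $ j = det (\<chi> r s. if s = i then axis j 1 $ r else Q $ r $ s) / det Q"
proof -
  have d: "det Q \<noteq> 0" using assms invertible_det_nz by blast
  have "Q *v (matrix_inv Q *v axis j 1) = axis j 1"
    by (simp add: matrix_vector_mul_assoc matrix_inv_works[OF assms])
  then have "matrix_inv Q *v axis j 1 = (\<chi> k. det (\<chi> r s. if s = k then axis j 1 $ r else Q $ r $ s) / det Q)"
    using cramer[OF d] by blast
  moreover have "(matrix_inv Q *v axis j 1) $ i = matrix_inv Q $ i $ j"
    by (simp add: matrix_vector_mult_def axis_def if_distrib[of "\<lambda>x. _ * x"] cong: if_cong)
  ultimately show ?thesis by simp
qed

lemma differentiable_matrix_inv:
  fixes Q :: "'v::real_normed_vector \<Rightarrow> 'a::real_normed_field^'n^'n"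
  assumes U: "open U" "x \<in> U" and inv: "\<And>y. y \<in> U \<Longrightarrow> invertible (Q y)"
    and Q: "\<And>i j. (\<lambda>y. Q y $ i $ j) differentiable (at x)"
  shows "(\<lambda>y. matrix_inv (Q y) $ i $ j) differentiable (at x)"
proof -
  let ?q = "\<lambda>y. det (\<chi> r s. if s = i then axis j 1 $ r else Q y $ r $ s) / det (Q y)"
  have e: "(\<lambda>y. (\<chi> r s. if s = i then axis j 1 $ r else Q y $ r $ s) $ r $ s) differentiable (at x)" for r s
    by (cases "s = i") (simp_all add: Q)
  have "det (Q x) \<noteq> 0" using inv[OF U(2)] invertible_det_nz by blast
  then have "?q differentiable (at x)"
    by (intro differentiable_divide differentiable_det e Q)
  then show ?thesis
    using differentiable_cong_open[OF U, of "\<lambda>y. matrix_inv (Q y) $ i $ j" ?q] matrix_inv_cramer[OF inv] by blast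
qed

lemma invertible_posdef:
  fixes Q :: "real^'n^'n"
  assumes "\<And>v. v \<noteq> 0 \<Longrightarrow> v \<bullet> (Q *v v) > 0"
  shows "invertible Q"
proof -
  have "v = 0" if "Q *v v = 0" for v using assms[of v] that by (cases "v = 0") auto
  then show ?thesis by (simp add: invertible_left_inverse matrix_left_invertible_ker)
qed

definition metric_form :: "(real^'n \<Rightarrow> real^'n^'n) \<Rightarrow> real^'n \<Rightarrow> real^'n \<Rightarrow> real^'n \<Rightarrow> real" where
  "metric_form g x a b = a \<bullet> (g x *v b)"

definition levi_civita :: "(real^'n \<Rightarrow> real^'n^'n) \<Rightarrow> real^'n \<Rightarrow> real^'n \<Rightarrow> real^'n \<Rightarrow> real^'n" where
  "levi_civita g x a b = (\<chi> i. \<Sum>j\<in>UNIV. \<Sum>k\<in>UNIV. christoffel g i j k x * a $ j * b $ k)"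

lemma metric_form_sum: "metric_form g x a b = (\<Sum>i\<in>UNIV. \<Sum>j\<in>UNIV. g x $ i $ j * a $ i * b $ j)"
  by (simp add: metric_form_def inner_vec_def matrix_vector_mult_def sum_distrib_left mult_ac)

lemma bilinear_metric_form: "bilinear (metric_form g x)"
  by (simp add: bilinear_def metric_form_def linear_iff inner_add_left inner_add_right
      matrix_vector_right_distrib matrix_vector_mult_scaleR)

lemma bilinear_levi_civita: "bilinear (levi_civita g x)"
  by (auto simp: bilinear_def levi_civita_def linear_iff vec_eq_iff algebra_simps sum.distrib sum_distrib_left)

lemma fderiv_pd:
  fixes \<phi> :: "real^'n \<Rightarrow> real"
  assumes "\<phi> differentiable (at x)"
  shows "\<D> \<phi> x a = (\<Sum>j\<in>UNIV. pd j \<phi> x * a $ j)"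
proof -
  have l: "linear (\<D> \<phi> x)" by (rule linear_frechet_derivative[OF assms])
  have "a = (\<Sum>j\<in>UNIV. a $ j *\<^sub>R axis j 1)"
    by (simp add: vec_eq_iff axis_def if_distrib[of "\<lambda>x. _ * x"] cong: if_cong)
  then have "\<D> \<phi> x a = \<D> \<phi> x (\<Sum>j\<in>UNIV. a $ j *\<^sub>R axis j 1)" by simp
  then show ?thesis by (simp add: linear_sum[OF l] linear_cmul[OF l] pd_def mult.commute)
qed

lemma sum_delta_mult:
  fixes F :: "'i::finite \<Rightarrow> 'b::semiring_1"
  shows "(\<Sum>l\<in>UNIV. (if m = l then 1 else 0) * F l) = F m"
    "(\<Sum>l\<in>UNIV. (if l = m then 1 else 0) * F l) = F m"
  by (simp_all add: if_distrib[of "\<lambda>x. x * _"] cong: if_cong)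

lemma sum3_rotate:
  "(\<Sum>i\<in>A. \<Sum>j\<in>B. \<Sum>k\<in>C. f i j k) = (\<Sum>k\<in>C. \<Sum>i\<in>A. \<Sum>j\<in>B. f i j k)"
proof -
  have "(\<Sum>i\<in>A. \<Sum>j\<in>B. \<Sum>k\<in>C. f i j k) = (\<Sum>i\<in>A. \<Sum>k\<in>C. \<Sum>j\<in>B. f i j k)"
    by (intro sum.cong refl sum.swap)
  then show ?thesis using sum.swap by fastforce
qed

locale riemannian_patch =
  fixes U :: "(real^'n) set" and g :: "real^'n \<Rightarrow> real^'n^'n"
  assumes open_U: "open U" and smooth_g: "smooth_on U g"
    and g_sym: "x \<in> U \<Longrightarrow> transpose (g x) = g x"
    and g_pos: "x \<in> U \<Longrightarrow> v \<noteq> 0 \<Longrightarrow> v \<bullet> (g x *v v) > 0"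
begin

lemma g_entry_smooth: "smooth_on U (\<lambda>y. g y $ i $ j)"
  by (intro smooth_on_bounded_linear[OF open_U bounded_linear_vec_nth] smooth_g)

lemma g_entry_sym: "x \<in> U \<Longrightarrow> g x $ i $ j = g x $ j $ i"
  using g_sym[of x] by (auto simp: transpose_def vec_eq_iff)

lemma invertible_g: "x \<in> U \<Longrightarrow> invertible (g x)"
  using invertible_posdef g_pos by blast

lemma metric_form_commute: "x \<in> U \<Longrightarrow> metric_form g x a b = metric_form g x b a"
  unfolding metric_form_sum by (subst sum.swap) (simp add: g_entry_sym mult_ac)

lemma christoffel_differentiable:
  assumes x: "x \<in> U"
  shows "christoffel g i j k differentiable (at x)"
proof -
  have "(\<lambda>y. matrix_inv (g y) $ i $ l) differentiable (at x)" for l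
    by (rule differentiable_matrix_inv[OF open_U x invertible_g smooth_onD[OF g_entry_smooth x]])
  moreover have "(\<lambda>y. pd j (\<lambda>y. g y $ k $ l) y) differentiable (at x)" for j k l
    unfolding pd_def by (rule smooth_onD[OF smooth_on_fderiv[OF g_entry_smooth] x])
  ultimately show ?thesis
    unfolding christoffel_def[abs_def]
    by (intro differentiable_divide differentiable_sum differentiable_mult differentiable_add
        differentiable_diff differentiable_const) simp_all
qed

lemma has_derivative_metric_form:
  assumes x: "x \<in> U"
  shows "((\<lambda>y. metric_form g y b c) has_derivative
    (\<lambda>a. \<Sum>j\<in>UNIV. \<Sum>k\<in>UNIV. \<Sum>m\<in>UNIV. pd j (\<lambda>y. g y $ k $ m) x * a $ j * b $ k * c $ m)) (at x)"
proof -
  have d: "(\<lambda>y. g y $ k $ m) differentiable (at x)" for k m by (rule smooth_onD[OF g_entry_smooth x])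
  have "((\<lambda>y. \<Sum>k\<in>UNIV. \<Sum>m\<in>UNIV. g y $ k $ m * b $ k * c $ m) has_derivative
    (\<lambda>a. \<Sum>k\<in>UNIV. \<Sum>m\<in>UNIV. \<D> (\<lambda>y. g y $ k $ m) x a * b $ k * c $ m)) (at x)"
    by (intro has_derivative_sum has_derivative_mult_left has_derivative_fderiv d)
  moreover have "(\<Sum>k\<in>UNIV. \<Sum>m\<in>UNIV. \<D> (\<lambda>y. g y $ k $ m) x a * b $ k * c $ m)
      = (\<Sum>j\<in>UNIV. \<Sum>k\<in>UNIV. \<Sum>m\<in>UNIV. pd j (\<lambda>y. g y $ k $ m) x * a $ j * b $ k * c $ m)" for a
    by (simp only: fderiv_pd[OF d] sum_distrib_right) (rule sum3_rotate)
  ultimately show ?thesis by (simp add: metric_form_sum[abs_def])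
qed

text \<open>The Koszul formula for constant vector fields.\<close>
lemma metric_form_levi_civita:
  assumes x: "x \<in> U"
  shows "2 * metric_form g x (levi_civita g x a b) c
    = \<D> (\<lambda>y. metric_form g y b c) x a + \<D> (\<lambda>y. metric_form g y a c) x b - \<D> (\<lambda>y. metric_form g y a b) x c"
proof -
  let ?d = "\<lambda>j k m. pd j (\<lambda>y. g y $ k $ m) x"
  let ?E = "\<lambda>j k m. ?d j k m + ?d k j m - ?d m j k"
  have low: "(\<Sum>i\<in>UNIV. g x $ i $ m * christoffel g i j k x) = ?E j k m / 2" for j k m
  proof -
    have "(\<Sum>i\<in>UNIV. g x $ i $ m * christoffel g i j k x)
      = (\<Sum>i\<in>UNIV. \<Sum>l\<in>UNIV. (g x $ m $ i * matrix_inv (g x) $ i $ l) * (?E j k l / 2))"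
      by (simp add: christoffel_def sum_distrib_left sum_divide_distrib g_entry_sym[OF x, of _ m] mult_ac)
    also have "\<dots> = (\<Sum>l\<in>UNIV. (\<Sum>i\<in>UNIV. g x $ m $ i * matrix_inv (g x) $ i $ l) * (?E j k l / 2))"
      by (subst sum.swap) (simp only: sum_distrib_right)
    also have "\<dots> = ?E j k m / 2"
      by (simp only: matrix_inv_sum[OF invertible_g[OF x]] sum_delta_mult)
    finally show ?thesis .
  qed
  have "metric_form g x (levi_civita g x a b) c
    = (\<Sum>i\<in>UNIV. \<Sum>m\<in>UNIV. \<Sum>j\<in>UNIV. \<Sum>k\<in>UNIV. (g x $ i $ m * christoffel g i j k x) * (a $ j * b $ k * c $ m))"
    by (simp add: metric_form_sum levi_civita_def sum_distrib_left sum_distrib_right mult_ac)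
  also have "\<dots> = (\<Sum>j\<in>UNIV. \<Sum>k\<in>UNIV. \<Sum>i\<in>UNIV. \<Sum>m\<in>UNIV. (g x $ i $ m * christoffel g i j k x) * (a $ j * b $ k * c $ m))"
    by (rule sum4_swap)
  also have "\<dots> = (\<Sum>j\<in>UNIV. \<Sum>k\<in>UNIV. \<Sum>m\<in>UNIV. (\<Sum>i\<in>UNIV. g x $ i $ m * christoffel g i j k x) * (a $ j * b $ k * c $ m))"
    unfolding sum_distrib_right by (intro sum.cong refl sum.swap)
  also have "\<dots> = (\<Sum>j\<in>UNIV. \<Sum>k\<in>UNIV. \<Sum>m\<in>UNIV. ?E j k m / 2 * (a $ j * b $ k * c $ m))"
    by (simp only: low)
  finally have "2 * metric_form g x (levi_civita g x a b) c
    = (\<Sum>j\<in>UNIV. \<Sum>k\<in>UNIV. \<Sum>m\<in>UNIV. ?E j k m * (a $ j * b $ k * c $ m))"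
    by (simp add: sum_distrib_left)
  also have "\<dots> = (\<Sum>j\<in>UNIV. \<Sum>k\<in>UNIV. \<Sum>m\<in>UNIV. ?d j k m * a $ j * b $ k * c $ m)
      + (\<Sum>j\<in>UNIV. \<Sum>k\<in>UNIV. \<Sum>m\<in>UNIV. ?d k j m * b $ k * a $ j * c $ m)
      - (\<Sum>j\<in>UNIV. \<Sum>k\<in>UNIV. \<Sum>m\<in>UNIV. ?d m j k * c $ m * a $ j * b $ k)"
    by (simp add: algebra_simps sum.distrib sum_subtractf)
  also have "(\<Sum>j\<in>UNIV. \<Sum>k\<in>UNIV. \<Sum>m\<in>UNIV. ?d k j m * b $ k * a $ j * c $ m)
      = (\<Sum>k\<in>UNIV. \<Sum>j\<in>UNIV. \<Sum>m\<in>UNIV. ?d k j m * b $ k * a $ j * c $ m)" by (rule sum.swap)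
  also have "(\<Sum>j\<in>UNIV. \<Sum>k\<in>UNIV. \<Sum>m\<in>UNIV. ?d m j k * c $ m * a $ j * b $ k)
      = (\<Sum>m\<in>UNIV. \<Sum>j\<in>UNIV. \<Sum>k\<in>UNIV. ?d m j k * c $ m * a $ j * b $ k)" by (rule sum3_rotate)
  finally show ?thesis by (simp only: fderivI[OF has_derivative_metric_form[OF x]])
qed

lemma metric_form_nondegenerate:
  assumes "x \<in> U" "\<And>c. metric_form g x a c = 0"
  shows "a = 0"
  using assms(2)[of a] g_pos[OF assms(1), of a] by (auto simp: metric_form_def)

lemma levi_civita_sym:
  assumes x: "x \<in> U"
  shows "levi_civita g x a b = levi_civita g x b a"
proof -
  have "\<D> (\<lambda>y. metric_form g y a b) x = \<D> (\<lambda>y. metric_form g y b a) x"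
    by (rule fderiv_cong_open[OF open_U x metric_form_commute])
  then have "metric_form g x (levi_civita g x a b) c = metric_form g x (levi_civita g x b a) c" for c
    using metric_form_levi_civita[OF x, of a b c] metric_form_levi_civita[OF x, of b a c] by simp
  then have "metric_form g x (levi_civita g x a b - levi_civita g x b a) c = 0" for c
    by (simp add: bilinear_lsub[OF bilinear_metric_form])
  from metric_form_nondegenerate[OF x this] show ?thesis by simp
qed

lemma levi_civita_parallel:
  assumes x: "x \<in> U"
  shows "((\<lambda>y. metric_form g y a b) has_derivative
    (\<lambda>c. metric_form g x (levi_civita g x c a) b + metric_form g x a (levi_civita g x c b))) (at x)"
proof -
  have s: "\<D> (\<lambda>y. metric_form g y a b) x = \<D> (\<lambda>y. metric_form g y b a) x" for a b
    by (rule fderiv_cong_open[OF open_U x metric_form_commute])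
  have "metric_form g x (levi_civita g x c a) b + metric_form g x a (levi_civita g x c b)
      = \<D> (\<lambda>y. metric_form g y a b) x c" for c
    using metric_form_levi_civita[OF x, of c a b] metric_form_levi_civita[OF x, of c b a] s[of b a] s[of c a] s[of c b]
    by (simp add: metric_form_commute[OF x, of a])
  then show ?thesis
    using has_derivative_fderiv[OF differentiableI[OF has_derivative_metric_form[OF x]]] by simp
qed

lemma has_derivative_levi_civita:
  assumes x: "x \<in> U"
  shows "((\<lambda>y. levi_civita g y b c) has_derivative
    (\<lambda>a. \<chi> l. \<Sum>j\<in>UNIV. \<Sum>k\<in>UNIV. \<D> (christoffel g l j k) x a * b $ j * c $ k)) (at x)"
proof -
  have "((\<lambda>y. levi_civita g y b c $ l) has_derivative
    (\<lambda>a. \<Sum>j\<in>UNIV. \<Sum>k\<in>UNIV. \<D> (christoffel g l j k) x a * b $ j * c $ k)) (at x)" for l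
    unfolding levi_civita_def vec_lambda_beta
    by (intro has_derivative_sum has_derivative_mult_left has_derivative_fderiv christoffel_differentiable x)
  then show ?thesis
    by (subst has_derivative_componentwise_within) (auto simp: Basis_vec_def inner_axis)
qed

lemma curvature_levi_civita:
  assumes x: "x \<in> U"
  shows "curvature (levi_civita g) x a b c $ l
    = (\<Sum>i\<in>UNIV. \<Sum>j\<in>UNIV. \<Sum>k\<in>UNIV. riemann_curv g l i j k x * a $ i * b $ j * c $ k)"
proof -
  let ?\<Gamma> = "\<lambda>i j k. christoffel g i j k x"
  have d: "\<D> (\<lambda>y. levi_civita g y b c) x a $ l
    = (\<Sum>i\<in>UNIV. \<Sum>j\<in>UNIV. \<Sum>k\<in>UNIV. pd i (christoffel g l j k) x * a $ i * b $ j * c $ k)" for a b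
    by (simp only: fderivI[OF has_derivative_levi_civita[OF x]] fderiv_pd[OF christoffel_differentiable[OF x]]
        sum_distrib_right vec_lambda_beta) (rule sum3_rotate)
  have q: "levi_civita g x a (levi_civita g x b c) $ l
    = (\<Sum>i\<in>UNIV. \<Sum>j\<in>UNIV. \<Sum>k\<in>UNIV. (\<Sum>s\<in>UNIV. ?\<Gamma> l i s * ?\<Gamma> s j k) * a $ i * b $ j * c $ k)" for a b
  proof -
    have "levi_civita g x a (levi_civita g x b c) $ l
      = (\<Sum>i\<in>UNIV. \<Sum>s\<in>UNIV. \<Sum>j\<in>UNIV. \<Sum>k\<in>UNIV. ?\<Gamma> l i s * ?\<Gamma> s j k * a $ i * b $ j * c $ k)"
      by (simp add: levi_civita_def sum_distrib_left sum_distrib_right mult_ac)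
    also have "\<dots> = (\<Sum>i\<in>UNIV. \<Sum>j\<in>UNIV. \<Sum>k\<in>UNIV. \<Sum>s\<in>UNIV. ?\<Gamma> l i s * ?\<Gamma> s j k * a $ i * b $ j * c $ k)"
      by (intro sum.cong refl sum3_rotate[symmetric])
    finally show ?thesis by (simp add: sum_distrib_right)
  qed
  have sw: "(\<Sum>i\<in>UNIV. \<Sum>j\<in>UNIV. \<Sum>k\<in>UNIV. f i j k * b $ i * a $ j * c $ k)
    = (\<Sum>i\<in>UNIV. \<Sum>j\<in>UNIV. \<Sum>k\<in>UNIV. f j i k * a $ i * b $ j * c $ k)" for f
    by (subst sum.swap) (simp add: mult_ac)
  show ?thesis
    unfolding curvature_def vector_add_component vector_minus_component d q sw[of "\<lambda>i j k. pd i (christoffel g l j k) x"]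
      sw[of "\<lambda>i j k. \<Sum>s\<in>UNIV. ?\<Gamma> l i s * ?\<Gamma> s j k"]
    by (simp add: riemann_curv_def sum.distrib sum_subtractf algebra_simps)
qed

text \<open>The sectional curvature controls the sign of \<open>\<langle>R(a, b) b, a\<rangle>\<close> for independent vectors because its
  denominator is then positive, by the strict Cauchy--Schwarz inequality.  For dependent vectors the
  expression vanishes by skew symmetry.\<close>
lemma nonpos_connection_levi_civita:
  assumes sec: "\<And>x X Y. x \<in> U \<Longrightarrow> X \<noteq> Y \<Longrightarrow> independent {X, Y} \<Longrightarrow> sectional_curvature g x X Y \<le> 0"
  shows "nonpos_connection U (metric_form g) (levi_civita g)"
proof
  show "open U" by (rule open_U)
  fix y assume y: "y \<in> U"
  show "bilinear (metric_form g y)" "bilinear (levi_civita g y)"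
    by (rule bilinear_metric_form bilinear_levi_civita)+
  show "metric_form g y a b = metric_form g y b a" "levi_civita g y a b = levi_civita g y b a" for a b
    by (rule metric_form_commute[OF y] levi_civita_sym[OF y])+
  show "((\<lambda>y. metric_form g y a b) has_derivative
    (\<lambda>c. metric_form g y (levi_civita g y c a) b + metric_form g y a (levi_civita g y c b))) (at y)" for a b
    by (rule levi_civita_parallel[OF y])
  show "(\<lambda>y. levi_civita g y a b) differentiable (at y)" for a b
    by (rule differentiableI[OF has_derivative_levi_civita[OF y]])
  show pos: "metric_form g y a a > 0" if "a \<noteq> 0" for a
    using g_pos[OF y that] by (simp add: metric_form_def)
  show "metric_form g y (curvature (levi_civita g) y a b b) a \<le> 0" for a b
  proof (cases "a \<noteq> b \<and> independent {a, b}")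
    case True
    let ?q = "metric_form g y"
    note bl = bilinear_lsub[OF bilinear_metric_form] bilinear_rsub[OF bilinear_metric_form]
      bilinear_lmul[OF bilinear_metric_form] bilinear_rmul[OF bilinear_metric_form]
    have "b \<noteq> 0" using True dependent_zero by blast
    then have b: "?q b b > 0" by (rule pos)
    \<comment> \<open>A multiple of the component of \<open>a\<close> orthogonal to \<open>b\<close>; its length gives the strict inequality.\<close>
    let ?z = "?q b b *\<^sub>R a - ?q a b *\<^sub>R b"
    have "?z \<noteq> 0"
    proof
      assume "?z = 0"
      then have "a = (?q a b / ?q b b) *\<^sub>R b" using b by (simp add: eq_vector_fraction_iff)
      then have "a \<in> span {b}" by (metis span_base span_scale insertI1)
      moreover have "a \<notin> span ({a, b} - {a})" using True dependent_def by blast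
      moreover have "{a, b} - {a} = {b}" using True by auto
      ultimately show False by simp
    qed
    then have "0 < ?q ?z ?z" by (rule pos)
    also have "?q ?z ?z = ?q b b * (?q a a * ?q b b - (?q a b)\<^sup>2)"
      by (simp add: bl metric_form_commute[OF y, of b a] power2_eq_square algebra_simps)
    finally have den: "?q a a * ?q b b - (?q a b)\<^sup>2 > 0" using b by (simp add: zero_less_mult_iff)
    have "sectional_curvature g y a b = ?q (curvature (levi_civita g) y a b b) a / (?q a a * ?q b b - (?q a b)\<^sup>2)"
      unfolding sectional_curvature_def metric_form_def[symmetric] metric_form_sum[of g y "curvature _ _ _ _ _"]
        curvature_levi_civita[OF y]
      by (subst (2) sum.swap) (simp add: sum_distrib_left sum_distrib_right mult_ac)
    moreover have "sectional_curvature g y a b \<le> 0" using sec[OF y] True by blast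
    ultimately show ?thesis using den by (simp add: divide_le_0_iff)
  next
    case False
    have zero: "curvature (levi_civita g) y a b b = 0"
    proof -
      have scale: "curvature (levi_civita g) y (r *\<^sub>R v) v w = 0" "curvature (levi_civita g) y v (r *\<^sub>R v) w = 0" for r v w
      proof -
        have "curvature (levi_civita g) y (r *\<^sub>R v) v w = r *\<^sub>R curvature (levi_civita g) y v v w"
          by (simp add: vec_eq_iff curvature_levi_civita[OF y] sum_distrib_left mult_ac)
        also have "curvature (levi_civita g) y v v w = 0" by (simp add: curvature_def)
        finally show "curvature (levi_civita g) y (r *\<^sub>R v) v w = 0" by simp
        then show "curvature (levi_civita g) y v (r *\<^sub>R v) w = 0"
          using curvature_skew[of "levi_civita g" y v "r *\<^sub>R v" w] by simp
      qed
      have "(\<exists>r. a = r *\<^sub>R b) \<or> (\<exists>r. b = r *\<^sub>R a)"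
      proof (cases "a = b")
        case True
        then show ?thesis by (metis scaleR_one)
      next
        case neq: False
        with False have "dependent {a, b}" by simp
        then have "a \<in> span {b} \<or> b \<in> span {a}"
          using neq unfolding dependent_def by (auto simp: insert_Diff_if)
        then show ?thesis by (auto simp: span_singleton)
      qed
      then show ?thesis using scale by metis
    qed
    show ?thesis by (simp add: zero bilinear_lzero[OF bilinear_metric_form])
  qed
qed

end

section \<open>Pluri-harmonic maps to Riemannian manifolds\<close>

text \<open>Contraction of the nonlinear term of the pluri-harmonic map equation with a vector and its
  conjugate.\<close>
lemma contract_levi_form:
  fixes C :: "'i::finite \<Rightarrow> 'j::finite \<Rightarrow> complex"
  shows "(\<Sum>\<alpha>\<in>UNIV. \<Sum>\<beta>\<in>UNIV. (\<Sum>j\<in>UNIV. \<Sum>k\<in>UNIV. C j k * P j \<beta> * Q k \<alpha>) * a \<alpha> * b \<beta>)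
    = (\<Sum>j\<in>UNIV. \<Sum>k\<in>UNIV. C j k * (\<Sum>\<beta>\<in>UNIV. b \<beta> * P j \<beta>) * (\<Sum>\<alpha>\<in>(UNIV::'m::finite set). a \<alpha> * Q k \<alpha>))"
proof -
  have "(\<Sum>\<alpha>\<in>UNIV. \<Sum>\<beta>\<in>UNIV. (\<Sum>j\<in>UNIV. \<Sum>k\<in>UNIV. C j k * P j \<beta> * Q k \<alpha>) * a \<alpha> * b \<beta>)
    = (\<Sum>\<alpha>\<in>UNIV. \<Sum>\<beta>\<in>UNIV. \<Sum>j\<in>UNIV. \<Sum>k\<in>UNIV. C j k * ((a \<alpha> * Q k \<alpha>) * (b \<beta> * P j \<beta>)))"
    by (simp add: sum_distrib_left sum_distrib_right mult_ac)
  also have "\<dots> = (\<Sum>j\<in>UNIV. \<Sum>k\<in>UNIV. \<Sum>\<alpha>\<in>UNIV. \<Sum>\<beta>\<in>UNIV. C j k * ((a \<alpha> * Q k \<alpha>) * (b \<beta> * P j \<beta>)))"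
    by (rule sum4_swap)
  also have "\<dots> = (\<Sum>j\<in>UNIV. \<Sum>k\<in>UNIV. C j k * ((\<Sum>\<alpha>\<in>UNIV. a \<alpha> * Q k \<alpha>) * (\<Sum>\<beta>\<in>UNIV. b \<beta> * P j \<beta>)))"
    by (simp only: sum_product) (simp only: sum_distrib_left)
  finally show ?thesis by (simp add: mult_ac)
qed

text \<open>Contracting the pluri-harmonic map equation with the velocity of a holomorphic disc and its conjugate
  gives, after multiplication by 4, the Laplacian of the restriction to the disc, and a nonlinear term in the
  Wirtinger derivatives of the restriction.\<close>
lemma pluriharmonic_disc:
  fixes \<phi> :: "'i::finite \<Rightarrow> complex^'m \<Rightarrow> complex"
  assumes V: "open V" "disc p v w t \<in> V" and \<phi>: "\<And>i. smooth_on V (\<phi> i)"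
    and eq: "\<And>\<alpha> \<beta>. dz \<alpha> (dzbar \<beta> (\<phi> i)) (disc p v w t)
      + (\<Sum>j\<in>UNIV. \<Sum>k\<in>UNIV. C j k * dzbar \<beta> (\<phi> j) (disc p v w t) * dz \<alpha> (\<phi> k) (disc p v w t)) = 0"
  defines "\<psi> \<equiv> \<lambda>i t. \<phi> i (disc p v w t)"
  shows "laplacian (\<psi> i) t
    + (\<Sum>j\<in>UNIV. \<Sum>k\<in>UNIV. C j k * (\<D> (\<psi> j) t 1 + \<i> * \<D> (\<psi> j) t \<i>) * (\<D> (\<psi> k) t 1 - \<i> * \<D> (\<psi> k) t \<i>)) = 0"
proof -
  let ?z = "disc p v w t" and ?W = "v + t *s w"
  let ?S = "disc p v w -` V"
  have S: "open ?S" "t \<in> ?S" using open_disc_vimage V by auto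
  have C2: "Ck_on 2 V (\<phi> i)" for i using \<phi> by (simp add: smooth_on_def)
  have \<psi>: "smooth_on ?S (\<psi> i)" for i
    unfolding \<psi>_def by (rule smooth_on_compose[OF S(1) _ \<phi> smooth_on_disc[OF S(1)]]) auto
  have d: "\<phi> j differentiable (at ?z)" for j by (rule smooth_onD[OF \<phi> V(2)])
  have eq': "dz \<alpha> (dzbar \<beta> (\<phi> i)) ?z = - (\<Sum>j\<in>UNIV. \<Sum>k\<in>UNIV. C j k * dzbar \<beta> (\<phi> j) ?z * dz \<alpha> (\<phi> k) ?z)" for \<alpha> \<beta>
    using eq by (simp add: eq_neg_iff_add_eq_0)
  have "wirtinger (wirtinger_bar (\<psi> i)) t
    = (\<Sum>\<alpha>\<in>UNIV. \<Sum>\<beta>\<in>UNIV. dz \<alpha> (dzbar \<beta> (\<phi> i)) ?z * ?W $ \<alpha> * cnj (?W $ \<beta>))"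
    unfolding \<psi>_def by (rule levi_form_disc(1)[OF V(1) C2 V(2)])
  also have "\<dots> = - (\<Sum>\<alpha>\<in>UNIV. \<Sum>\<beta>\<in>UNIV. (\<Sum>j\<in>UNIV. \<Sum>k\<in>UNIV. C j k * dzbar \<beta> (\<phi> j) ?z * dz \<alpha> (\<phi> k) ?z)
      * ?W $ \<alpha> * cnj (?W $ \<beta>))"
    unfolding eq' by (simp only: mult_minus_left sum_negf)
  also have "\<dots> = - (\<Sum>j\<in>UNIV. \<Sum>k\<in>UNIV. C j k * wirtinger_bar (\<psi> j) t * wirtinger (\<psi> k) t)"
    unfolding \<psi>_def wirtinger_disc[OF d] by (subst contract_levi_form) simp
  also have "\<dots> = - (\<Sum>j\<in>UNIV. \<Sum>k\<in>UNIV. C j k * (\<D> (\<psi> j) t 1 + \<i> * \<D> (\<psi> j) t \<i>) * (\<D> (\<psi> k) t 1 - \<i> * \<D> (\<psi> k) t \<i>)) / 4"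
    by (simp add: wirtinger_def wirtinger_bar_def sum_divide_distrib)
  also have "wirtinger (wirtinger_bar (\<psi> i)) t
      = laplacian (\<psi> i) t / 4"
    by (rule wirtinger_wirtinger_bar[OF S]) (use \<psi>[of i] in \<open>simp add: smooth_on_def\<close>)
  finally show ?thesis by (simp only: divide_cancel_right eq_neg_iff_add_eq_0) simp
qed

text \<open>If \<open>X\<close>, \<open>Y\<close> are the real partial derivatives of a map with real components, the real part of
  \<open>(X\<^sub>j + \<i> Y\<^sub>j) (X\<^sub>k - \<i> Y\<^sub>k)\<close> is \<open>X\<^sub>j X\<^sub>k + Y\<^sub>j Y\<^sub>k\<close>; so the real part of the equation along the disc is the
  harmonic map equation.\<close>
lemma tension_levi_civita_disc:
  fixes u :: "complex^'m \<Rightarrow> real^'n"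
  assumes V: "open V" "disc p v w t \<in> V" and u: "smooth_on V u"
    and eq: "\<And>i \<alpha> \<beta>. dz \<alpha> (dzbar \<beta> (\<lambda>z. complex_of_real (u z $ i))) (disc p v w t)
      + (\<Sum>j\<in>UNIV. \<Sum>k\<in>UNIV. complex_of_real (christoffel g i j k (u (disc p v w t)))
        * dzbar \<beta> (\<lambda>z. complex_of_real (u z $ j)) (disc p v w t)
        * dz \<alpha> (\<lambda>z. complex_of_real (u z $ k)) (disc p v w t)) = 0"
  shows "tension (levi_civita g) (\<lambda>t. u (disc p v w t)) t = 0"
proof -
  let ?F = "\<lambda>t. u (disc p v w t)"
  let ?S = "disc p v w -` V"
  let ?X = "\<D> ?F t 1" and ?Y = "\<D> ?F t \<i>"
  have S: "open ?S" "t \<in> ?S" using open_disc_vimage V by auto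
  have F: "smooth_on ?S ?F" by (rule smooth_on_compose[OF S(1) _ u smooth_on_disc[OF S(1)]]) auto
  have bl: "bounded_linear (\<lambda>x::real^'n. complex_of_real (x $ i))" for i
    using bounded_linear_compose[OF bounded_linear_of_real bounded_linear_vec_nth] .
  have \<phi>: "smooth_on V (\<lambda>z. complex_of_real (u z $ i))" for i
    by (rule smooth_on_bounded_linear[OF V(1) bl u])
  have D1: "\<D> (\<lambda>t. complex_of_real (?F t $ i)) t d = complex_of_real (\<D> ?F t d $ i)" for i d
    by (rule fderiv_bounded_linear(2)[OF bl smooth_onD[OF F S(2)]])
  have D2: "\<D> (\<lambda>t. \<D> (\<lambda>t. complex_of_real (?F t $ i)) t d) t d = complex_of_real (\<D> (\<lambda>t. \<D> ?F t d) t d $ i)" for i d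
    by (rule second_fderiv_bounded_linear[OF S bl]) (use F in \<open>simp add: smooth_on_def\<close>)
  have "tension (levi_civita g) ?F t $ i = 0" for i
  proof -
    let ?G = "\<lambda>j k. christoffel g i j k (?F t)"
    have "Re (laplacian (\<lambda>t. complex_of_real (?F t $ i)) t
      + (\<Sum>j\<in>UNIV. \<Sum>k\<in>UNIV. complex_of_real (?G j k)
        * (\<D> (\<lambda>t. complex_of_real (?F t $ j)) t 1 + \<i> * \<D> (\<lambda>t. complex_of_real (?F t $ j)) t \<i>)
        * (\<D> (\<lambda>t. complex_of_real (?F t $ k)) t 1 - \<i> * \<D> (\<lambda>t. complex_of_real (?F t $ k)) t \<i>))) = 0"
      by (subst pluriharmonic_disc[OF V \<phi> eq]) simp
    then have "\<D> (\<lambda>t. \<D> ?F t 1) t 1 $ i + \<D> (\<lambda>t. \<D> ?F t \<i>) t \<i> $ i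
      + (\<Sum>j\<in>UNIV. \<Sum>k\<in>UNIV. ?G j k * (?X $ j * ?X $ k + ?Y $ j * ?Y $ k)) = 0"
      unfolding D1 D2 by (simp add: algebra_simps)
    then show ?thesis
      by (simp add: tension_def cov_def levi_civita_def algebra_simps sum.distrib)
  qed
  then show ?thesis by (simp add: vec_eq_iff)
qed

theorem pluriharmonic_riemannian_constant:
  fixes M :: "'a topology" and A :: "('a, complex^'m) chart set"
    and N :: "'b topology" and B :: "('b, real^'n) chart set"
  assumes M: "complex_manifold M A" "compact_space M" "hermitian_metric A h" "positive_HSC A h"
    and N: "smooth_manifold N B" "riemannian_metric B g" "nonpos_sectional_curvature B g"
    and f: "pluriharmonic_riemannian M A N B g f"
  shows "f constant_on topspace M"
proof -
  have chart: "is_chart N d" if "d \<in> B" for d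
    using N(1) that by (simp add: smooth_manifold_def connected_manifold_def)
  have sm: "smooth_map M A N B f" using f by (simp add: pluriharmonic_riemannian_def)
  interpret pluriharmonic_map M A h N B "\<lambda>d. metric_form (g d)" "\<lambda>d. levi_civita (g d)" f
  proof (rule pluriharmonic_map.intro)
    show "complex_manifold M A" "hermitian_metric A h" by fact+
    show "d \<in> B \<Longrightarrow> is_chart N d" for d by (rule chart)
    show "topspace N = (\<Union>d\<in>B. fst d)" using N(1) by (simp add: smooth_manifold_def connected_manifold_def)
    show "transition d d' differentiable (at y)" if "d \<in> B" "d' \<in> B" "y \<in> overlap d d'" for d d' y
      using N(1) that unfolding smooth_manifold_def by (blast intro: smooth_onD)
    show "metric_form (g d) y a b
      = metric_form (g d') (transition d d' y) (\<D> (transition d d') y a) (\<D> (transition d d') y b)"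
      if "d \<in> B" "d' \<in> B" "y \<in> overlap d d'" for d d' y a b
      using N(2) that unfolding riemannian_metric_def metric_form_def by blast
    show "nonpos_connection (chart_image d) (metric_form (g d)) (levi_civita (g d))" if d: "d \<in> B" for d
    proof (rule riemannian_patch.nonpos_connection_levi_civita)
      show "riemannian_patch (chart_image d) (g d)"
        using N(2) d chart_facts(4)[OF chart[OF d]] by unfold_locales (auto simp: riemannian_metric_def)
      show "sectional_curvature (g d) x X Y \<le> 0" if "x \<in> chart_image d" "X \<noteq> Y" "independent {X, Y}" for x X Y
        using N(3) d that unfolding nonpos_sectional_curvature_def by blast
    qed
    show "smooth_map M A N B f" by (rule sm)
    show "tension (levi_civita (g d)) (\<lambda>t. local_rep c d f (disc p v w t)) t = 0"
      if cd: "c \<in> A" "d \<in> B" and t: "disc p v w t \<in> map_domain c d f" for c d p v w t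
    proof (rule tension_levi_civita_disc[OF _ t])
      have "is_chart M c" using M(1) cd by (simp add: complex_manifold_def connected_manifold_def)
      moreover have "continuous_map M N f" using sm by (simp add: smooth_map_def)
      ultimately show "open (map_domain c d f)" using open_map_domain[OF _ _ chart[OF cd(2)]] by blast
      show "smooth_on (map_domain c d f) (local_rep c d f)" using sm cd by (simp add: smooth_map_def)
    qed (use f cd t in \<open>simp add: pluriharmonic_riemannian_def Let_def\<close>)
  qed
  show ?thesis by (rule constant_if_positive_HSC[OF M(2,4)])
qed

section \<open>Pluri-harmonic maps to Kaehler manifolds\<close>

text \<open>A linear change of coordinates, applied below to the identification of \<open>\<complex>\<^sup>n\<close> with \<open>\<real>\<^sup>2\<^sup>n\<close>.\<close>
lemma nonpos_connection_transport:
  fixes \<phi> :: "'w::euclidean_space \<Rightarrow> 'v::euclidean_space"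
  assumes conn: "nonpos_connection U G \<Gamma>"
    and \<phi>: "linear \<phi>" and \<psi>: "linear \<psi>" and inv: "\<And>x. \<phi> (\<psi> x) = x" "\<And>x. \<psi> (\<phi> x) = x"
  shows "nonpos_connection (\<phi> -` U) (\<lambda>y a b. G (\<phi> y) (\<phi> a) (\<phi> b)) (\<lambda>y a b. \<psi> (\<Gamma> (\<phi> y) (\<phi> a) (\<phi> b)))"
proof -
  interpret nonpos_connection U G \<Gamma> by (rule conn)
  have bl\<phi>: "bounded_linear \<phi>" and bl\<psi>: "bounded_linear \<psi>"
    using \<phi> \<psi> by (simp_all add: linear_conv_bounded_linear)
  have d\<phi>: "(\<phi> has_derivative \<phi>) (at y)" for y by (rule bounded_linear_imp_has_derivative[OF bl\<phi>])
  note l = linear_add[OF \<phi>] linear_cmul[OF \<phi>] linear_add[OF \<psi>] linear_cmul[OF \<psi>]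
    linear_diff[OF \<psi>]
  show ?thesis
  proof (rule nonpos_connection.intro)
    show "open (\<phi> -` U)"
      by (intro open_vimage open_U) (simp add: linear_continuous_on[OF bl\<phi>])
    fix y assume "y \<in> \<phi> -` U"
    then have y: "\<phi> y \<in> U" by simp
    note bG = bilinear_ladd[OF bilinear_G[OF y]] bilinear_radd[OF bilinear_G[OF y]]
      bilinear_lmul[OF bilinear_G[OF y]] bilinear_rmul[OF bilinear_G[OF y]]
    note b\<Gamma> = bilinear_ladd[OF bilinear_\<Gamma>[OF y]] bilinear_radd[OF bilinear_\<Gamma>[OF y]]
      bilinear_lmul[OF bilinear_\<Gamma>[OF y]] bilinear_rmul[OF bilinear_\<Gamma>[OF y]]
    show "bilinear (\<lambda>a b. G (\<phi> y) (\<phi> a) (\<phi> b))" "bilinear (\<lambda>a b. \<psi> (\<Gamma> (\<phi> y) (\<phi> a) (\<phi> b)))"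
      by (simp_all add: bilinear_def linear_iff l bG b\<Gamma>)
    show "G (\<phi> y) (\<phi> a) (\<phi> b) = G (\<phi> y) (\<phi> b) (\<phi> a)" "\<psi> (\<Gamma> (\<phi> y) (\<phi> a) (\<phi> b)) = \<psi> (\<Gamma> (\<phi> y) (\<phi> b) (\<phi> a))" for a b
      by (rule G_sym[OF y]) (simp only: \<Gamma>_sym[OF y])
    show "0 < G (\<phi> y) (\<phi> a) (\<phi> a)" if "a \<noteq> 0" for a
    proof -
      have "\<phi> a \<noteq> 0" using that inv(2)[of a] linear_0[OF \<psi>] by metis
      then show ?thesis by (rule G_pos[OF y])
    qed
    show "((\<lambda>y. G (\<phi> y) (\<phi> a) (\<phi> b)) has_derivative
      (\<lambda>c. G (\<phi> y) (\<phi> (\<psi> (\<Gamma> (\<phi> y) (\<phi> c) (\<phi> a)))) (\<phi> b) + G (\<phi> y) (\<phi> a) (\<phi> (\<psi> (\<Gamma> (\<phi> y) (\<phi> c) (\<phi> b)))))) (at y)" for a b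
      unfolding inv by (rule has_derivative_compose[OF d\<phi> G_parallel[OF y]])
    have d\<Gamma>: "((\<lambda>y. \<psi> (\<Gamma> (\<phi> y) (\<phi> a) (\<phi> b))) has_derivative
      (\<lambda>c. \<psi> (\<D> (\<lambda>y. \<Gamma> y (\<phi> a) (\<phi> b)) (\<phi> y) (\<phi> c)))) (at y)" for a b
      by (rule bounded_linear.has_derivative[OF bl\<psi>
            has_derivative_compose[OF d\<phi> has_derivative_fderiv[OF \<Gamma>_differentiable[OF y]]]])
    show "(\<lambda>y. \<psi> (\<Gamma> (\<phi> y) (\<phi> a) (\<phi> b))) differentiable (at y)" for a b
      by (rule differentiableI[OF d\<Gamma>])
    have "\<phi> (curvature (\<lambda>y a b. \<psi> (\<Gamma> (\<phi> y) (\<phi> a) (\<phi> b))) y a b c) = curvature \<Gamma> (\<phi> y) (\<phi> a) (\<phi> b) (\<phi> c)" for a b c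
      by (simp add: curvature_def fderivI[OF d\<Gamma>] inv linear_add[OF \<phi>] linear_diff[OF \<phi>])
    then show "G (\<phi> y) (\<phi> (curvature (\<lambda>y a b. \<psi> (\<Gamma> (\<phi> y) (\<phi> a) (\<phi> b))) y a b b)) (\<phi> a) \<le> 0" for a b
      using curvature_nonpos[OF y] by simp
  qed
qed

text \<open>The difference \<open>S\<close> of two such connections satisfies \<open>S(a, b) = S(b, a)\<close>, and \<open>G(S(c, a), b)\<close> is skew
  in \<open>a\<close> and \<open>b\<close>.  A trilinear form that is symmetric in the first two and skew in the last two arguments
  vanishes.\<close>
lemma (in nonpos_connection) connection_unique:
  assumes y: "y \<in> U" and C_sym: "\<And>a b. C a b = C b a"
    and parallel: "\<And>a b. ((\<lambda>y. G y a b) has_derivative (\<lambda>c. G y (C c a) b + G y a (C c b))) (at y)"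
  shows "C a b = \<Gamma> y a b"
proof -
  define S where "S a b = C a b - \<Gamma> y a b" for a b
  note bl = bilinear_lsub[OF bilinear_G[OF y]] bilinear_rsub[OF bilinear_G[OF y]]
  have S_sym: "S a b = S b a" for a b by (simp add: S_def C_sym[of a b] \<Gamma>_sym[OF y, of a b])
  have skew: "G y (S c a) b = - G y (S c b) a" for a b c
  proof -
    have "(\<lambda>c. G y (C c a) b + G y a (C c b)) = (\<lambda>c. G y (\<Gamma> y c a) b + G y a (\<Gamma> y c b))"
      using has_derivative_unique[OF parallel G_parallel[OF y]] .
    then have "G y (C c a) b + G y a (C c b) = G y (\<Gamma> y c a) b + G y a (\<Gamma> y c b)" by (rule fun_cong)
    then show ?thesis unfolding S_def bl by (simp add: G_sym[OF y, of a])
  qed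
  have "G y (S a b) c = - G y (S a b) c" for c
    using skew[of a b c] skew[of c a b] skew[of b c a] S_sym[of a b] S_sym[of a c] S_sym[of b c] by simp
  then have "G y (S a b) (S a b) = 0" by simp
  then have "S a b = 0" using G_pos[OF y, of "S a b"] by (cases "S a b = 0") auto
  then show ?thesis by (simp add: S_def)
qed

lemma realify_complexify [simp]: "realify (complexify x) = x" "complexify (realify w) = w"
  by (auto simp: realify_def complexify_def vec_eq_iff split: sum.splits)

lemma linear_realify: "linear realify"
  by (auto simp: linear_iff realify_def vec_eq_iff split: sum.splits)

lemma linear_complexify: "linear complexify"
  by (auto simp: linear_iff complexify_def vec_eq_iff complex_eq_iff)

lemma herm_form_linear:
  "herm_form H (a + b) c = herm_form H a c + herm_form H b c"
  "herm_form H a (b + c) = herm_form H a b + herm_form H a c"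
  "herm_form H (z *s a) c = z * herm_form H a c"
  "herm_form H a (z *s c) = cnj z * herm_form H a c"
  "herm_form H (r *\<^sub>R a) c = of_real r * herm_form H a c"
  "herm_form H a (r *\<^sub>R c) = of_real r * herm_form H a c"
proof -
  show "herm_form H (a + b) c = herm_form H a c + herm_form H b c"
    "herm_form H a (b + c) = herm_form H a b + herm_form H a c"
    by (simp_all add: herm_form_def algebra_simps sum.distrib)
  show s: "herm_form H (z *s a) c = z * herm_form H a c"
    "herm_form H a (z *s c) = cnj z * herm_form H a c" for z a c
    by (simp_all add: herm_form_def sum_distrib_left mult_ac)
  have "r *\<^sub>R a = of_real r *s a" for a :: "complex^'a" by (simp add: vec_eq_iff complex_eq_iff)
  then show "herm_form H (r *\<^sub>R a) c = of_real r * herm_form H a c"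
    "herm_form H a (r *\<^sub>R c) = of_real r * herm_form H a c"
    by (simp_all add: s)
qed

lemma bilinear_real_form: "bilinear (real_form H)"
  by (simp add: bilinear_def linear_iff real_form_def herm_form_linear algebra_simps)

definition chern_connection :: "(complex^'n \<Rightarrow> complex^'n^'n) \<Rightarrow> complex^'n \<Rightarrow> complex^'n \<Rightarrow> complex^'n \<Rightarrow> complex^'n" where
  "chern_connection g y a b = (\<chi> i. \<Sum>j\<in>UNIV. \<Sum>k\<in>UNIV. chern_christoffel g i j k y * a $ j * b $ k)"

locale kaehler_patch =
  fixes U :: "(complex^'n) set" and g :: "complex^'n \<Rightarrow> complex^'n^'n"
  assumes open_U: "open U" and smooth_g: "smooth_on U g"
    and g_herm: "y \<in> U \<Longrightarrow> g y $ j $ i = cnj (g y $ i $ j)"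
    and g_pos: "y \<in> U \<Longrightarrow> v \<noteq> 0 \<Longrightarrow> Re (herm_form (g y) v v) > 0"
    and closed: "y \<in> U \<Longrightarrow> d_kaehler_form g y X Y Z = 0"
begin

text \<open>The derivative \<open>\<partial>\<^sub>a\<close> of the function \<open>g(b, c)\<close>, for constant vectors \<open>b\<close> and \<open>c\<close>.  The Chern connection is
  characterized by \<open>\<partial>\<^sub>a g(b, c) = g(\<nabla>\<^sub>a b, c)\<close>.\<close>
definition herm_dz :: "complex^'n \<Rightarrow> complex^'n \<Rightarrow> complex^'n \<Rightarrow> complex^'n \<Rightarrow> complex" where
  "herm_dz y a b c = (\<Sum>j\<in>UNIV. \<Sum>k\<in>UNIV. \<Sum>l\<in>UNIV. dz j (\<lambda>y. g y $ k $ l) y * a $ j * b $ k * cnj (c $ l))"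

lemma herm_dz_scale:
  "herm_dz y (z *s a) b c = z * herm_dz y a b c" "herm_dz y a (z *s b) c = z * herm_dz y a b c" "herm_dz y a b (z *s c) = cnj z * herm_dz y a b c"
  by (simp_all add: herm_dz_def sum_distrib_left mult_ac)

lemma herm_form_sym: "y \<in> U \<Longrightarrow> herm_form (g y) a b = cnj (herm_form (g y) b a)"
  unfolding herm_form_def by (subst sum.swap) (simp add: g_herm[symmetric] mult_ac)

lemma real_form_sym: "y \<in> U \<Longrightarrow> real_form (g y) a b = real_form (g y) b a"
  using herm_form_sym[of y a b] by (simp add: real_form_def)

lemma entry_smooth: "smooth_on U (\<lambda>y. g y $ i $ j)"
  by (intro smooth_on_bounded_linear[OF open_U bounded_linear_vec_nth] smooth_g)

lemma herm_form_chern: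
  assumes y: "y \<in> U"
  shows "herm_form (g y) (chern_connection g y a b) c = herm_dz y a b c"
proof -
  have inv: "invertible (g y)" using g_pos[OF y] by (rule invertible_posdef_hermitian)
  have low: "(\<Sum>i\<in>UNIV. g y $ i $ m * chern_christoffel g i j k y) = dz j (\<lambda>y. g y $ k $ m) y" for j k m
  proof -
    have "(\<Sum>i\<in>UNIV. g y $ i $ m * chern_christoffel g i j k y)
      = (\<Sum>i\<in>UNIV. \<Sum>l\<in>UNIV. (matrix_inv (g y) $ l $ i * g y $ i $ m) * dz j (\<lambda>y. g y $ k $ l) y)"
      by (simp add: chern_christoffel_def sum_distrib_left mult_ac)
    also have "\<dots> = (\<Sum>l\<in>UNIV. (\<Sum>i\<in>UNIV. matrix_inv (g y) $ l $ i * g y $ i $ m) * dz j (\<lambda>y. g y $ k $ l) y)"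
      by (subst sum.swap) (simp only: sum_distrib_right)
    also have "\<dots> = dz j (\<lambda>y. g y $ k $ m) y"
      by (simp only: matrix_inv_sum[OF inv] sum_delta_mult)
    finally show ?thesis .
  qed
  have "herm_form (g y) (chern_connection g y a b) c
    = (\<Sum>i\<in>UNIV. \<Sum>m\<in>UNIV. \<Sum>j\<in>UNIV. \<Sum>k\<in>UNIV. (g y $ i $ m * chern_christoffel g i j k y) * (a $ j * b $ k * cnj (c $ m)))"
    by (simp add: herm_form_def chern_connection_def sum_distrib_left sum_distrib_right mult_ac)
  also have "\<dots> = (\<Sum>j\<in>UNIV. \<Sum>k\<in>UNIV. \<Sum>i\<in>UNIV. \<Sum>m\<in>UNIV. (g y $ i $ m * chern_christoffel g i j k y) * (a $ j * b $ k * cnj (c $ m)))"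
    by (rule sum4_swap)
  also have "\<dots> = (\<Sum>j\<in>UNIV. \<Sum>k\<in>UNIV. \<Sum>m\<in>UNIV. (\<Sum>i\<in>UNIV. g y $ i $ m * chern_christoffel g i j k y) * (a $ j * b $ k * cnj (c $ m)))"
    unfolding sum_distrib_right by (intro sum.cong refl sum.swap)
  also have "\<dots> = herm_dz y a b c" by (simp only: low herm_dz_def mult.assoc)
  finally show ?thesis .
qed

lemma has_derivative_herm_form:
  assumes y: "y \<in> U"
  shows "((\<lambda>y. herm_form (g y) b c) has_derivative (\<lambda>a. herm_dz y a b c + cnj (herm_dz y a c b))) (at y)"
proof -
  have d: "(\<lambda>y. g y $ k $ l) differentiable (at y)" for k l by (rule smooth_onD[OF entry_smooth y])
  have e: "\<D> (\<lambda>y. g y $ k $ l) y a = (\<Sum>j\<in>UNIV. dz j (\<lambda>y. g y $ k $ l) y * a $ j)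
      + cnj (\<Sum>j\<in>UNIV. dz j (\<lambda>y. g y $ l $ k) y * a $ j)" for k l a
  proof -
    have c: "\<D> (\<lambda>y. g y $ k $ l) y s = cnj (\<D> (\<lambda>y. g y $ l $ k) y s)" for s
    proof -
      have "\<D> (\<lambda>y. g y $ k $ l) y = \<D> (\<lambda>y. cnj (g y $ l $ k)) y"
        by (rule fderiv_cong_open[OF open_U y g_herm])
      then show ?thesis by (simp add: fderiv_bounded_linear(2)[OF bounded_linear_cnj d])
    qed
    have "dzbar j (\<lambda>y. g y $ k $ l) y = cnj (dz j (\<lambda>y. g y $ l $ k) y)" for j
      by (simp add: dz_def dzbar_def c[symmetric])
    then have "(\<Sum>j\<in>UNIV. cnj (a $ j) * dzbar j (\<lambda>y. g y $ k $ l) y) = cnj (\<Sum>j\<in>UNIV. dz j (\<lambda>y. g y $ l $ k) y * a $ j)"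
      by (simp add: mult.commute)
    moreover have "\<D> (\<lambda>y. g y $ k $ l) y a = (\<Sum>j\<in>UNIV. a $ j * dz j (\<lambda>y. g y $ k $ l) y)
        + (\<Sum>j\<in>UNIV. cnj (a $ j) * dzbar j (\<lambda>y. g y $ k $ l) y)"
      unfolding dz_expand[OF d, symmetric] by (simp add: field_simps)
    ultimately show ?thesis by (simp add: mult.commute)
  qed
  have "((\<lambda>y. \<Sum>k\<in>UNIV. \<Sum>l\<in>UNIV. g y $ k $ l * b $ k * cnj (c $ l)) has_derivative
    (\<lambda>a. \<Sum>k\<in>UNIV. \<Sum>l\<in>UNIV. \<D> (\<lambda>y. g y $ k $ l) y a * b $ k * cnj (c $ l))) (at y)"
    by (intro has_derivative_sum has_derivative_mult_left has_derivative_fderiv d)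
  moreover have "(\<Sum>k\<in>UNIV. \<Sum>l\<in>UNIV. \<D> (\<lambda>y. g y $ k $ l) y a * b $ k * cnj (c $ l))
      = herm_dz y a b c + cnj (herm_dz y a c b)" for a
  proof -
    have 1: "(\<Sum>k\<in>UNIV. \<Sum>l\<in>UNIV. (\<Sum>j\<in>UNIV. dz j (\<lambda>y. g y $ k $ l) y * a $ j) * b $ k * cnj (c $ l)) = herm_dz y a b c"
      unfolding herm_dz_def sum_distrib_right by (rule sum3_rotate)
    have T': "(\<Sum>l\<in>UNIV. \<Sum>k\<in>UNIV. (\<Sum>j\<in>UNIV. dz j (\<lambda>y. g y $ l $ k) y * a $ j) * c $ l * cnj (b $ k)) = herm_dz y a c b"
      unfolding herm_dz_def sum_distrib_right by (rule sum3_rotate)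
    have "cnj (herm_dz y a c b) = (\<Sum>l\<in>UNIV. \<Sum>k\<in>UNIV. cnj (\<Sum>j\<in>UNIV. dz j (\<lambda>y. g y $ l $ k) y * a $ j) * b $ k * cnj (c $ l))"
      by (subst T'[symmetric]) (simp add: mult_ac)
    also have "\<dots> = (\<Sum>k\<in>UNIV. \<Sum>l\<in>UNIV. cnj (\<Sum>j\<in>UNIV. dz j (\<lambda>y. g y $ l $ k) y * a $ j) * b $ k * cnj (c $ l))"
      by (rule sum.swap)
    finally have 2: "cnj (herm_dz y a c b)
      = (\<Sum>k\<in>UNIV. \<Sum>l\<in>UNIV. cnj (\<Sum>j\<in>UNIV. dz j (\<lambda>y. g y $ l $ k) y * a $ j) * b $ k * cnj (c $ l))" .
    show ?thesis by (simp only: e distrib_right sum.distrib 1 2)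
  qed
  ultimately show ?thesis by (simp add: herm_form_def)
qed

text \<open>The Kaehler condition says that the cyclic sum of \<open>S(a, b, c)\<close>, where \<open>S\<close> is the skew part of \<open>herm_dz\<close> in
  its first two arguments, has imaginary part 0.  As \<open>S\<close> is linear in \<open>a\<close> and \<open>b\<close> but antilinear in \<open>c\<close>,
  replacing \<open>a\<close>, \<open>b\<close> by \<open>\<i> a\<close>, \<open>\<i> b\<close> changes the sign of one term and leaves the other two unchanged, which
  shows that \<open>S\<close> is real.  It is then 0, again by linearity in \<open>a\<close>.\<close>
lemma herm_dz_sym:
  assumes y: "y \<in> U"
  shows "herm_dz y a b c = herm_dz y b a c"
proof -
  define S where "S a b c = herm_dz y a b c - herm_dz y b a c" for a b c
  have dK: "\<D> (\<lambda>u. kaehler_form (g u) b c) y a = - 2 * Im (herm_dz y a b c + cnj (herm_dz y a c b))" for a b c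
  proof -
    have "((\<lambda>u. 2 * Re (\<i> * herm_form (g u) b c)) has_derivative (\<lambda>a. 2 * Re (\<i> * (herm_dz y a b c + cnj (herm_dz y a c b))))) (at y)"
      by (intro has_derivative_mult_right has_derivative_Re has_derivative_herm_form[OF y])
    moreover have "(\<lambda>u. kaehler_form (g u) b c) = (\<lambda>u. 2 * Re (\<i> * herm_form (g u) b c))"
      by (simp add: kaehler_form_def real_form_def herm_form_linear)
    ultimately show ?thesis by (simp add: fderivI)
  qed
  have cyc: "Im (S a b c + S b c a + S c a b) = 0" for a b c
    using closed[OF y, of a b c] by (simp add: d_kaehler_form_def dK S_def)
  have scale: "S (z *s a) b c = z * S a b c" "S a (z *s b) c = z * S a b c" "S a b (z *s c) = cnj z * S a b c" for z a b c
    by (simp_all add: S_def herm_dz_scale right_diff_distrib)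
  have im: "Im (S a b c) = 0" for a b c
    using cyc[of a b c] cyc[of "\<i> *s a" "\<i> *s b" c] by (simp add: scale)
  have "Re (S a b c) = 0" using im[of "\<i> *s a" b c] by (simp add: scale)
  then have "S a b c = 0" using im[of a b c] by (simp add: complex_eq_iff)
  then show ?thesis by (simp add: S_def)
qed

lemma chern_connection_sym:
  assumes y: "y \<in> U"
  shows "chern_connection g y a b = chern_connection g y b a"
proof -
  let ?v = "chern_connection g y a b - chern_connection g y b a"
  have "herm_form (g y) ?v c = 0" for c
    using herm_form_linear(1)[of "g y" ?v "chern_connection g y b a" c] herm_form_chern[OF y] herm_dz_sym[OF y, of a b c]
    by simp
  then have "?v = 0" using g_pos[OF y, of ?v] by (cases "?v = 0") auto
  then show ?thesis by simp
qed

lemma chern_connection_parallel: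
  assumes y: "y \<in> U"
  shows "((\<lambda>y. real_form (g y) a b) has_derivative
    (\<lambda>c. real_form (g y) (chern_connection g y c a) b + real_form (g y) a (chern_connection g y c b))) (at y)"
proof -
  have "((\<lambda>y. 2 * Re (herm_form (g y) a b)) has_derivative (\<lambda>c. 2 * Re (herm_dz y c a b + cnj (herm_dz y c b a)))) (at y)"
    by (intro has_derivative_mult_right has_derivative_Re has_derivative_herm_form[OF y])
  moreover have "2 * Re (herm_dz y c a b + cnj (herm_dz y c b a))
    = real_form (g y) (chern_connection g y c a) b + real_form (g y) a (chern_connection g y c b)" for c
    unfolding real_form_sym[OF y, of a] by (simp add: real_form_def herm_form_chern[OF y])
  ultimately show ?thesis by (simp add: real_form_def[abs_def])
qed

end

lemma nonpos_connection_cong: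
  assumes conn: "nonpos_connection U G \<Gamma>" and eq: "\<And>y a b. y \<in> U \<Longrightarrow> \<Gamma>' y a b = \<Gamma> y a b"
  shows "nonpos_connection U G \<Gamma>'"
proof -
  interpret nonpos_connection U G \<Gamma> by (rule conn)
  show ?thesis
  proof (rule nonpos_connection.intro[OF open_U bilinear_G G_sym G_pos])
    fix y assume y: "y \<in> U"
    have e: "\<Gamma>' y = \<Gamma> y" using eq[OF y] by (intro ext)
    have D: "\<D> (\<lambda>y. \<Gamma>' y a b) y = \<D> (\<lambda>y. \<Gamma> y a b) y" for a b
      by (rule fderiv_cong_open[OF open_U y eq])
    show "bilinear (\<Gamma>' y)" unfolding e by (rule bilinear_\<Gamma>[OF y])
    show "\<Gamma>' y a b = \<Gamma>' y b a" for a b unfolding e by (rule \<Gamma>_sym[OF y])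
    show "((\<lambda>y. G y a b) has_derivative (\<lambda>c. G y (\<Gamma>' y c a) b + G y a (\<Gamma>' y c b))) (at y)" for a b
      unfolding e by (rule G_parallel[OF y])
    show "(\<lambda>y. \<Gamma>' y a b) differentiable (at y)" for a b
      using differentiable_cong_open[OF open_U y, of "\<lambda>y. \<Gamma>' y a b" "\<lambda>y. \<Gamma> y a b"] eq \<Gamma>_differentiable[OF y]
      by simp
    show "G y (curvature \<Gamma>' y a b b) a \<le> 0" for a b
      using curvature_nonpos[OF y] by (simp add: curvature_def D e)
  qed
qed

lemma smooth_on_vec_lambda:
  fixes f :: "'i::finite \<Rightarrow> 'v::real_normed_vector \<Rightarrow> 'w::euclidean_space"
  assumes "open S" "\<And>i. smooth_on S (f i)"
  shows "smooth_on S (\<lambda>x. \<chi> i. f i x)"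
proof -
  have "linear (axis i :: 'w \<Rightarrow> 'w^'i)" for i
    by (auto simp: linear_iff vec_eq_iff axis_def)
  then have "bounded_linear (axis i :: 'w \<Rightarrow> 'w^'i)" for i
    using linear_conv_bounded_linear by blast
  then have "smooth_on S (\<lambda>x. axis i (f i x))" for i
    by (rule smooth_on_bounded_linear[OF assms(1) _ assms(2)])
  then have "smooth_on S (\<lambda>x. \<Sum>i\<in>UNIV. axis i (f i x))" by (rule smooth_on_sum[OF assms(1)])
  moreover have "(\<Sum>i\<in>UNIV. axis i (f i x)) = (\<chi> i. f i x)" for x
    by (simp add: vec_eq_iff axis_def)
  ultimately show ?thesis by simp
qed

definition realified_metric :: "(complex^'n \<Rightarrow> complex^'n^'n) \<Rightarrow> real^('n + 'n) \<Rightarrow> real^('n + 'n)^('n + 'n)" where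
  "realified_metric g x = (\<chi> a b. real_form (g (complexify x)) (complexify (axis a 1)) (complexify (axis b 1)))"

lemma underlying_metric_realified:
  "underlying_metric g (fst d, realify \<circ> snd d) = realified_metric (g d)"
  by (simp add: fun_eq_iff underlying_metric_def realified_metric_def comp_def)

lemma metric_form_realified:
  "metric_form (realified_metric g) x a b = real_form (g (complexify x)) (complexify a) (complexify b)"
proof -
  have "metric_form (realified_metric g) x = (\<lambda>a b. real_form (g (complexify x)) (complexify a) (complexify b))"
  proof (rule bilinear_eq_stdbasis[OF bilinear_metric_form])
    show "bilinear (\<lambda>a b. real_form (g (complexify x)) (complexify a) (complexify b))"
      using bilinear_real_form[of "g (complexify x)"]
      by (simp add: bilinear_def linear_iff linear_add[OF linear_complexify] linear_cmul[OF linear_complexify])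
    fix i j :: "real^('a + 'a)" assume "i \<in> Basis" "j \<in> Basis"
    then obtain k l where "i = axis k 1" "j = axis l 1" by (auto simp: Basis_vec_def)
    then show "metric_form (realified_metric g) x i j = real_form (g (complexify x)) (complexify i) (complexify j)"
      by (simp add: metric_form_sum axis_def[of k 1] axis_def[of l 1] if_distrib[of "\<lambda>x. _ * x"] cong: if_cong)
        (simp add: realified_metric_def axis_def)
  qed
  then show ?thesis by simp
qed

context kaehler_patch
begin

lemma riemannian_patch_realified: "riemannian_patch (realify ` U) (realified_metric g)"
proof
  have im: "realify ` U = complexify -` U"
    by (auto simp: image_iff) (metis realify_complexify(1))
  have bl: "bounded_linear (complexify :: real^('n + 'n) \<Rightarrow> _)"
    using linear_complexify by (simp add: linear_conv_bounded_linear)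
  show op: "open (realify ` U)"
    unfolding im by (intro open_vimage open_U) (simp add: linear_continuous_on[OF bl])
  have "smooth_on (realify ` U) (\<lambda>x. g (complexify x))"
    by (rule smooth_on_compose[OF op _ smooth_g smooth_on_linear[OF bl]]) (auto simp: im)
  moreover have "bounded_linear (\<lambda>Q. real_form Q v w)" for v w :: "complex^'n"
  proof -
    have "herm_form (P + Q) v w = herm_form P v w + herm_form Q v w" for P Q
      by (simp add: herm_form_def distrib_right sum.distrib)
    moreover have "herm_form (r *\<^sub>R P) v w = complex_of_real r * herm_form P v w" for r P
    proof -
      have "(r *\<^sub>R P) $ i $ j = complex_of_real r * P $ i $ j" for i j by (simp add: complex_eq_iff)
      then show ?thesis by (simp add: herm_form_def sum_distrib_left mult_ac)
    qed
    ultimately have "linear (\<lambda>Q. real_form Q v w)" by (simp add: linear_iff real_form_def)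
    then show ?thesis by (simp add: linear_conv_bounded_linear)
  qed
  ultimately have "smooth_on (realify ` U) (\<lambda>x. real_form (g (complexify x)) v w)" for v w
    using smooth_on_bounded_linear[OF op] by blast
  then show "smooth_on (realify ` U) (realified_metric g)"
    unfolding realified_metric_def[abs_def] by (intro smooth_on_vec_lambda op)
  fix x assume "x \<in> realify ` U"
  then have x: "complexify x \<in> U" by (simp add: im)
  show "transpose (realified_metric g x) = realified_metric g x"
    by (simp add: transpose_def realified_metric_def vec_eq_iff real_form_sym[OF x])
  show "0 < v \<bullet> (realified_metric g x *v v)" if "v \<noteq> 0" for v
  proof -
    have "complexify v \<noteq> 0" using that linear_0[OF linear_realify] realify_complexify(1) by metis
    then show ?thesis
      using g_pos[OF x] metric_form_realified[of g x v v] by (simp add: metric_form_def real_form_def)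
  qed
qed

text \<open>The Levi-Civita connection of the underlying real metric, transported to complex coordinates, and the
  Chern connection are both torsion-free and preserve the metric, hence equal.\<close>
lemma nonpos_connection_chern:
  assumes sec: "\<And>x X Y. x \<in> realify ` U \<Longrightarrow> X \<noteq> Y \<Longrightarrow> independent {X, Y} \<Longrightarrow>
    sectional_curvature (realified_metric g) x X Y \<le> 0"
  shows "nonpos_connection U (\<lambda>y. real_form (g y)) (chern_connection g)"
proof -
  define \<Gamma> where "\<Gamma> y a b = complexify (levi_civita (realified_metric g) (realify y) (realify a) (realify b))" for y a b
  have "nonpos_connection (realify ` U) (metric_form (realified_metric g)) (levi_civita (realified_metric g))"
    by (rule riemannian_patch.nonpos_connection_levi_civita[OF riemannian_patch_realified]) (rule sec)
  from nonpos_connection_transport[OF this linear_realify linear_complexify realify_complexify]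
  have "nonpos_connection (realify -` realify ` U)
     (\<lambda>y a b. metric_form (realified_metric g) (realify y) (realify a) (realify b)) \<Gamma>"
    by (simp add: \<Gamma>_def[abs_def])
  moreover have "realify -` realify ` U = U"
    by (rule inj_vimage_image_eq) (metis injI realify_complexify(2))
  ultimately have conn: "nonpos_connection U (\<lambda>y. real_form (g y)) \<Gamma>"
    by (simp add: metric_form_realified)
  show ?thesis
    by (rule nonpos_connection_cong[OF conn])
      (rule nonpos_connection.connection_unique[OF conn _ chern_connection_sym chern_connection_parallel])
qed

end

text \<open>The nonlinear term is the connection applied to the partial derivatives \<open>X - \<i> Y\<close> and \<open>X + \<i> Y\<close> of \<open>F\<close>; by
  symmetry the mixed terms cancel and the sum over \<open>X, X\<close> and \<open>Y, Y\<close> remains.\<close>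
lemma tension_chern_disc:
  fixes u :: "complex^'m \<Rightarrow> complex^'n"
  assumes V: "open V" "disc p v w t \<in> V" and u: "smooth_on V u"
    and sym: "\<And>a b. chern_connection g (u (disc p v w t)) a b = chern_connection g (u (disc p v w t)) b a"
    and eq: "\<And>i \<alpha> \<beta>. dz \<alpha> (dzbar \<beta> (\<lambda>z. u z $ i)) (disc p v w t)
      + (\<Sum>j\<in>UNIV. \<Sum>k\<in>UNIV. chern_christoffel g i j k (u (disc p v w t))
        * dz \<alpha> (\<lambda>z. u z $ j) (disc p v w t) * dzbar \<beta> (\<lambda>z. u z $ k) (disc p v w t)) = 0"
  shows "tension (chern_connection g) (\<lambda>t. u (disc p v w t)) t = 0"
proof -
  let ?F = "\<lambda>t. u (disc p v w t)"
  let ?S = "disc p v w -` V"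
  let ?X = "\<D> ?F t 1" and ?Y = "\<D> ?F t \<i>"
  let ?\<Gamma> = "chern_connection g (?F t)"
  have S: "open ?S" "t \<in> ?S" using open_disc_vimage V by auto
  have F: "smooth_on ?S ?F" by (rule smooth_on_compose[OF S(1) _ u smooth_on_disc[OF S(1)]]) auto
  have bl: "bounded_linear (\<lambda>x::complex^'n. x $ i)" for i by (rule bounded_linear_vec_nth)
  have \<phi>: "smooth_on V (\<lambda>z. u z $ i)" for i by (rule smooth_on_bounded_linear[OF V(1) bl u])
  have D1: "\<D> (\<lambda>t. ?F t $ i) t d = \<D> ?F t d $ i" for i d
    by (rule fderiv_bounded_linear(2)[OF bl smooth_onD[OF F S(2)]])
  have D2: "\<D> (\<lambda>t. \<D> (\<lambda>t. ?F t $ i) t d) t d = \<D> (\<lambda>t. \<D> ?F t d) t d $ i" for i d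
    by (rule second_fderiv_bounded_linear[OF S bl]) (use F in \<open>simp add: smooth_on_def\<close>)
  have "tension (chern_connection g) ?F t $ i = 0" for i
  proof -
    let ?C = "\<lambda>j k. chern_christoffel g i k j (?F t)"
    have eq': "dz \<alpha> (dzbar \<beta> (\<lambda>z. u z $ i)) (disc p v w t)
      + (\<Sum>j\<in>UNIV. \<Sum>k\<in>UNIV. ?C j k * dzbar \<beta> (\<lambda>z. u z $ j) (disc p v w t) * dz \<alpha> (\<lambda>z. u z $ k) (disc p v w t)) = 0" for \<alpha> \<beta>
      using eq[of \<alpha> \<beta> i] by (subst sum.swap) (simp add: mult_ac)
    have "\<D> (\<lambda>t. \<D> ?F t 1) t 1 $ i + \<D> (\<lambda>t. \<D> ?F t \<i>) t \<i> $ i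
      + (\<Sum>j\<in>UNIV. \<Sum>k\<in>UNIV. ?C j k * (?X $ j + \<i> * ?Y $ j) * (?X $ k - \<i> * ?Y $ k)) = 0"
      using pluriharmonic_disc[where \<phi> = "\<lambda>i z. u z $ i", OF V \<phi> eq'] unfolding D1 D2 .
    also have "(\<Sum>j\<in>UNIV. \<Sum>k\<in>UNIV. ?C j k * (?X $ j + \<i> * ?Y $ j) * (?X $ k - \<i> * ?Y $ k))
      = ?\<Gamma> ?X ?X $ i + ?\<Gamma> ?Y ?Y $ i + \<i> * (?\<Gamma> ?X ?Y $ i - ?\<Gamma> ?Y ?X $ i)"
      by (subst sum.swap)
        (simp add: chern_connection_def algebra_simps sum.distrib sum_subtractf sum_distrib_left)
    finally have "\<D> (\<lambda>t. \<D> ?F t 1) t 1 $ i + \<D> (\<lambda>t. \<D> ?F t \<i>) t \<i> $ i + (?\<Gamma> ?X ?X $ i + ?\<Gamma> ?Y ?Y $ i) = 0"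
      by (simp add: sym[of ?X ?Y])
    then show ?thesis by (simp add: tension_def cov_def algebra_simps)
  qed
  then show ?thesis by (simp add: vec_eq_iff)
qed

theorem pluriharmonic_kaehler_constant:
  fixes M :: "'a topology" and A :: "('a, complex^'m) chart set"
    and N :: "'b topology" and B :: "('b, complex^'n) chart set"
  assumes M: "complex_manifold M A" "compact_space M" "hermitian_metric A h" "positive_HSC A h"
    and N: "complex_manifold N B" "kaehler_metric B g"
      "nonpos_sectional_curvature (underlying_atlas B) (underlying_metric g)"
    and f: "pluriharmonic_kaehler M A N B g f"
  shows "f constant_on topspace M"
proof -
  have chart: "is_chart N d" if "d \<in> B" for d
    using N(1) that by (simp add: complex_manifold_def connected_manifold_def)
  have sm: "smooth_map M A N B f" using f by (simp add: pluriharmonic_kaehler_def)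
  have herm: "hermitian_metric B g" using N(2) by (simp add: kaehler_metric_def)
  have patch: "kaehler_patch (chart_image d) (g d)" if d: "d \<in> B" for d
  proof
    show "open (chart_image d)" by (rule chart_facts(4)[OF chart[OF d]])
    show "smooth_on (chart_image d) (g d)" using herm d unfolding hermitian_metric_def by blast
    fix y assume y: "y \<in> chart_image d"
    show "g d y $ j $ i = cnj (g d y $ i $ j)" for i j using herm d y unfolding hermitian_metric_def by blast
    show "0 < Re (herm_form (g d y) v v)" if "v \<noteq> 0" for v
      using herm d y that unfolding hermitian_metric_def by blast
    show "d_kaehler_form (g d) y X Y Z = 0" for X Y Z
      using N(2) d y unfolding kaehler_metric_def by blast
  qed
  interpret pluriharmonic_map M A h N B "\<lambda>d y. real_form (g d y)" "\<lambda>d. chern_connection (g d)" f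
  proof (rule pluriharmonic_map.intro)
    show "complex_manifold M A" "hermitian_metric A h" by fact+
    show "d \<in> B \<Longrightarrow> is_chart N d" for d by (rule chart)
    show "topspace N = (\<Union>d\<in>B. fst d)" using N(1) by (simp add: complex_manifold_def connected_manifold_def)
    show "transition d d' differentiable (at y)" if "d \<in> B" "d' \<in> B" "y \<in> overlap d d'" for d d' y
      using N(1) that unfolding complex_manifold_def holo_on_def differentiable_def by blast
    show "real_form (g d y) a b
      = real_form (g d' (transition d d' y)) (\<D> (transition d d') y a) (\<D> (transition d d') y b)"
      if "d \<in> B" "d' \<in> B" "y \<in> overlap d d'" for d d' y a b
    proof -
      have "herm_form (g d y) a b = herm_form (g d' (transition d d' y)) (\<D> (transition d d') y a) (\<D> (transition d d') y b)"
        using herm that unfolding hermitian_metric_def by blast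
      then show ?thesis by (simp add: real_form_def)
    qed
    show "nonpos_connection (chart_image d) (\<lambda>y. real_form (g d y)) (chern_connection (g d))" if d: "d \<in> B" for d
    proof (rule kaehler_patch.nonpos_connection_chern[OF patch[OF d]])
      let ?d = "(fst d, realify \<circ> snd d)"
      have "?d \<in> underlying_atlas B" using d by (auto simp: underlying_atlas_def)
      moreover have "chart_image ?d = realify ` chart_image d" by (simp add: chart_image_def image_comp)
      ultimately show "sectional_curvature (realified_metric (g d)) x X Y \<le> 0"
        if "x \<in> realify ` chart_image d" "X \<noteq> Y" "independent {X, Y}" for x X Y
        using N(3) that unfolding nonpos_sectional_curvature_def underlying_metric_realified[symmetric] by blast
    qed
    show "smooth_map M A N B f" by (rule sm)
    show "tension (chern_connection (g d)) (\<lambda>t. local_rep c d f (disc p v w t)) t = 0"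
      if cd: "c \<in> A" "d \<in> B" and t: "disc p v w t \<in> map_domain c d f" for c d p v w t
    proof (rule tension_chern_disc[OF _ t])
      have c: "is_chart M c" using M(1) cd by (simp add: complex_manifold_def connected_manifold_def)
      moreover have "continuous_map M N f" using sm by (simp add: smooth_map_def)
      ultimately show "open (map_domain c d f)" using open_map_domain[OF _ _ chart[OF cd(2)]] by blast
      show "smooth_on (map_domain c d f) (local_rep c d f)" using sm cd by (simp add: smooth_map_def)
      obtain q where "f q \<in> fst d" "local_rep c d f (disc p v w t) = snd d (f q)"
        by (rule map_domainE[OF c t])
      then have "local_rep c d f (disc p v w t) \<in> chart_image d" by (simp add: chart_image_def)
      then show "chern_connection (g d) (local_rep c d f (disc p v w t)) a b
        = chern_connection (g d) (local_rep c d f (disc p v w t)) b a" for a b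
        by (rule kaehler_patch.chern_connection_sym[OF patch[OF cd(2)]])
    qed (use f cd t in \<open>simp add: pluriharmonic_kaehler_def Let_def\<close>)
  qed
  show ?thesis by (rule constant_if_positive_HSC[OF M(2,4)])
qed

theorem corollary1p12:
  fixes M :: "'a topology" and A :: "('a, complex^'m) chart set"
    and h :: "('a, complex^'m) chart \<Rightarrow> complex^'m \<Rightarrow> complex^'m^'m"
  assumes "complex_manifold M A" and "compact_space M"
    and "hermitian_metric A h" and "positive_HSC A h"
  shows "(\<forall>(N :: 'b topology) (B :: ('b, real^'n) chart set) g f.
            smooth_manifold N B \<and> riemannian_metric B g \<and>
            nonpos_sectional_curvature B g \<and>
            pluriharmonic_riemannian M A N B g f
            \<longrightarrow> f constant_on topspace M)
       \<and> (\<forall>(N :: 'c topology) (B :: ('c, complex^'k) chart set) g f.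
            complex_manifold N B \<and> kaehler_metric B g \<and>
            nonpos_sectional_curvature (underlying_atlas B) (underlying_metric g) \<and>
            pluriharmonic_kaehler M A N B g f
            \<longrightarrow> f constant_on topspace M)"
  by (intro conjI allI impI; elim conjE;
      rule pluriharmonic_riemannian_constant[OF assms] pluriharmonic_kaehler_constant[OF assms]; assumption)

end
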